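(* Let $A$ be a Galois ring or a quasi-Galois ring, with maximal ideal $\mathfrak{m}_A$. If the residue field $A/\mathfrak{m}_A$ has odd characteristic and $|A/\mathfrak{m}_A|\neq 3,5,9$, then $$H_2(\mathrm{SL}_2(A),\mathbb{Z})=0.$$
   Context: $H_2(G,\mathbb{Z})$ is the second integral homology of the group $G$. Galois ring: for a prime $p$ and integers $l,m\ge 1$, $\mathrm{GR}(p^l,m):=(\mathbb{Z}/p^l)[X]/(f(X))$, where $f(X)\in(\mathbb{Z}/p^l)[X]$ is a monic polynomial of degree $m$ whose reduction in $\mathbb{F}_p[X]$ is irreducible. It is a finite local ring of characteristic $p^l$, order $p^{lm}$ and residue field $\mathbb{F}_{p^m}$, and is independent of $f$ up to isomorphism. Quasi-Galois ring: for a prime $p$ and integers $m,n\ge 1$, $A(p^m,n):=\mathbb{F}_{p^m}[X]/(X^n)$. *)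

theory Defs
  imports "HOL-Algebra.Algebra" "HOL-Number_Theory.Residues"
begin

section \<open>Integral group homology\<close>

text \<open>
  The complex \<open>\<int> \<otimes>\<^bsub>\<int>G\<^esub> B\<close>, where \<open>B\<close> is the (unnormalised) bar resolution of \<open>\<int>\<close> over
  \<open>\<int>G\<close>. In degree \<open>n\<close> it is the free abelian group on the symbols
  \<open>[g\<^sub>1|...|g\<^sub>n]\<close>, represented by lists of length \<open>n\<close>, with differential
  \<open>[g\<^sub>2|...|g\<^sub>n] + (\<Sum>0<i<n. (-1)\<^sup>i [g\<^sub>1|...|g\<^sub>i g\<^sub>i\<^sub>+\<^sub>1|...|g\<^sub>n]) + (-1)\<^sup>n [g\<^sub>1|...|g\<^sub>n\<^sub>-\<^sub>1]\<close>.
\<close>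

definition bar_chain_group :: "('g, 'm) monoid_scheme \<Rightarrow> nat \<Rightarrow> ('g list \<Rightarrow>\<^sub>0 int) monoid" where
  "bar_chain_group G n = free_Abelian_group {gs. length gs = n \<and> set gs \<subseteq> carrier G}"

definition bar_face :: "('g, 'm) monoid_scheme \<Rightarrow> nat \<Rightarrow> 'g list \<Rightarrow> 'g list" where
  "bar_face G i gs =
     (if i = 0 then tl gs
      else if i = length gs then butlast gs
      else take (i - 1) gs @ [gs ! (i - 1) \<otimes>\<^bsub>G\<^esub> gs ! i] @ drop (i + 1) gs)"

definition bar_boundary :: "('g, 'm) monoid_scheme \<Rightarrow> ('g list \<Rightarrow>\<^sub>0 int) \<Rightarrow> ('g list \<Rightarrow>\<^sub>0 int)" where
  "bar_boundary G =
     frag_extend (\<lambda>gs. if gs = [] then 0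
       else (\<Sum>i\<le>length gs. frag_cmul ((-1) ^ i) (frag_of (bar_face G i gs))))"

text \<open>
  In degree \<open>0\<close> the target \<open>n - 1\<close> of the differential is again \<open>0\<close>; this is immaterial, since
  the differential vanishes there.
\<close>

definition bar_cycles :: "('g, 'm) monoid_scheme \<Rightarrow> nat \<Rightarrow> ('g list \<Rightarrow>\<^sub>0 int) set" where
  "bar_cycles G n = kernel (bar_chain_group G n) (bar_chain_group G (n - 1)) (bar_boundary G)"

definition bar_boundaries :: "('g, 'm) monoid_scheme \<Rightarrow> nat \<Rightarrow> ('g list \<Rightarrow>\<^sub>0 int) set" where
  "bar_boundaries G n = bar_boundary G ` carrier (bar_chain_group G (Suc n))"

definition group_homology :: "nat \<Rightarrow> ('g, 'm) monoid_scheme \<Rightarrow> ('g list \<Rightarrow>\<^sub>0 int) set monoid" where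
  "group_homology n G =
     subgroup_generated (bar_chain_group G n) (bar_cycles G n) Mod bar_boundaries G n"


section \<open>The special linear group of degree two\<close>

text \<open>The tuple \<open>(a, b, c, d)\<close> stands for the matrix with rows \<open>(a, b)\<close> and \<open>(c, d)\<close>.\<close>

definition SL2 :: "('a, 'r) ring_scheme \<Rightarrow> ('a \<times> 'a \<times> 'a \<times> 'a) monoid" where
  "SL2 A =
     \<lparr> carrier = {(a, b, c, d). a \<in> carrier A \<and> b \<in> carrier A \<and> c \<in> carrier A \<and> d \<in> carrier A \<and>
                    (a \<otimes>\<^bsub>A\<^esub> d) \<ominus>\<^bsub>A\<^esub> (b \<otimes>\<^bsub>A\<^esub> c) = \<one>\<^bsub>A\<^esub>},
       monoid.mult = (\<lambda>(a, b, c, d) (a', b', c', d').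
         (a \<otimes>\<^bsub>A\<^esub> a' \<oplus>\<^bsub>A\<^esub> b \<otimes>\<^bsub>A\<^esub> c', a \<otimes>\<^bsub>A\<^esub> b' \<oplus>\<^bsub>A\<^esub> b \<otimes>\<^bsub>A\<^esub> d',
          c \<otimes>\<^bsub>A\<^esub> a' \<oplus>\<^bsub>A\<^esub> d \<otimes>\<^bsub>A\<^esub> c', c \<otimes>\<^bsub>A\<^esub> b' \<oplus>\<^bsub>A\<^esub> d \<otimes>\<^bsub>A\<^esub> d')),
       one = (\<one>\<^bsub>A\<^esub>, \<zero>\<^bsub>A\<^esub>, \<zero>\<^bsub>A\<^esub>, \<one>\<^bsub>A\<^esub>) \<rparr>"


section \<open>Galois and quasi-Galois rings\<close>

text \<open>
  Polynomials are coefficient lists with the leading coefficient first, and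
  \<open>rupture R (carrier R) f\<close> is the quotient \<open>R[X]/(f)\<close>. Both notions below are closed under ring
  isomorphism. The assumption \<^term>\<open>cring A\<close> is needed because \<open>\<simeq>\<close> does not constrain the field
  \<^term>\<open>zero A\<close> of the record.
\<close>

definition galois_polynomial :: "nat \<Rightarrow> nat \<Rightarrow> nat \<Rightarrow> int list \<Rightarrow> bool" where
  "galois_polynomial p l m f \<longleftrightarrow>
     f \<in> carrier (univ_poly (residue_ring (int p ^ l)) (carrier (residue_ring (int p ^ l)))) \<and>
     f \<noteq> [] \<and> lead_coeff f = 1 \<and> degree f = m \<and>
     pirreducible\<^bsub>residue_ring (int p)\<^esub> (carrier (residue_ring (int p))) (map (\<lambda>a. a mod int p) f)"

definition galois_ring :: "('a, 'r) ring_scheme \<Rightarrow> bool" where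
  "galois_ring A \<longleftrightarrow> cring A \<and>
     (\<exists>p l m f. Factorial_Ring.prime p \<and> l \<ge> 1 \<and> m \<ge> 1 \<and> galois_polynomial p l m f \<and>
        A \<simeq> rupture (residue_ring (int p ^ l)) (carrier (residue_ring (int p ^ l))) f)"

text \<open>
  The field \<open>\<bbbF>\<^bsub>p^m\<^esub>\<close> is any field with \<open>p^m\<close> elements. Taking its carrier inside \<^typ>\<open>nat\<close> is no
  restriction, because every finite field is isomorphic to one whose carrier is a set of
  natural numbers.
\<close>

definition quasi_galois_ring :: "('a, 'r) ring_scheme \<Rightarrow> bool" where
  "quasi_galois_ring A \<longleftrightarrow> cring A \<and>
     (\<exists>p m (n :: nat) (F :: nat ring). Factorial_Ring.prime p \<and> m \<ge> 1 \<and> n \<ge> 1 \<and> field F \<and> card (carrier F) = p ^ m \<and>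
        A \<simeq> rupture F (carrier F) (X\<^bsub>F\<^esub> [^]\<^bsub>univ_poly F (carrier F)\<^esub> n))"

text \<open>The additive order of \<open>1\<close>, which is \<open>0\<close> if that order is infinite.\<close>

definition ring_char :: "('a, 'r) ring_scheme \<Rightarrow> nat" where
  "ring_char R = group.ord (add_monoid R) \<one>\<^bsub>R\<^esub>"

end

theory Submission
  imports Defs "HOL-Computational_Algebra.Computational_Algebra"
begin

text \<open>
  The rings in question are finite local rings \<open>A\<close> whose maximal ideal is generated by a nilpotent
  \<open>t\<close>, with \<open>p = 0\<close> or \<open>p\<close> a unit multiple of \<open>t\<close>. That \<open>H\<^sub>2\<close> vanishes means that the universal
  cocycle extension of \<open>SL\<^sub>2(A)\<close> by the \<open>2\<close>-chains modulo boundaries splits, and in fact every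
  central extension does. Conjugation by a torus element \<open>diag(r, 1/r)\<close> with \<open>r\<^sup>2 - 1\<close> a unit
  selects canonical lifts of the elementary matrices. The commutators of lifts of the upper
  unitriangular matrices form a bilinear pairing, invariant under the torus; a unit \<open>r\<close> at which
  some quadratic polynomials take unit values forces it to vanish, and such an \<open>r\<close> exists unless
  the residue field has \<open>3\<close>, \<open>5\<close> or \<open>9\<close> elements. So the canonical lifts satisfy the defining
  relations of the Steinberg group, and the obstruction to a splitting is the commutator pairing of
  the lifted torus elements: a bimultiplicative alternating symbol on \<open>A\<^sup>\<times>\<close> with the Steinberg
  relation. It has odd exponent, a power of \<open>p\<close> (the residue field has cyclic unit group), and a
  descending induction along the powers of \<open>t\<close>, using \<open>p\<close>-th powers of units \<open>1 - t g\<close>, shows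
  that it is trivial.
\<close>

section \<open>Symbols on local rings\<close>

text \<open>Torus invariance lets a factor u^2 cross the commutator pairing as u^(-2). Applied to
  (r+1)^2 + (r-1)^2 = 2 r^2 + 2, this shows that (r+1)^(-2) + (r-1)^(-2) - 2 r^(-2) - 2 annihilates
  the pairing; up to a unit square it is -2 (r^2+1)(r^2-r-1)(r^2+r-1). A field with 3 elements
  offers only 0, 1, -1; with 5 elements, 2 and 3 are roots of r^2+1; with 9 elements, the elements
  of order 4 are roots of r^2+1 and those of order 8 of the other two factors, whose product is
  r^4+1 in characteristic 3.

  Vanishing of the commutator symbol only makes the torus lifts commute. Their multiplicativity in
  the argument u follows at once when one factor is a square; for two nonsquares it is reduced to a
  relation attached to a + b = 1, which requires writing 1 as a sum of two nonsquare units.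

  A symbol lives on pairs of units, while the descending induction needs non-unit arguments. It
  therefore runs on a Dennis--Stein pairing <a,b>, with a in the maximal ideal and b arbitrary,
  which is additive in b under b + c - a b c.\<close>

lemma unit_mult_iff: "(a * b :: 'r::comm_ring_1) dvd 1 \<longleftrightarrow> a dvd 1 \<and> b dvd 1"
  by (metis dvd_mult_left dvd_mult_right mult_dvd_mono mult_1)

lemma unit_power: "(a :: 'r::comm_ring_1) dvd 1 \<Longrightarrow> a ^ k dvd 1"
  by (induction k) (auto simp: unit_mult_iff)

locale local_ring =
  fixes M :: "'r::comm_ring_1 set"
  assumes mem_iff: "a \<in> M \<longleftrightarrow> \<not> a dvd 1"
    and add_mem: "a \<in> M \<Longrightarrow> b \<in> M \<Longrightarrow> a + b \<in> M"
begin

lemma zero_mem: "0 \<in> M" by (simp add: mem_iff)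

lemma mult_mem: "a \<in> M \<Longrightarrow> a * b \<in> M" "a \<in> M \<Longrightarrow> b * a \<in> M"
  by (auto simp: mem_iff unit_mult_iff)

lemma uminus_mem: "a \<in> M \<Longrightarrow> - a \<in> M" by (simp add: mem_iff)

lemma diff_mem: "a \<in> M \<Longrightarrow> b \<in> M \<Longrightarrow> a - b \<in> M"
  using add_mem[of a "-b"] uminus_mem by simp

lemma unit_add: "u dvd 1 \<Longrightarrow> a \<in> M \<Longrightarrow> u + a dvd 1"
  using diff_mem[of "u + a" a] mem_iff by auto

lemma unit_diff: "u dvd 1 \<Longrightarrow> a \<in> M \<Longrightarrow> u - a dvd 1"
  using unit_add[of u "-a"] uminus_mem by simp

lemma unit_cong: "a - b \<in> M \<Longrightarrow> a dvd 1 \<longleftrightarrow> b dvd 1"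
  using unit_diff[of a "a-b"] unit_add[of b "a-b"] by auto

lemma unit_one_diff: "a \<in> M \<Longrightarrow> 1 - a dvd 1" using unit_diff[of 1 a] by simp

end

locale symbol = local_ring M for M :: "'r::comm_ring_1 set" +
  fixes B :: "'r \<Rightarrow> 'r \<Rightarrow> 'c::ab_group_add"
  assumes mult_left: "u dvd 1 \<Longrightarrow> u' dvd 1 \<Longrightarrow> v dvd 1 \<Longrightarrow> B (u * u') v = B u v + B u' v"
    and anti: "u dvd 1 \<Longrightarrow> v dvd 1 \<Longrightarrow> B v u = - B u v"
    and alt: "u dvd 1 \<Longrightarrow> B u u = 0"
    and steinberg: "u dvd 1 \<Longrightarrow> v dvd 1 \<Longrightarrow> u + v = 1 \<Longrightarrow> B u v = 0"
begin

lemma mult_right: "u dvd 1 \<Longrightarrow> v dvd 1 \<Longrightarrow> v' dvd 1 \<Longrightarrow> B u (v * v') = B u v + B u v'"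
  by (metis anti mult_left minus_add_distrib unit_mult_iff)

lemma one_left: "v dvd 1 \<Longrightarrow> B 1 v = 0"
  using mult_left[of 1 1 v] by simp

lemma one_right: "v dvd 1 \<Longrightarrow> B v 1 = 0"
  using mult_right[of v 1 1] by simp

lemma inv_left: "u * u' = 1 \<Longrightarrow> v dvd 1 \<Longrightarrow> B u' v = - B u v"
  using mult_left[of u u' v] one_left[of v]
  by (metis add_eq_0_iff dvd_def mult.commute)

lemma inv_right: "u * u' = 1 \<Longrightarrow> v dvd 1 \<Longrightarrow> B v u' = - B v u"
  using mult_right[of v u u'] one_right[of v]
  by (metis add_eq_0_iff dvd_def mult.commute)

lemmas bilin = mult_left mult_right unit_mult_iff

text \<open>Put u o v = u + v - a u v, so that 1 - a (u o v) = (1 - a u)(1 - a v). Dividing w = u +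
  v (1 - a u) and w = v + u (1 - a v) by w gives two Steinberg relations; in their sum all terms
  without a factor 1 - a u or 1 - a v cancel by antisymmetry. Thus \<open>B u (1 - a * u)\<close> is
  additive in u for this circle operation.\<close>

lemma phi_add:
  assumes a: "a \<in> M" and u: "u dvd 1" and v: "v dvd 1" and w: "w dvd 1"
    and e: "w = u + v - a * u * v"
  shows "B u (1 - a * u) + B v (1 - a * v) = B w (1 - a * w)"
proof -
  obtain w' where w': "w * w' = 1" using w by (auto simp: dvd_def)
  have uw': "w' dvd 1" using w' by (metis dvd_triv_right)
  define P where "P = 1 - a * u"
  define Q where "Q = 1 - a * v"
  have uP: "P dvd 1" and uQ: "Q dvd 1"
    unfolding P_def Q_def using a by (auto intro!: unit_one_diff mult_mem(1))
  have PQ: "1 - a * w = P * Q" unfolding P_def Q_def e by (simp add: algebra_simps)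
  have "u * w' + v * P * w' = w * w'" unfolding P_def e by (simp add: algebra_simps)
  hence 1: "B (u * w') (v * P * w') = 0" using w' u v uP uw' by (intro steinberg) (auto simp: unit_mult_iff)
  have "v * w' + u * Q * w' = w * w'" unfolding Q_def e by (simp add: algebra_simps)
  hence 2: "B (v * w') (u * Q * w') = 0" using w' u v uQ uw' by (intro steinberg) (auto simp: unit_mult_iff)
  have inv: "B w' x = - B w x" "B x w' = - B x w" if "x dvd 1" for x
    using that inv_left[OF w' that] inv_right[OF w' that] by auto
  have "0 = B (u * w') (v * P * w') + B (v * w') (u * Q * w')" using 1 2 by simp
  also have "\<dots> = B u P + B v Q - B w P - B w Q"
    using u v uP uQ uw' w anti[OF u v] anti[OF u w] anti[OF v w] by (simp add: bilin inv alt)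
  finally show ?thesis unfolding PQ using w uP uQ by (simp add: bilin P_def[symmetric] Q_def[symmetric] algebra_simps)
qed

section \<open>The Dennis--Stein pairing of a symbol\<close>

text \<open>For units \<open>a\<close> this is \<open>B (1 - ab) a\<close>: the two expressions agree by a Steinberg relation, but
  the one below makes sense for \<open>a, b \<in> M\<close>, where it plays the role of the Dennis--Stein symbol.\<close>

definition E :: "'r \<Rightarrow> 'r \<Rightarrow> 'c" where
  "E a b = B (1 - a) (1 - b) + B (1 - b) (1 - a * b) + B (1 - a * b) (1 - a)"

text \<open>The Dennis--Stein symbol <a,b>. Its value at a unit b comes from \<open>phi_add\<close>,
  the one at a unit a is forced by antisymmetry, and \<open>E\<close> extends it to pairs of
  non-units.\<close>

definition D :: "'r \<Rightarrow> 'r \<Rightarrow> 'c" where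
  "D a b = (if a dvd 1 then B (1 - a * b) a else if b dvd 1 then B b (1 - a * b) else E a b)"

lemma D_unit_right:
  assumes "b dvd 1" "a \<in> M" shows "D a b = B b (1 - a * b)"
  using assms mem_iff by (auto simp: D_def)

lemma D_unit_left: "a dvd 1 \<Longrightarrow> D a b = B (1 - a * b) a"
  by (auto simp: D_def)

lemma D_nonunit: "a \<in> M \<Longrightarrow> b \<in> M \<Longrightarrow> D a b = E a b"
  using mem_iff by (auto simp: D_def)

lemma D_anti: assumes "a \<in> M" shows "D b a = - D a b"
proof (cases "b dvd 1")
  case True
  thus ?thesis using assms anti[of "1 - a * b" b]
    by (simp add: D_unit_right D_unit_left mult.commute unit_one_diff mult_mem)
next
  case False
  hence b: "b \<in> M" by (simp add: mem_iff)
  have *: "1 - a dvd 1" "1 - b dvd 1" "1 - a * b dvd 1" using assms b by (auto intro!: unit_one_diff mult_mem)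
  show ?thesis using assms b anti[OF *(1,2)] anti[OF *(2,3)] anti[OF *(3,1)]
    by (simp add: D_nonunit E_def mult.commute)
qed

end

section \<open>Symbols killed by an odd number\<close>

lemma sum_const_add: fixes m n :: nat shows "(\<Sum>i<m + n. x) = (\<Sum>i<m. x) + (\<Sum>i<n. x :: 'c::comm_monoid_add)"
  by (induction n) (auto simp: algebra_simps)

lemma sum_const_mult: fixes m n :: nat shows "(\<Sum>i<m * n. x) = (\<Sum>i<n. \<Sum>j<m. x :: 'c::comm_monoid_add)"
  by (induction n) (simp_all add: sum_const_add add.commute)

text \<open>Constant sums play the role of integer multiples, the value group being a bare
  \<open>ab_group_add\<close>. With k a = l b + 1, the two vanishing multiples leave x = 0.\<close>

lemma coprime_torsion:
  fixes x :: "'c::ab_group_add" and k l :: nat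
  assumes "coprime k l" "(\<Sum>i<k. x) = 0" "(\<Sum>i<l. x) = 0"
  shows "x = 0"
proof (cases "k = 0")
  case True
  hence "l = 1" using assms(1) by simp
  thus ?thesis using assms(3) by simp
next
  case False
  then obtain a b where "k * a = l * b + 1" using assms(1) bezout_nat[of k l] by auto
  hence "(\<Sum>i<k * a. x) = (\<Sum>i<l * b. x) + x" by (simp only: sum_const_add) simp
  thus ?thesis using assms(2,3) by (simp add: sum_const_mult)
qed

text \<open>The assumption \<open>three\<close> says that the residue field has more than two
  elements: 0, 1 and r are pairwise distinct modulo M.\<close>

locale odd_symbol = symbol M B for M :: "'r::comm_ring_1 set" and B :: "'r \<Rightarrow> 'r \<Rightarrow> 'c::ab_group_add" +
  fixes p :: nat
  assumes p_odd: "odd p" and p_tors: "u dvd 1 \<Longrightarrow> v dvd 1 \<Longrightarrow> (\<Sum>i<p. B u v) = 0"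
    and three: "\<exists>r. r dvd 1 \<and> 1 - r dvd (1::'r)"
begin

lemma power_left: "u dvd 1 \<Longrightarrow> v dvd 1 \<Longrightarrow> B (u ^ k) v = (\<Sum>i<k. B u v)"
  by (induction k) (auto simp: one_left mult_left unit_power add.commute)

text \<open>As p is odd, (-1)^p = -1, so the value equals its own p-fold multiple, which is
  0.\<close>

lemma minus_one_left: assumes "v dvd 1" shows "B (-1) v = 0"
proof -
  have "(-1) ^ p = (-1::'r)" using p_odd by simp
  thus ?thesis using power_left[of "-1" v p] p_tors[of "-1" v] assms by simp
qed

lemma uminus_left: "u dvd 1 \<Longrightarrow> v dvd 1 \<Longrightarrow> B (- u) v = B u v"
  using mult_left[of "-1" u v] minus_one_left[of v] by simp

text \<open>A non-unit b is 1 o u for u = -(1 - b)/(1 - a), a unit congruent to -1. Since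
  \<open>B 1 (1 - a) = 0\<close>, additivity for the circle operation forces the value
  \<open>B u (1 - a * u)\<close> at b, and this expands to \<open>E a b\<close> once the sign of u
  is dropped by \<open>uminus_left\<close>.\<close>

lemma E_eq:
  assumes a: "a \<in> M" and b: "b \<in> M"
  obtains u where "u dvd 1" "b = 1 + u - a * 1 * u" "u + 1 \<in> M" "E a b = B u (1 - a * u)"
proof -
  define P Q S where "P = 1 - a" and "Q = 1 - b" and "S = 1 - a * b"
  have un: "P dvd 1" "Q dvd 1" "S dvd 1" unfolding P_def Q_def S_def
    using a b by (auto intro!: unit_one_diff mult_mem(1))
  obtain P' where P': "P * P' = 1" using un by (auto simp: dvd_def)
  have uP': "P' dvd 1" using P' by (metis dvd_triv_right)
  define u where "u = - (Q * P')"
  have uu: "u dvd 1" by (simp add: u_def unit_mult_iff un uP')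
  have 1: "1 + u - a * 1 * u = 1 - Q * (P * P')" unfolding u_def P_def by (simp add: algebra_simps)
  hence 1: "b = 1 + u - a * 1 * u" using P' by (simp add: Q_def)
  have "1 - a * u = P * P' + a * Q * P'" using P' by (simp add: u_def)
  also have "\<dots> = S * P'" by (simp add: P_def Q_def S_def algebra_simps)
  finally have 2: "1 - a * u = S * P'" .
  have "u + 1 = b + a * u" using 1 by simp
  hence 3: "u + 1 \<in> M" using a b add_mem mult_mem by simp
  have "B u (1 - a * u) = B (Q * P') (S * P')" unfolding 2 unfolding u_def
    using un uP' by (intro uminus_left) (auto simp: unit_mult_iff)
  also have "\<dots> = B Q S + B P Q + B S P"
    using un uP' inv_left[OF P'] inv_right[OF P'] anti[OF un(1,2)] anti[OF un(1,3)] alt[OF un(1)]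
    by (simp add: bilin)
  finally have "E a b = B u (1 - a * u)" by (simp add: E_def P_def Q_def S_def)
  with uu 1 3 show ?thesis using that by blast
qed

text \<open>Writing b = 1 o u turns b o v into 1 o (u o v), and \<open>phi_add\<close> applies twice
  provided u o v is a unit. Modulo M the latter is v - 1; if that vanishes, v is split as s o r with
  r from \<open>three\<close>.\<close>

lemma D_circ_unit:
  assumes a: "a \<in> M" and b: "b \<in> M" and v: "v dvd 1"
  shows "D a (b + v - a * b * v) = D a b + D a v"
proof -
  obtain u where u: "u dvd 1" "b = 1 + u - a * 1 * u" "u + 1 \<in> M" "E a b = B u (1 - a * u)"
    using E_eq[OF a b] .
  have main: "D a (b + v - a * b * v) = D a b + D a v" if v: "v dvd 1" and v1: "1 - v dvd 1" for v
  proof -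
    define x where "x = u + v - a * u * v"
    have "x - (v - 1) = (u + 1) - a * u * v" by (simp add: x_def)
    also have "\<dots> \<in> M" using u(3) a by (intro diff_mem mult_mem(1)) auto
    finally have "x dvd 1 \<longleftrightarrow> v - 1 dvd 1" by (rule unit_cong)
    hence x: "x dvd 1" using v1 minus_dvd_iff[of "v - 1" 1] by simp
    define w where "w = b + v - a * b * v"
    have w': "w = 1 + x - a * 1 * x" unfolding w_def x_def u(2) by (simp add: algebra_simps)
    have "w - v = b - a * b * v" by (simp add: w_def)
    also have "\<dots> \<in> M" using a b by (intro diff_mem mult_mem(1)) auto
    finally have w: "w dvd 1" using v unit_cong by blast
    have "B w (1 - a * w) = B x (1 - a * x)"
      using phi_add[OF a _ x w w'] one_left[of "1 - a"] a unit_one_diff by simp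
    also have "\<dots> = B u (1 - a * u) + B v (1 - a * v)"
      using phi_add[OF a u(1) v x x_def] by simp
    finally show ?thesis using u a b v w by (simp add: D_unit_right D_nonunit w_def)
  qed
  show ?thesis
  proof (cases "1 - v dvd 1")
    case True thus ?thesis using main v by blast
  next
    case False
    hence v1: "1 - v \<in> M" by (simp add: mem_iff)
    obtain r :: 'r where r: "r dvd 1" "1 - r dvd 1" using three by blast
    have ar: "1 - a * r dvd 1" using a by (intro unit_one_diff mult_mem)
    then obtain q where q: "(1 - a * r) * q = 1" by (auto simp: dvd_def)
    \<comment> \<open>The solution of v = s o r. As v is 1 modulo M, s is 1 - r there, so s and 1 -
      s are both units.\<close>
    define s where "s = (v - r) * q"
    have qu: "q dvd 1" using q by (metis dvd_triv_right)
    have vs: "v = s + r - a * s * r"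
    proof -
      have "s + r - a * s * r = (v - r) * ((1 - a * r) * q) + r" unfolding s_def by (simp add: algebra_simps)
      thus ?thesis using q by simp
    qed
    have "(v - r) - (1 - r) \<in> M" using uminus_mem[OF v1] by simp
    hence "v - r dvd 1" using unit_cong r by blast
    hence s: "s dvd 1" by (simp add: s_def unit_mult_iff qu)
    have "s - (1 - r) = - (1 - v) + a * s * r" using vs by (simp add: algebra_simps)
    also have "\<dots> \<in> M" using a v1 by (intro add_mem uminus_mem mult_mem(1)) auto
    finally have sr: "s - (1 - r) \<in> M" .
    have "(1 - s) - r = - (s - (1 - r))" by simp
    also have "\<dots> \<in> M" using sr uminus_mem by blast
    finally have s1: "1 - s dvd 1" using r unit_cong by blast
    define c where "c = b + s - a * b * s"
    have "c - s = b - a * b * s" by (simp add: c_def)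
    also have "\<dots> \<in> M" using a b by (intro diff_mem mult_mem(1)) auto
    finally have c: "c dvd 1" using s unit_cong by blast
    define w where "w = b + v - a * b * v"
    have "w - v = b - a * b * v" by (simp add: w_def)
    also have "\<dots> \<in> M" using a b by (intro diff_mem mult_mem(1)) auto
    finally have w: "w dvd 1" using v unit_cong by blast
    have "w = c + r - a * c * r" unfolding w_def c_def vs by (simp add: algebra_simps)
    hence "D a w = D a c + D a r" using phi_add[OF a c r(1) w] a c r w by (simp add: D_unit_right)
    moreover have "D a c = D a b + D a s" unfolding c_def using main[OF s s1] .
    moreover have "D a v = D a s + D a r" using phi_add[OF a s r(1) v vs] a s r v by (simp add: D_unit_right)
    ultimately show ?thesis by (simp add: w_def[symmetric] add.assoc)
  qed
qed

text \<open>The circle operation is associative, so D a x can be added and cancelled again if x, c o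
  x and b o (c o x) are units. When b or b + c lies in M, two of these three conditions agree modulo
  M and three residue classes suffice to find x; the remaining cases are direct.\<close>

lemma D_circ:
  assumes a: "a \<in> M"
  shows "D a (b + c - a * b * c) = D a b + D a c"
proof -
  have comm: "b + c - a * b * c = c + b - a * c * b" for b c by (simp add: algebra_simps)
  have unit: "D a (b + v - a * b * v) = D a b + D a v" if v: "v dvd 1" and w: "b + v - a * b * v dvd 1" for b v
  proof (cases "b dvd 1")
    case True
    thus ?thesis using phi_add[OF a True v w] a v w by (simp add: D_unit_right)
  qed (use D_circ_unit[OF a] v mem_iff in blast)
  have cancel: ?thesis if x: "x dvd 1" "c + x - a * c * x dvd 1"
     "b + (c + x - a * c * x) - a * b * (c + x - a * c * x) dvd 1" for x
  proof -
    let ?y = "c + x - a * c * x" and ?w = "b + c - a * b * c"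
    have e: "b + ?y - a * b * ?y = ?w + x - a * ?w * x" by (simp add: algebra_simps)
    have "D a ?w + D a x = D a (b + ?y - a * b * ?y)" using unit[OF x(1), of ?w] x(3) unfolding e by simp
    also have "\<dots> = D a b + (D a c + D a x)" using unit[OF x(2) x(3)] unit[OF x(1,2)] by simp
    finally show ?thesis by (simp add: add.assoc[symmetric])
  qed
  obtain r :: 'r where r: "r dvd 1" "1 - r dvd 1" using three by blast
  have key: "\<exists>x. x dvd 1 \<and> c + x dvd 1 \<and> b + c + x dvd 1" if "b \<in> M \<or> b + c \<in> M"
  proof -
    have *: "\<exists>x. x dvd 1 \<and> c + x dvd 1"
    proof (cases "c \<in> M")
      case True thus ?thesis using unit_add[of 1 c] by (auto simp: add.commute intro!: exI[of _ 1])
    next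
      case False
      hence c: "c dvd 1" by (simp add: mem_iff)
      have "c + - (c * r) = c * (1 - r)" by (simp add: algebra_simps)
      hence "c + - (c * r) dvd 1" using c r by (simp only: unit_mult_iff)
      thus ?thesis using c r by (intro exI[of _ "- (c * r)"]) (auto simp: unit_mult_iff)
    qed
    then obtain x where x: "x dvd 1" "c + x dvd 1" by blast
    have "b + c + x dvd 1" using that unit_add[of "c + x" b] unit_add[of x "b + c"] x
      by (auto simp: algebra_simps)
    with x show ?thesis by blast
  qed
  consider "b \<in> M \<or> b + c \<in> M" | "b \<notin> M" "c \<in> M" | "b \<notin> M" "c \<notin> M" "b + c \<notin> M" by blast
  thus ?thesis
  proof cases
    case 1
    then obtain x where x: "x dvd 1" "c + x dvd 1" "b + c + x dvd 1" using key by blast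
    have m: "y - a * z \<in> M \<longleftrightarrow> y \<in> M" for y z
      using diff_mem[of y "a * z"] add_mem[of "y - a * z" "a * z"] mult_mem(1)[OF a, of z] by auto
    have "c + x - a * c * x \<notin> M" using x m[of "c + x" "c * x"] mem_iff by (simp add: mult.assoc)
    have "b + (c + x - a * c * x) - a * b * (c + x - a * c * x)
       = (b + c + x) - a * (c * x + b * (c + x - a * c * x))" by (simp add: algebra_simps)
    moreover have "(b + c + x) - a * (c * x + b * (c + x - a * c * x)) \<notin> M" using x(3) m mem_iff by blast
    ultimately have "b + (c + x - a * c * x) - a * b * (c + x - a * c * x) \<notin> M" by (simp only: not_False_eq_True)
    with \<open>c + x - a * c * x \<notin> M\<close> show ?thesis using cancel[OF x(1)] mem_iff by blast
  next
    case 2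
    thus ?thesis using D_circ_unit[OF a, of c b] mem_iff unfolding comm[of b c] by (simp add: add.commute)
  next
    case 3
    have "b + c - a * b * c dvd 1" using 3 unit_diff[of "b + c" "a * b * c"] mem_iff a mult_mem(1) by (simp add: mult.assoc)
    thus ?thesis using unit 3 mem_iff by blast
  qed
qed

lemma D_zero: "a \<in> M \<Longrightarrow> D a 0 = 0"
  using D_circ[of a 0 0] by simp

text \<open>For b in M the element b o 1 is a unit, so a map additive for the circle operation is
  determined by its values at units.\<close>

lemma D_eqI:
  assumes a: "a \<in> M" and "\<And>u. u dvd 1 \<Longrightarrow> f u = (g u :: 'c)"
   and f: "\<And>b c. f (b + c - a * b * c) = f b + f c"
   and g: "\<And>b c. g (b + c - a * b * c) = g b + g c"
  shows "f b = g b"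
proof (cases "b dvd 1")
  case False
  have e: "b + 1 - a * b * 1 = 1 + (b - a * b)" by simp
  have "b - a * b \<in> M" using a False by (intro diff_mem mult_mem) (auto simp: mem_iff)
  hence "b + 1 - a * b * 1 dvd 1" unfolding e by (intro unit_add) auto
  hence "f b + f 1 = g b + g 1" using f[of b 1] g[of b 1] assms(2) by simp
  thus ?thesis using assms(2)[of 1] by simp
qed (use assms in auto)

text \<open>The Dennis--Stein identity. Both sides are additive in c for the circle operation with
  parameter a b and, for unit c, additive in a for the one with parameter b c. Two uses of
  \<open>D_eqI\<close> leave units a and c, where it is multiplicativity of B in its first
  argument.\<close>

lemma D_cocycle:
  assumes a: "a \<in> M" and b: "b \<in> M"
  shows "D (a * b) c = D a (b * c) + D b (a * c)"
proof -
  have D': "D (x + y - x * y * c) c = D x c + D y c" if "c \<in> M" for x y c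
  proof -
    have "D (x + y - x * y * c) c = - D c (x + y - c * x * y)"
      by (subst D_anti[OF that, symmetric]) (simp add: mult_ac)
    thus ?thesis using that by (simp add: D_circ D_anti)
  qed
  have main: "D (a * b) c = D a (b * c) + D b (a * c)" if c: "c dvd 1" for c
  proof -
    have cb: "b * c \<in> M" using b mult_mem by blast
    have "D (a * b) c = D a (b * c) + D b (a * c)"
    proof (rule D_eqI[OF cb, where f = "\<lambda>a. D (a * b) c" and g = "\<lambda>a. D a (b * c) + D b (a * c)"])
      fix u :: 'r assume u: "u dvd 1"
      have 1: "1 - u * b * c dvd 1" using b by (intro unit_one_diff mult_mem(1) mult_mem(2))
      have "D (u * b) c = B c (1 - u * b * c)" using b c by (intro D_unit_right mult_mem(2))
      moreover have "D u (b * c) = B (1 - u * b * c) u" using u by (simp add: D_unit_left mult_ac)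
      moreover have "D b (u * c) = B (u * c) (1 - u * b * c)" using b c u
        by (subst D_unit_right) (auto simp: mult_ac unit_mult_iff)
      ultimately show "D (u * b) c = D u (b * c) + D b (u * c)"
        using anti[OF u 1] c u 1 by (simp add: mult_left)
    next
      fix x y
      show "D ((x + y - b * c * x * y) * b) c = D (x * b) c + D (y * b) c"
      proof -
        have "D ((x + y - b * c * x * y) * b) c = B c ((1 - x * b * c) * (1 - y * b * c))"
          using c mult_mem(2)[OF b, of "x + y - b * c * x * y"] by (subst D_unit_right) (auto simp: algebra_simps)
        also have "\<dots> = B c (1 - x * b * c) + B c (1 - y * b * c)"
          using c b by (intro mult_right unit_one_diff mult_mem(1) mult_mem(2)) auto
        also have "\<dots> = D (x * b) c + D (y * b) c" using b c by (simp add: D_unit_right mult_mem)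
        finally show ?thesis .
      qed
      show "D (x + y - b * c * x * y) (b * c) + D b ((x + y - b * c * x * y) * c) =
         D x (b * c) + D b (x * c) + (D y (b * c) + D b (y * c))"
      proof -
        have "D (x + y - b * c * x * y) (b * c) = D x (b * c) + D y (b * c)"
          using D'[OF cb, of x y] by (simp add: mult_ac)
        moreover have "(x + y - b * c * x * y) * c = x * c + y * c - b * (x * c) * (y * c)" by (simp add: algebra_simps)
        ultimately show ?thesis using D_circ[OF b, of "x * c" "y * c"] by simp
      qed
    qed
    thus ?thesis .
  qed
  have ab: "a * b \<in> M" using a mult_mem by blast
  show ?thesis
  proof (rule D_eqI[OF ab, where f = "D (a * b)" and g = "\<lambda>c. D a (b * c) + D b (a * c)"])
    fix x y
    show "D (a * b) (x + y - a * b * x * y) = D (a * b) x + D (a * b) y" by (rule D_circ[OF ab])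
    have "b * (x + y - a * b * x * y) = b * x + b * y - a * (b * x) * (b * y)"
      "a * (x + y - a * b * x * y) = a * x + a * y - b * (a * x) * (a * y)" by (simp_all add: algebra_simps)
    thus "D a (b * (x + y - a * b * x * y)) + D b (a * (x + y - a * b * x * y)) =
      D a (b * x) + D b (a * x) + (D a (b * y) + D b (a * y))"
      by (simp add: D_circ[OF a] D_circ[OF b])
  qed (rule main)
qed

lemma D_tors: assumes a: "a \<in> M" shows "(\<Sum>i<p. D a b) = 0"
proof (cases "b dvd 1")
  case True
  thus ?thesis using a by (simp only: D_unit_right) (intro p_tors unit_one_diff mult_mem(1), auto)
next
  case False
  hence b: "b \<in> M" by (simp add: mem_iff)
  have *: "1 - a dvd 1" "1 - b dvd 1" "1 - a * b dvd 1" using a b by (auto intro!: unit_one_diff mult_mem(1))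
  show ?thesis unfolding D_nonunit[OF a b] E_def sum.distrib
    using p_tors[OF *(1,2)] p_tors[OF *(2,3)] p_tors[OF *(3,1)] by (simp only: add_0_left)
qed

lemma D_power:
  assumes a: "a \<in> M" shows "D (a ^ Suc k) b = (\<Sum>i<Suc k. D a (a ^ k * b))"
proof (induction k arbitrary: b)
  case (Suc k)
  have "D (a ^ Suc (Suc k)) b = D (a * a ^ Suc k) b" by simp
  also have "\<dots> = D a (a ^ Suc k * b) + D (a ^ Suc k) (a * b)"
    using a by (intro D_cocycle) (auto intro: mult_mem)
  also have "D (a ^ Suc k) (a * b) = (\<Sum>i<Suc k. D a (a ^ Suc k * b))"
    by (subst Suc.IH) (simp add: mult_ac)
  finally show ?case by (simp add: add.commute)
qed simp

lemma D_ppower_left: assumes "a \<in> M" shows "D (a ^ p) b = 0"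
proof -
  obtain k where "p = Suc k" using p_odd by (cases p) auto
  thus ?thesis using D_power[OF assms, of k b] D_tors[OF assms, of "a ^ k * b"] by simp
qed

lemma D_ppower_right: assumes a: "a \<in> M" shows "D a (b ^ p) = 0"
proof (cases "b dvd 1")
  case True
  have "1 - a * b ^ p dvd 1" using a by (intro unit_one_diff mult_mem(1))
  thus ?thesis using a True by (simp add: D_unit_right unit_power power_left p_tors)
next
  case False
  thus ?thesis using D_anti[OF a, of "b ^ p"] D_ppower_left[of b a] mem_iff by simp
qed

text \<open>The argument on the left is the k-fold circle sum of c, the x with 1 - a x = (1 - a c)^k
  obtained without dividing by a.\<close>

lemma D_circ_power:
  assumes a: "a \<in> M" shows "D a (c * (\<Sum>i<k. (1 - a * c) ^ i)) = (\<Sum>i<k. D a c)"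
proof (induction k)
  case (Suc k)
  let ?S = "\<Sum>i<k. (1 - a * c) ^ i"
  have "a * c * ?S = 1 - (1 - a * c) ^ k"
    using one_diff_power_eq[of "1 - a * c" k] by simp
  hence "(1 - a * c) ^ k = 1 - a * (c * ?S)" by (simp add: algebra_simps)
  hence "c * (\<Sum>i<Suc k. (1 - a * c) ^ i) = c * (?S + (1 - a * (c * ?S)))" by simp
  also have "\<dots> = c * ?S + c - a * (c * ?S) * c" by (simp add: algebra_simps)
  finally have "c * (\<Sum>i<Suc k. (1 - a * c) ^ i) = c * ?S + c - a * (c * ?S) * c" .
  thus ?case using D_circ[OF a] Suc by simp
qed (simp add: D_zero a)

lemma D_circ_ppower:
  "a \<in> M \<Longrightarrow> D a (c * (\<Sum>i<p. (1 - a * c) ^ i)) = 0"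
  by (simp only: D_circ_power D_tors)

end

section \<open>Symbols of prime exponent on chain rings\<close>

lemma sum_one_diff_power:
  fixes z :: "'r::comm_ring_1"
  shows "(\<Sum>i<n. (1 - z) ^ i) = (\<Sum>j<n. of_nat (n choose Suc j) * (- z) ^ j)"
proof (induction n)
  case (Suc n)
  have "(1 - z) ^ n = (\<Sum>j\<le>n. of_nat (n choose j) * (- z) ^ j)"
    using binomial_ring[of "- z" 1 n] by simp
  moreover have "(\<Sum>j<Suc n. of_nat (n choose Suc j) * (- z) ^ j) = (\<Sum>j<n. of_nat (n choose Suc j) * (- z) ^ j)"
    by (simp add: binomial_eq_0)
  ultimately have "(\<Sum>i<Suc n. (1 - z) ^ i) =
      (\<Sum>j<Suc n. of_nat (n choose Suc j) * (- z) ^ j) + (\<Sum>j<Suc n. of_nat (n choose j) * (- z) ^ j)"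
    using Suc by (subst sum.lessThan_Suc) (simp only: lessThan_Suc_atMost)
  thus ?case by (simp only: sum.distrib[symmetric] distrib_right[symmetric] of_nat_add[symmetric] binomial_Suc_Suc add.commute)
qed simp

text \<open>This is (1 - (1 - z)^p)/z: every binomial coefficient but the last is a multiple of p,
  the first being p itself, and the last term is z^(p-1) because p - 1 is even. If p = 0 in the ring
  only z^(p-1) survives; if p generates M the term p takes the lead.\<close>

lemma sum_one_diff_power_prime:
  fixes z :: "'r::comm_ring_1"
  assumes p: "Factorial_Ring.prime p" and "odd p"
  shows "\<exists>h. (\<Sum>i<p. (1 - z) ^ i) = of_nat p * (1 + z * h) + z ^ (p - 1)"
proof -
  obtain m where m: "p = Suc (Suc m)" using p prime_ge_2_nat[OF p] by (metis One_nat_def Suc_1 Suc_leD not_less_eq_eq old.nat.exhaust zero_le)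
  have "even (Suc m)" using assms m by simp
  have "p dvd (p choose Suc (Suc j))" if "j < m" for j
    using p that m by (intro dvd_choose_prime) auto
  hence "\<exists>c. (p choose Suc (Suc j)) = p * c" if "j < m" for j using that by (auto simp: dvd_def)
  then obtain c where c: "\<And>j. j < m \<Longrightarrow> (p choose Suc (Suc j)) = p * c j" by metis
  have "(\<Sum>i<p. (1 - z) ^ i) = (\<Sum>j<Suc (Suc m). of_nat (p choose Suc j) * (- z) ^ j)"
    unfolding sum_one_diff_power using m by simp
  also have "\<dots> = of_nat p + (\<Sum>j<m. of_nat (p choose Suc (Suc j)) * (- z) ^ Suc j) + (- z) ^ Suc m"
    by (subst sum.lessThan_Suc, subst sum.lessThan_Suc_shift) (simp add: m del: binomial_Suc_Suc power_Suc)
  also have "(\<Sum>j<m. of_nat (p choose Suc (Suc j)) * (- z) ^ Suc j) = (\<Sum>j<m. of_nat p * (z * (- of_nat (c j) * (- z) ^ j)))"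
    by (intro sum.cong) (auto simp: c algebra_simps)
  also have "\<dots> = of_nat p * (z * (\<Sum>j<m. - of_nat (c j) * (- z) ^ j))"
    by (simp only: sum_distrib_left)
  also have "(- z) ^ Suc m = z ^ (p - 1)" using \<open>even (Suc m)\<close> m by (simp only: power_minus_even) simp
  finally show ?thesis
    by (intro exI[of _ "\<Sum>j<m. - of_nat (c j) * (- z) ^ j"]) (simp add: distrib_left)
qed

text \<open>\<open>char\<close> covers equal characteristic, where p = 0, and the unramified mixed
  case, where p generates M. \<open>perfect\<close> is perfectness of the residue field.\<close>

locale chain_ring = local_ring M for M :: "'r::comm_ring_1 set" +
  fixes p n :: nat and t :: 'r
  assumes p: "Factorial_Ring.prime p" "odd p" and M_eq: "M = range ((*) t)" and nilp: "t ^ n = 0"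
    and char: "of_nat p = (0::'r) \<or> (\<exists>w. w dvd 1 \<and> of_nat p = t * w)"
    and perfect: "\<exists>b. a - b ^ p \<in> M"

locale chain_symbol = odd_symbol M B p + chain_ring M p n t
  for M :: "'r::comm_ring_1 set" and B :: "'r \<Rightarrow> 'r \<Rightarrow> 'c::ab_group_add" and p n t
begin

text \<open>By \<open>D_power\<close>, i + 1 times the value is <t^(i+1), c^p>, which vanishes
  because of the p-th power. The value is also killed by p, and p is prime to i + 1.\<close>

lemma D_monomial: assumes t: "t \<in> M" and "\<not> p dvd Suc i"  shows "D t (t ^ i * c ^ p) = 0"
proof (rule coprime_torsion)
  show "coprime (Suc i) p" using assms(2) p(1) by (simp add: coprime_commute prime_imp_coprime)
  show "(\<Sum>j<Suc i. D t (t ^ i * c ^ p)) = 0"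
    using D_power[OF t, of i "c ^ p"] D_ppower_right[of "t ^ Suc i" c] t
    by (auto intro: mult_mem simp del: sum.lessThan_Suc)
  show "(\<Sum>j<p. D t (t ^ i * c ^ p)) = 0" by (rule D_tors[OF t])
qed

lemma t_mem: "t \<in> M" unfolding M_eq by (metis mult_1_right rangeI)

text \<open>Elements congruent modulo t^(i+1) differ by a multiple of t^(i+1) also for the circle
  operation with parameter t, so agreement of leading terms can feed an induction.\<close>

lemma circ_decompose:
  assumes "g - u = t ^ Suc i * x"
  shows "\<exists>y. u = g + t ^ Suc i * y - t * g * (t ^ Suc i * y)"
proof -
  have "1 - t * g dvd 1" using t_mem by (intro unit_one_diff mult_mem(1))
  then obtain q where q: "(1 - t * g) * q = 1" by (auto simp: dvd_def)
  define y where "y = - x * q"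
  have "g + t ^ Suc i * y - t * g * (t ^ Suc i * y) = g - t ^ Suc i * x * ((1 - t * g) * q)"
    by (simp add: y_def algebra_simps)
  also have "\<dots> = u" unfolding q assms[symmetric] by simp
  finally show ?thesis by metis
qed

text \<open>Every leading term t^i v is attained by an element pairing to 0 with t. If p does not
  divide i + 1, a monomial t^i b^p with b^p = v modulo M serves. Otherwise it is a p-fold circle sum
  of some c, with leading term c (t c)^(p-1) or c p according to the characteristic.\<close>

lemma D_leading: "\<exists>g x. D t g = 0 \<and> g - t ^ i * v = t ^ Suc i * x"
proof -
  have tM: "t \<in> M" by (rule t_mem)
  have circ: "\<exists>h. D t (c * (of_nat p * (1 + t * c * h) + (t * c) ^ (p - 1))) = 0" for c
  proof -
    obtain h where "(\<Sum>j<p. (1 - t * c) ^ j) = of_nat p * (1 + t * c * h) + (t * c) ^ (p - 1)"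
      using sum_one_diff_power_prime[OF p] by metis
    thus ?thesis using D_circ_ppower[OF tM, of c] by metis
  qed
  obtain b where "v - b ^ p \<in> M" using perfect by blast
  then obtain v' where v': "v - b ^ p = t * v'" unfolding M_eq by auto
  have p3: "p \<ge> 3" using p prime_ge_2_nat[OF p(1)] by (cases "p = 2") auto
  show ?thesis
  proof (cases "p dvd Suc i")
    case False
    have "t ^ i * b ^ p - t ^ i * v = - (t ^ i * (v - b ^ p))" by (simp add: algebra_simps)
    also have "\<dots> = t ^ Suc i * - v'" unfolding v' by (simp add: algebra_simps)
    finally show ?thesis using D_monomial[OF tM False, of b] by blast
  next
    case True
    show ?thesis using char
    proof
      assume p0: "of_nat p = (0::'r)"
      obtain k where k: "Suc i = p * Suc k"
      proof -
        obtain k where "Suc i = p * k" using True by (auto simp: dvd_def)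
        thus ?thesis using that by (cases k) auto
      qed
      \<comment> \<open>From i + 1 = p (k + 1); hence t^(p-1) (t^k b)^p has degree exactly
        i.\<close>
      have i: "i = p * k + (p - 1)" using k p3 by (cases p) auto
      have "(t ^ k * b) * (t * (t ^ k * b)) ^ (p - 1) = t ^ (p - 1) * (t ^ k * b) ^ Suc (p - 1)"
        by (simp add: power_mult_distrib algebra_simps)
      also have "\<dots> = t ^ (p - 1) * ((t ^ k) ^ p * b ^ p)" using p3 by (simp add: power_mult_distrib)
      also have "\<dots> = t ^ i * b ^ p" unfolding i
        by (simp only: power_add power_mult[symmetric] mult.commute[of p k] mult_ac)
      finally have "D t (t ^ i * b ^ p) = 0" using circ[of "t ^ k * b"] p0 by auto
      moreover have "t ^ i * b ^ p - t ^ i * v = - (t ^ i * (v - b ^ p))" by (simp add: algebra_simps)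
      hence "t ^ i * b ^ p - t ^ i * v = t ^ Suc i * - v'" unfolding v' by (simp add: algebra_simps)
      ultimately show ?thesis by blast
    next
      assume "\<exists>w. w dvd 1 \<and> of_nat p = t * w"
      then obtain w w' where w: "of_nat p = t * w" "w * w' = 1" by (auto simp: dvd_def)
      obtain j where i: "i = Suc j" using True p3 by (cases i) auto
      \<comment> \<open>Since p = t w, this makes c p = t^(j+1) v = t^i v. As p - 1 is at least 2,
        two factors t c can be split off from c (t c)^(p-1), which exhibits it as a multiple of
        t^(i+1).\<close>
      define c where "c = t ^ j * (v * w')"
      obtain h where h: "D t (c * (of_nat p * (1 + t * c * h) + (t * c) ^ (p - 1))) = 0" using circ by blast
      obtain m where m: "p - 1 = Suc (Suc m)" using p3 by (cases p; cases "p - 1"; cases "p - 2") auto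
      have "c * of_nat p = t ^ i * v * (w * w')" unfolding w(1) c_def i by (simp add: algebra_simps)
      hence cp: "c * of_nat p = t ^ i * v" by (simp add: w)
      have "c * (of_nat p * (1 + t * c * h) + (t * c) ^ (p - 1)) - t ^ i * v
         = (c * of_nat p) * t * c * h + c * (t * c) ^ (p - 1) + ((c * of_nat p) - t ^ i * v)"
        by (simp add: algebra_simps)
      also have "\<dots> = t ^ i * v * t * c * h + c * (t * c) * (t * c) * (t * c) ^ m" unfolding cp m by (simp add: algebra_simps)
      also have "c * (t * c) * (t * c) * (t * c) ^ m = t ^ Suc i * (c * c * (v * w') * (t * c) ^ m)"
        unfolding i by (simp add: c_def algebra_simps)
      also have "t ^ i * v * t * c * h + t ^ Suc i * (c * c * (v * w') * (t * c) ^ m) =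
        t ^ Suc i * (v * c * h + c * c * (v * w') * (t * c) ^ m)" by (simp add: algebra_simps)
      finally show ?thesis using h by blast
    qed
  qed
qed

lemma D_t: "D t u = 0"
proof -
  have "i \<le> n \<Longrightarrow> D t (t ^ i * v) = 0" for i v
  proof (induction i arbitrary: v rule: inc_induct)
    case base
    show ?case by (simp add: nilp D_zero t_mem)
  next
    case (step i)
    obtain g x where g: "D t g = 0" "g - t ^ i * v = t ^ Suc i * x" using D_leading by blast
    obtain y where "t ^ i * v = g + t ^ Suc i * y - t * g * (t ^ Suc i * y)" using circ_decompose[OF g(2)] by blast
    thus ?case using D_circ[OF t_mem, of g "t ^ Suc i * y"] g(1) step.IH by simp
  qed
  from this[of 0 u] show ?thesis by simp
qed

lemma symbol_t: "u dvd 1 \<Longrightarrow> B u (1 - t * u) = 0"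
  using D_t[of u] by (simp add: D_unit_right t_mem)

end

context chain_symbol
begin

lemma chain_symbol_mult: assumes w: "w dvd 1" shows "chain_symbol M B p n (t * w)"
proof unfold_locales
  obtain w' where w': "w * w' = 1" using w by (auto simp: dvd_def)
  show "M = range ((*) (t * w))" unfolding M_eq
  proof (intro equalityI subsetI)
    fix x assume "x \<in> range ((*) t)"
    then obtain y where "x = t * y" by blast
    hence "x = (t * w) * (w' * y)" using w' by (simp add: mult.assoc) (simp add: mult.assoc[symmetric])
    thus "x \<in> range ((*) (t * w))" by blast
  qed (auto simp: mult.assoc)
  show "(t * w) ^ n = 0" by (simp add: power_mult_distrib nilp)
  show "of_nat p = (0::'r) \<or> (\<exists>v. v dvd 1 \<and> of_nat p = t * w * v)" using char
  proof
    assume "\<exists>v. v dvd 1 \<and> of_nat p = t * v"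
    then obtain v where v: "v dvd 1" "of_nat p = t * v" by blast
    have "of_nat p = t * w * (w' * v)" using w' v by (simp add: mult.assoc) (simp add: mult.assoc[symmetric])
    moreover have "w' * v dvd 1" using v w' by (metis dvd_triv_right unit_mult_iff)
    ultimately show ?thesis by blast
  qed simp
qed (use p perfect in auto)

text \<open>\<open>symbol_t\<close> holds for every generator of M. For the generator t v and the
  unit u/v it gives B (u/v) (1 - t u) = 0, and comparison with B u (1 - t u) = 0 leaves the term
  with v.\<close>

lemma symbol_t_any: assumes u: "u dvd 1" and v: "v dvd 1" shows "B v (1 - t * u) = 0"
proof -
  obtain v' where v': "v * v' = 1" using v by (auto simp: dvd_def)
  have uv: "v' dvd 1" using v' by (metis dvd_triv_right)
  interpret s: chain_symbol M B p n "t * v" using chain_symbol_mult[OF v] .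
  have 1: "1 - t * u dvd 1" using t_mem by (intro unit_one_diff mult_mem)
  have "B (u * v') (1 - t * v * (u * v')) = 0" using u uv by (intro s.symbol_t) (auto simp: unit_mult_iff)
  also have "t * v * (u * v') = t * u * (v * v')" by (simp add: algebra_simps)
  finally have "B (u * v') (1 - t * u) = 0" using v' by simp
  hence "B u (1 - t * u) - B v (1 - t * u) = 0" using u uv 1 inv_left[OF v' 1] by (simp add: mult_left)
  thus ?thesis using symbol_t[OF u] by simp
qed

text \<open>Every unit is a p-th power times some 1 - t x, and p-th powers are killed by torsion.
  For a non-unit x, 1 - t x is the product of 1 - t and 1 - t y with the unit y = (x - 1)/(1 - t),
  so \<open>symbol_t_any\<close> covers all x.\<close>

lemma symbol_trivial: assumes u: "u dvd 1" and v: "v dvd 1" shows "B v u = 0"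
proof -
  have "B v (1 - t * x) = 0" for x
  proof (cases "x dvd 1")
    case True thus ?thesis using symbol_t_any v by blast
  next
    case False
    hence x: "x \<in> M" by (simp add: mem_iff)
    have t1: "1 - t dvd 1" using t_mem unit_one_diff by blast
    then obtain q where q: "(1 - t) * q = 1" by (auto simp: dvd_def)
    have qu: "q dvd 1" using q by (metis dvd_triv_right)
    have "x - 1 dvd 1" using unit_one_diff[OF x] minus_dvd_iff[of "x - 1" 1] by simp
    hence y: "(x - 1) * q dvd 1" using qu by (simp add: unit_mult_iff)
    have "(1 - t) * (1 - t * ((x - 1) * q)) = (1 - t) - t * (x - 1) * ((1 - t) * q)" by (simp add: algebra_simps)
    also have "\<dots> = 1 - t * x" unfolding q by (simp add: algebra_simps)
    finally have "1 - t * x = (1 - t * 1) * (1 - t * ((x - 1) * q))" by simp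
    moreover have "1 - t * ((x - 1) * q) dvd 1" using t_mem unit_one_diff mult_mem by blast
    ultimately have "B v (1 - t * x) = B v (1 - t * 1) + B v (1 - t * ((x - 1) * q))" using t1 v
      by (simp only: mult_right mult_1_right)
    thus ?thesis using symbol_t_any[OF _ v, of 1] symbol_t_any[OF y v] by simp
  qed
  note unip = this
  obtain b where b: "u - b ^ p \<in> M" using perfect by blast
  hence bp: "b ^ p dvd 1" using unit_cong u by blast
  hence bu: "b dvd 1" using p by (cases p) (auto simp: unit_mult_iff)
  obtain c where c: "b ^ p * c = 1" using bp by (auto simp: dvd_def)
  obtain x where x: "u - b ^ p = t * x" using b M_eq by auto
  have "b ^ p * (1 - t * (- x * c)) = b ^ p + (t * x) * (b ^ p * c)" by (simp add: algebra_simps)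
  also have "\<dots> = u" by (simp add: c x[symmetric])
  finally have "u = b ^ p * (1 - t * (- x * c))" by simp
  moreover have "1 - t * (- x * c) dvd 1" using t_mem unit_one_diff mult_mem by blast
  ultimately have "B v u = B v (b ^ p) + B v (1 - t * (- x * c))" using bp v mult_right by metis
  also have "\<dots> = 0" using unip[of "- x * c"] anti[OF bp v] power_left[OF bu v] p_tors[OF bu v] by simp
  finally show ?thesis .
qed

end

section \<open>Unit groups, vanishing of all symbols, and squares\<close>

locale cyclic_chain_ring = chain_ring M p n t for M :: "'r::comm_ring_1 set" and p n t +
  fixes g :: 'r
  assumes three: "\<exists>r. r dvd 1 \<and> 1 - r dvd (1::'r)"
    and g: "g dvd 1" and gen: "u dvd 1 \<Longrightarrow> \<exists>i. u - g ^ i \<in> M"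
begin

lemma t_mem: "t \<in> M" unfolding M_eq by (metis mult_1_right rangeI)

lemma of_nat_p_mem: "of_nat p \<in> M"
  using char zero_mem t_mem mult_mem by auto

text \<open>A p-th power gains at least one factor t: 1 - (1 - z)^p is z times p (1 + z h) +
  z^(p-1), and the latter lies in M.\<close>

lemma unipotent_power: "\<exists>y'. (1 - t * y) ^ (p ^ k) = 1 - t ^ Suc k * y'"
proof (induction k)
  case (Suc k)
  then obtain y' where y': "(1 - t * y) ^ (p ^ k) = 1 - t ^ Suc k * y'" by blast
  define z where "z = t ^ Suc k * y'"
  have z: "z \<in> M" unfolding z_def using t_mem by (auto intro: mult_mem(1))
  obtain h where h: "(\<Sum>i<p. (1 - z) ^ i) = of_nat p * (1 + z * h) + z ^ (p - 1)"
    using sum_one_diff_power_prime[OF p] by blast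
  have "p - 1 > 0" using prime_ge_2_nat[OF p(1)] by simp
  hence "z ^ (p - 1) \<in> M" using z mult_mem(1) by (cases "p - 1") auto
  hence "(\<Sum>i<p. (1 - z) ^ i) \<in> M" unfolding h using of_nat_p_mem by (intro add_mem mult_mem(1))
  then obtain x where "(\<Sum>i<p. (1 - z) ^ i) = t * x" unfolding M_eq by blast
  hence "(1 - z) ^ p = 1 - z * (t * x)" using one_diff_power_eq[of "1 - z" p] by (simp add: algebra_simps)
  moreover have "(1 - t * y) ^ (p ^ Suc k) = ((1 - t * y) ^ (p ^ k)) ^ p"
    by (simp only: power_Suc2 power_mult)
  moreover have "z * (t * x) = t ^ Suc (Suc k) * (y' * x)" by (simp add: z_def mult_ac)
  ultimately have "(1 - t * y) ^ (p ^ Suc k) = 1 - t ^ Suc (Suc k) * (y' * x)"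
    unfolding y' z_def[symmetric] by (simp only:)
  thus ?case by blast
qed auto

lemma unipotent_order: assumes "1 - w \<in> M" shows "w ^ (p ^ n) = 1"
proof -
  obtain y where "1 - w = t * y" using assms M_eq by auto
  hence "w = 1 - t * y" by (simp add: algebra_simps)
  thus ?thesis using unipotent_power[of y n] nilp by auto
qed

lemma unit_decompose: assumes "u dvd 1" obtains i w where "u = g ^ i * w" "w dvd 1" "w ^ (p ^ n) = 1"
proof -
  obtain i where i: "u - g ^ i \<in> M" using gen[OF assms] by blast
  obtain g' where g': "g ^ i * g' = 1" using unit_power[OF g, of i] by (auto simp: dvd_def)
  have "1 - u * g' = - ((u - g ^ i) * g')" using g' by (simp add: algebra_simps)
  hence "1 - u * g' \<in> M" using i uminus_mem mult_mem(1) by simp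
  moreover have "g' dvd 1" using g' by (metis dvd_triv_right)
  moreover have "u = g ^ i * (u * g')" using g' by (simp add: mult.left_commute)
  ultimately show ?thesis using that[of i "u * g'"] unipotent_order assms by (simp add: unit_mult_iff)
qed

text \<open>The multiple p^e B is again a symbol and is killed by p, hence zero by
  \<open>symbol_trivial\<close>; so p^e already kills B.\<close>

lemma symbol_zero_if_torsion:
  assumes "symbol M B" "\<And>u v. u dvd 1 \<Longrightarrow> v dvd 1 \<Longrightarrow> (\<Sum>i<p ^ e. B u v :: 'c::ab_group_add) = 0"
    and "u dvd 1" "v dvd 1"
  shows "B u v = 0"
  using assms
proof (induction e arbitrary: u v)
  case (Suc e)
  interpret symbol M B by fact
  let ?B = "\<lambda>u v. \<Sum>i<p ^ e. B u v"
  interpret B': chain_symbol M ?B p n t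
  proof unfold_locales
    fix u v :: 'r assume u: "u dvd 1" and v: "v dvd 1"
    show "?B v u = - ?B u v" using u v by (simp only: anti[of u v] sum_negf)
    show "(\<Sum>i<p. ?B u v) = 0" using Suc.prems(2)[OF u v] by (simp add: sum_const_mult[symmetric] mult.commute)
    show "?B u v = 0" if "u + v = 1" using steinberg[OF u v that] by simp
  qed (auto simp: mult_left alt sum.distrib p three)
  show ?case using Suc.IH[OF assms(1)] B'.symbol_trivial Suc.prems(3,4) by blast
qed auto

text \<open>Units have the form g^i w with w^(p^n) = 1. Therefore p^(2n) B(u,v) = B(u^(p^n),
  v^(p^n)) is a value of B at two powers of g, and B is alternating. This bounds the torsion by a
  power of p.\<close>

theorem symbol_zero:
  assumes "symbol M (B :: 'r \<Rightarrow> 'r \<Rightarrow> 'c::ab_group_add)" "u dvd 1" "v dvd 1" shows "B u v = 0"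
proof (rule symbol_zero_if_torsion[OF assms(1) _ assms(2,3), of "n + n"])
  interpret symbol M B by fact
  have pl: "B (u ^ k) v = (\<Sum>i<k. B u v)" if "u dvd 1" "v dvd 1" for u v k
    using that by (induction k) (auto simp: one_left mult_left unit_power add.commute)
  have pr: "B v (u ^ k) = (\<Sum>i<k. B v u)" if "u dvd 1" "v dvd 1" for u v k
    using that by (induction k) (auto simp: one_right mult_right unit_power add.commute)
  fix u v :: 'r assume u: "u dvd 1" and v: "v dvd 1"
  obtain i w where w: "u = g ^ i * w" "w dvd 1" "w ^ (p ^ n) = 1" using unit_decompose[OF u] .
  obtain j x where x: "v = g ^ j * x" "x dvd 1" "x ^ (p ^ n) = 1" using unit_decompose[OF v] .
  have "(\<Sum>i<p ^ (n + n). B u v) = B (u ^ (p ^ n)) (v ^ (p ^ n))"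
    using u v by (simp add: pl pr unit_power power_add sum_const_mult)
  also have "\<dots> = B (g ^ (i * p ^ n)) (g ^ (j * p ^ n))" using w x by (simp add: power_mult_distrib power_mult)
  also have "\<dots> = 0" using g by (simp add: pl pr unit_power alt)
  finally show "(\<Sum>i<p ^ (n + n). B u v) = 0" .
qed

definition sq :: "'r \<Rightarrow> bool" where "sq u \<longleftrightarrow> (\<exists>v. v dvd 1 \<and> u = v * v)"

lemma sq_mult: "sq u \<Longrightarrow> sq v \<Longrightarrow> sq (u * v)"
proof -
  have "a * a * (b * b) = (a * b) * (a * b)" for a b :: 'r by (simp add: algebra_simps)
  thus "sq u \<Longrightarrow> sq v \<Longrightarrow> sq (u * v)" unfolding sq_def by (metis unit_mult_iff)
qed

lemma sq_inverse: "u * v = 1 \<Longrightarrow> sq u \<Longrightarrow> sq v"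
proof -
  assume uv: "u * v = 1" and "sq u"
  then obtain a where a: "u = a * a" by (auto simp: sq_def)
  have "v = (u * v) * v" using uv by simp
  also have "\<dots> = (a * v) * (a * v)" using a by (simp add: algebra_simps)
  finally have "v = (a * v) * (a * v)" .
  moreover have "u * v dvd 1" using uv by simp
  hence "a * v dvd 1" unfolding a unit_mult_iff by blast
  ultimately show "sq v" unfolding sq_def by (intro exI[of _ "a * v"] conjI)
qed

lemma sq_cancel: "sq u \<Longrightarrow> sq (u * v) \<Longrightarrow> sq v"
proof -
  assume u: "sq u" and uv: "sq (u * v)"
  have "u dvd 1" using u by (auto simp: sq_def unit_mult_iff)
  then obtain u' where u': "u * u' = 1" by (auto simp: dvd_def)
  have "sq (u' * (u * v))" using sq_mult sq_inverse[OF u' u] uv by blast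
  moreover have "u' * (u * v) = v" using u' by (simp add: mult.left_commute mult.assoc[symmetric])
  ultimately show "sq v" by simp
qed

text \<open>If w^(2k+1) = 1, then w is the square of w^(k+1).\<close>

lemma unipotent_sq: assumes "w ^ (p ^ n) = 1" "w dvd 1" shows "sq w"
proof -
  have "odd (p ^ n)" using p by simp
  then obtain k where k: "p ^ n = 2 * k + 1" by (elim oddE)
  have "w ^ Suc k * w ^ Suc k = w ^ (2 * k + 1) * w"
    by (simp only: power_add[symmetric] power_Suc2[symmetric]) (simp add: mult_2)
  also have "\<dots> = w" using assms(1) unfolding k by (simp only: mult_1_left)
  finally show ?thesis using unit_power[OF assms(2), of "Suc k"] unfolding sq_def
    by (intro exI[of _ "w ^ Suc k"] conjI) (simp_all only:)
qed

lemma one_diff_sq: "a \<in> M \<Longrightarrow> sq (1 - a)"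
  by (intro unipotent_sq unipotent_order unit_one_diff) auto

text \<open>Units are powers of g times squares, so a nonsquare carries an odd exponent of g, and
  two odd exponents add up to an even one.\<close>

lemma nonsq_mult: assumes "u dvd 1" "v dvd 1" "\<not> sq u" "\<not> sq v" shows "sq (u * v)"
proof -
  have even_sq: "sq (g ^ i)" if ev: "even i" for i
  proof -
    obtain j where "i = 2 * j" using ev by (elim evenE)
    hence "g ^ i = g ^ j * g ^ j" by (simp only: power_add mult_2)
    thus ?thesis using unit_power[OF g, of j] unfolding sq_def by blast
  qed
  obtain i w where w: "u = g ^ i * w" "w dvd 1" "w ^ (p ^ n) = 1" using unit_decompose[OF assms(1)] .
  obtain j x where x: "v = g ^ j * x" "x dvd 1" "x ^ (p ^ n) = 1" using unit_decompose[OF assms(2)] .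
  have "odd i" "odd j" using assms w x even_sq unipotent_sq sq_mult by blast+
  hence "sq (g ^ (i + j))" using even_sq by simp
  hence "sq (g ^ (i + j) * (w * x))" using sq_mult unipotent_sq w x by blast
  thus ?thesis using w x by (simp add: power_add algebra_simps)
qed

text \<open>Otherwise the set N of non-units and nonsquare units would be closed under addition:
  dividing by a square value a + b would give two nonsquares with sum 1, or a nonsquare of the form
  1 minus a non-unit. N would then be a subgroup containing 1, although 1 is a square.\<close>

lemma nonsq_sum:
  assumes z: "z dvd 1" "\<not> sq z"
  obtains u v where "u dvd 1" "v dvd 1" "\<not> sq u" "\<not> sq v" "u + v = 1"
proof -
  define N where "N = {a. a \<in> M \<or> a dvd 1 \<and> \<not> sq a}"
  have "\<exists>u v. u dvd 1 \<and> v dvd 1 \<and> \<not> sq u \<and> \<not> sq v \<and> u + v = 1"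
  proof (rule ccontr)
    assume no: "\<not> ?thesis"
    have add: "a + b \<in> N" if "a \<in> N" "b \<in> N" for a b
    proof (rule ccontr)
      assume "a + b \<notin> N"
      hence ab: "a + b \<notin> M" "sq (a + b)" by (auto simp: N_def mem_iff)
      obtain s where s: "(a + b) * s = 1" using ab by (auto simp: mem_iff dvd_def)
      have sqs: "sq s" using sq_inverse[OF s ab(2)] .
      have su: "s dvd 1" using s by (metis dvd_triv_right)
      have ns: "\<not> sq (x * s)" if "\<not> sq x" for x using that sq_cancel[OF sqs, of x] by (auto simp: mult.commute)
      have sum: "a * s + b * s = 1" using s by (simp add: algebra_simps)
      have *: False if "x \<in> M" "y \<in> N" "x * s + y * s = 1" for x y
      proof -
        have y: "y * s = 1 - x * s" using that(3) by (simp add: algebra_simps)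
        have "sq (y * s)" unfolding y using that mult_mem(1) by (intro one_diff_sq) auto
        hence "sq y" using sq_cancel[OF sqs, of y] by (simp add: mult.commute)
        moreover have "y \<notin> M" using \<open>sq y\<close> by (auto simp: sq_def mem_iff unit_mult_iff)
        ultimately show False using that by (auto simp: N_def)
      qed
      show False
      proof (cases "a \<in> M \<or> b \<in> M")
        case True
        thus ?thesis using *[of a b] *[of b a] that sum by (auto simp: add.commute)
      next
        case False
        hence "a dvd 1" "b dvd 1" "\<not> sq a" "\<not> sq b" using that by (auto simp: N_def)
        hence "a * s dvd 1" "b * s dvd 1" "\<not> sq (a * s)" "\<not> sq (b * s)" using ns su by (simp_all add: unit_mult_iff)
        thus ?thesis using no sum by blast
      qed
    qed
    have mult: "of_nat k * x \<in> N" if "x \<in> N" for k x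
    proof (induction k)
      case (Suc k) thus ?case using add[OF that Suc] by (simp add: algebra_simps)
    qed (simp add: N_def zero_mem)
    have uminus: "- x \<in> N" if "x \<in> N" for x
    proof -
      \<comment> \<open>Hence -1 is the image of the natural number p^n - 1, and closure under
        addition yields closure under negation.\<close>
      have "of_nat (p ^ n) = (0::'r)" using of_nat_p_mem nilp unfolding M_eq by (auto simp: power_mult_distrib)
      moreover have "p ^ n > 0" using p prime_gt_0_nat by simp
      then obtain k where "p ^ n = Suc k" by (cases "p ^ n") auto
      ultimately have "of_nat k = (- 1 :: 'r)" by (simp add: add_eq_0_iff)
      thus ?thesis using mult[OF that, of k] by simp
    qed
    have one: "1 \<notin> N" by (auto simp: N_def mem_iff sq_def intro: exI[of _ 1])
    obtain y where y: "z * y = 1" using z by (auto simp: dvd_def)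
    have yu: "y dvd 1" using y by (metis dvd_triv_right)
    have "\<not> sq y" using z sq_inverse[of y z] y by (auto simp: mult.commute)
    hence yN: "y \<in> N" and zN: "z \<in> N" using yu z by (auto simp: N_def)
    \<comment> \<open>With y = 1/z: either 1 + z is in N and 1 = (1 + z) - z, or 1 + z is a square,
      (1 + z) y is a nonsquare and 1 = (1 + z) y - y.\<close>
    show False
    proof (cases "1 + z \<in> N")
      case True
      thus False using add[OF True uminus[OF zN]] one by simp
    next
      case False
      hence "sq (1 + z)" by (auto simp: N_def mem_iff)
      moreover have "1 + z dvd 1" using False by (auto simp: N_def mem_iff)
      ultimately have "(1 + z) * y \<in> N" using sq_cancel[of "1 + z" y] \<open>\<not> sq y\<close> yu by (auto simp: N_def unit_mult_iff)
      hence "(1 + z) * y + - y \<in> N" using add uminus[OF yN] by blast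
      moreover have "(1 + z) * y + - y = 1" using y by (simp add: algebra_simps)
      ultimately show False using one by simp
    qed
  qed
  thus ?thesis using that by blast
qed

end

section \<open>A presentation of the special linear group\<close>

text \<open>Symbols take values in an \<open>ab_group_add\<close>. To serve as value group, the
  centre of a noncommutative group has to be a type of its own.\<close>

typedef (overloaded) 'e center = "{z::'e::group_add. \<forall>x. z + x = x + z}" by (rule exI[of _ 0]) simp

setup_lifting type_definition_center

instantiation center :: (group_add) ab_group_add
begin
lift_definition zero_center :: "'a center" is 0 by simp
lift_definition plus_center :: "'a center \<Rightarrow> 'a center \<Rightarrow> 'a center" is "(+)" by (metis add.assoc)
lift_definition uminus_center :: "'a center \<Rightarrow> 'a center" is "uminus"
proof -
  fix z x :: 'a assume z: "\<And>x. z + x = x + z"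
  have "z + (x - z) = x" using z by simp
  hence "- z + (z + (x - z)) = - z + x" by simp
  thus "- z + x = x + - z" by simp
qed
definition minus_center :: "'a center \<Rightarrow> 'a center \<Rightarrow> 'a center" where "minus_center a b = a + - b"
instance
proof
  fix a b c :: "'a center"
  note rep = Rep_center_inject[symmetric] plus_center.rep_eq zero_center.rep_eq uminus_center.rep_eq
  show "a + b + c = a + (b + c)" "0 + a = a" "- a + a = 0" by (simp_all add: rep add.assoc)
  have "Rep_center a + x = x + Rep_center a" for x using Rep_center[of a] by blast
  thus "a + b = b + a" by (simp only: rep)
qed (simp add: minus_center_def)
end

text \<open>The class \<open>group_add\<close> is used for noncommutative groups, written additively.\<close>

definition conj :: "'e::group_add \<Rightarrow> 'e \<Rightarrow> 'e" where "conj e x = e + x - e"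

lemma conj_plus: "conj e (x + y) = conj e x + conj e y"
  by (simp add: conj_def diff_conv_add_uminus add.assoc del: add_uminus_conv_diff)

lemma conj_comp: "conj (e + f) x = conj e (conj f x)"
  by (simp add: conj_def diff_conv_add_uminus minus_add add.assoc del: add_uminus_conv_diff)

lemma conj_uminus: "conj e (- x) = - conj e x"
  by (simp add: conj_def diff_conv_add_uminus minus_add add.assoc del: add_uminus_conv_diff)

lemma conj_0 [simp]: "conj 0 x = x" "conj e 0 = 0" by (simp_all add: conj_def)

lemma conj_self [simp]: "conj e e = e" by (simp add: conj_def)

lemma conj_move: "e + x = conj e x + e" by (simp add: conj_def)

text \<open>A \<open>comm_ring_1\<close> has no inverse operation, so inverses are carried as
  witnesses u' with u * u' = 1; these rules cancel such pairs inside products.\<close>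

lemma cancel_inv:
  assumes "u * u' = (1::'r::comm_ring_1)"
  shows "u * (u' * z) = z" "u' * (u * z) = z" "u' * u = 1"
  using assms by (simp_all add: mult.assoc[symmetric] mult.commute[of u' u])

section \<open>Two by two matrices and their elementary generators\<close>

type_synonym 'r mat = "'r \<times> 'r \<times> 'r \<times> 'r"

fun mm :: "'r::comm_ring_1 mat \<Rightarrow> 'r mat \<Rightarrow> 'r mat" where
  "mm (a, b, c, d) (a', b', c', d') = (a * a' + b * c', a * b' + b * d', c * a' + d * c', c * b' + d * d')"

definition SL :: "'r::comm_ring_1 mat set" where "SL = {(a, b, c, d). a * d - b * c = 1}"

definition xm :: "'r::comm_ring_1 \<Rightarrow> 'r mat" where "xm a = (1, a, 0, 1)"
definition ym :: "'r::comm_ring_1 \<Rightarrow> 'r mat" where "ym a = (1, 0, a, 1)"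
definition hm :: "'r::comm_ring_1 \<Rightarrow> 'r \<Rightarrow> 'r mat" where "hm u u' = (u, 0, 0, u')"

lemmas mat_defs = xm_def ym_def hm_def

lemma mm_assoc: "mm (mm x y) z = mm x (mm y z)"
  by (cases x; cases y; cases z) (simp add: algebra_simps)

lemma SL_mm: "x \<in> SL \<Longrightarrow> y \<in> SL \<Longrightarrow> mm x y \<in> SL"
proof -
  assume "x \<in> SL" "y \<in> SL"
  moreover obtain a b c d a' b' c' d' where "x = (a,b,c,d)" "y = (a',b',c',d')" by (cases x; cases y)
  moreover have "(a * a' + b * c') * (c * b' + d * d') - (a * b' + b * d') * (c * a' + d * c') = (a * d - b * c) * (a' * d' - b' * c')"
    by (simp add: algebra_simps)
  ultimately show ?thesis by (simp add: SL_def)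
qed

lemma SL_gens [simp]: "xm a \<in> SL" "ym a \<in> SL" "u * u' = 1 \<Longrightarrow> hm u u' \<in> SL"
  by (auto simp: SL_def mat_defs)

lemma mm_one [simp]: "mm (xm 0) x = x" "mm x (xm 0) = x" "ym 0 = xm 0" by (cases x; simp add: mat_defs)+

context local_ring begin

text \<open>If both values were non-units, their difference would put \<beta>, and then \<alpha>,
  into M: a linear form that is nonzero modulo M has at most one root there.\<close>

lemma linear_unit:
  fixes \<alpha> \<beta> x y :: 'r
  assumes "\<alpha> dvd 1 \<or> \<beta> dvd 1" "x - y dvd 1" shows "\<alpha> + \<beta> * x dvd 1 \<or> \<alpha> + \<beta> * y dvd 1"
proof (rule ccontr)
  assume "\<not> ?thesis"
  hence m: "\<alpha> + \<beta> * x \<in> M" "\<alpha> + \<beta> * y \<in> M" by (auto simp: mem_iff)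
  have "\<beta> * (x - y) \<in> M" using diff_mem[OF m] by (simp add: algebra_simps)
  hence b: "\<beta> \<in> M" using assms(2) by (auto simp: mem_iff unit_mult_iff)
  hence "\<alpha> \<in> M" using diff_mem[OF m(1) mult_mem(1)[OF b, of x]] by simp
  thus False using b assms(1) by (auto simp: mem_iff)
qed

text \<open>The classes of 0, 1 and r are distinct, and each of the two forms vanishes modulo M at
  no more than one of them.\<close>

lemma two_linear_units:
  fixes \<alpha> \<beta> \<gamma> \<delta> :: 'r
  assumes "\<alpha> dvd 1 \<or> \<beta> dvd 1" "\<gamma> dvd 1 \<or> \<delta> dvd 1" and r: "\<exists>r. r dvd 1 \<and> 1 - r dvd (1::'r)"
  shows "\<exists>m. \<alpha> + \<beta> * m dvd 1 \<and> \<gamma> + \<delta> * m dvd 1"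
proof -
  obtain r :: 'r where r: "r - 0 dvd 1" "1 - r dvd 1" using r by auto
  have d: "1 - 0 dvd (1::'r)" by simp
  show ?thesis
    using linear_unit[OF assms(1) r(1)] linear_unit[OF assms(1) r(2)] linear_unit[OF assms(1) d]
      linear_unit[OF assms(2) r(1)] linear_unit[OF assms(2) r(2)] linear_unit[OF assms(2) d] by blast
qed

lemma SL_row: "(a, b, c, d :: 'r) \<in> SL \<Longrightarrow> d dvd 1 \<or> c dvd 1"
  using diff_mem[of "a * d" "b * c"] mult_mem(2)[of d a] mult_mem(2)[of c b] by (auto simp: SL_def mem_iff)

text \<open>Elementary matrices generate: diag(u, 1/u) is w(u) w(-1) with w(u) = x(u) y(-1/u) x(u),
  a matrix with unit d factors as x diag y, and because c or d is a unit, some x(m) on the right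
  makes the lower right entry a unit.\<close>

lemma SL_induct [consumes 1, case_names x y mm]:
  fixes g :: "'r mat"
  assumes g: "g \<in> SL" and x: "\<And>a. P (xm a)" and y: "\<And>a. P (ym a)"
    and mm: "\<And>g h. g \<in> SL \<Longrightarrow> h \<in> SL \<Longrightarrow> P g \<Longrightarrow> P h \<Longrightarrow> P (mm g h)"
  shows "P g"
proof -
  have w: "P (mm (mm (xm u) (ym (-u'))) (xm u))" "mm (mm (xm u) (ym (-u'))) (xm u) \<in> SL" for u u'
    by (intro mm x y SL_mm SL_gens)+
  have h: "P (hm u u')" if "u * u' = 1" for u u'
  proof -
    note cancel_inv[OF that]
    hence "hm u u' = mm (mm (mm (xm u) (ym (-u'))) (xm u)) (mm (mm (xm (-1)) (ym (- (-1)))) (xm (-1)))"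
      using that by (simp add: mat_defs)
    thus ?thesis using mm w by metis
  qed
  have cell: "P (a, b, c, d)" if S: "(a, b, c, d) \<in> SL" and d: "d dvd 1" for a b c d
  proof -
    obtain d' where d': "d' * d = 1" using d by (auto simp: dvd_def mult.commute)
    note 1 = cancel_inv[OF d']
    have "a * d = 1 + b * c" using S by (simp add: SL_def algebra_simps)
    hence "(a * d) * d' = (1 + b * c) * d'" by simp
    moreover have "(a * d) * d' = a" using 1 d' by (simp add: mult.assoc mult.commute[of d d'])
    ultimately have "a = d' + b * d' * c" by (simp add: algebra_simps)
    hence "(a, b, c, d) = mm (mm (xm (b * d')) (hm d' d)) (ym (c * d'))"
      using d' by (simp add: mat_defs 1 algebra_simps)
    moreover have "P (mm (mm (xm (b * d')) (hm d' d)) (ym (c * d')))"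
      using d' by (intro mm SL_mm SL_gens x y h)
    ultimately show ?thesis by simp
  qed
  obtain a b c d where g': "g = (a, b, c, d)" by (cases g)
  have "\<exists>m. d + c * m dvd 1"
    using linear_unit[OF SL_row[of a b c d], of 1 0] g g'
    by (metis add_0_right diff_zero dvd_refl mult_zero_right)
  then obtain m where m: "d + c * m dvd 1" by blast
  have "mm g (xm m) \<in> SL" using g by (intro SL_mm) auto
  moreover have "mm g (xm m) = (a, a * m + b, c, d + c * m)" by (simp add: g' mat_defs add.commute)
  ultimately have "P (mm g (xm m))" using m cell by metis
  hence "P (mm (mm g (xm m)) (xm (- m)))" by (intro mm[OF SL_mm[OF g SL_gens(1)] SL_gens(1) _ x])
  moreover have "mm (mm g (xm m)) (xm (- m)) = g" by (simp add: g' mat_defs)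
  ultimately show ?thesis by simp
qed

end

text \<open>A representation of the rank one Steinberg group: two additive families on which U(u)
  V(-1/u) U(u) acts as the corresponding Weyl element acts on the unitriangular matrices.\<close>

locale steinberg_rep = cyclic_chain_ring M p n t g
  for M :: "'r::comm_ring_1 set" and p n t g +
  fixes U V :: "'r \<Rightarrow> 'e::group_add"
  assumes U_add: "U (a + b) = U a + U b" and V_add: "V (a + b) = V a + V b"
    and WU0: "u * u' = 1 \<Longrightarrow> conj (U u + V (- u') + U u) (U a) = V (- (u' * (u' * a)))"
    and WV0: "u * u' = 1 \<Longrightarrow> conj (U u + V (- u') + U u) (V a) = U (- (u * (u * a)))"
begin

definition W where "W u u' = U u + V (- u') + U u"

lemmas WU = WU0[folded W_def] and WV = WV0[folded W_def]

lemma UV_0 [simp]: "U 0 = 0" "V 0 = 0"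
  using U_add[of 0 0] V_add[of 0 0] add_left_cancel[of "U 0" 0 "U 0"] add_left_cancel[of "V 0" 0 "V 0"] by auto

lemma U_uminus: "U (- a) = - U a" using U_add[of a "-a"] minus_unique[of "U a" "U (- a)"] by simp
lemma V_uminus: "V (- a) = - V a" using V_add[of a "-a"] minus_unique[of "V a" "V (- a)"] by simp

text \<open>W u is fixed under conjugation by itself, while the conjugation exchanges its U and V
  factors.\<close>

lemma W_alt: assumes u: "u * u' = 1" shows "W u u' = V (- u') + U u + V (- u')"
proof -
  have "W u u' = conj (W u u') (W u u')" by simp
  also have "\<dots> = conj (W u u') (U u) + conj (W u u') (V (- u')) + conj (W u u') (U u)"
    by (subst (2) W_def) (simp only: conj_plus)
  also have "\<dots> = V (- u') + U u + V (- u')"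
    unfolding WU[OF u] WV[OF u] using u cancel_inv[OF u] by simp
  finally show ?thesis .
qed

lemma W_uminus: "W (- u) (- u') = - W u u'"
  by (simp add: W_def U_uminus V_uminus minus_add diff_conv_add_uminus add.assoc del: add_uminus_conv_diff)

lemma WU': assumes u: "u * u' = 1" shows "conj (- W u u') (U a) = V (- (u' * (u' * a)))"
  using WU[of "-u" "-u'" a] u by (simp add: W_uminus)

lemma WV': assumes u: "u * u' = 1" shows "conj (- W u u') (V a) = U (- (u * (u * a)))"
  using WV[of "-u" "-u'" a] u by (simp add: W_uminus)

lemma WW: assumes u: "u * u' = 1" and v: "v * v' = 1"
  shows "conj (W u u') (W v v') = W (u * (u * v')) (u' * (u' * v))"
proof -
  have e: "u * (u * v') * (u' * (u' * v)) = 1" using u v cancel_inv[OF u] cancel_inv[OF v]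
    by (simp add: mult_ac)
  show ?thesis unfolding W_alt[OF e]
    unfolding W_def[of v] conj_plus WU[OF u] WV[OF u] by simp
qed

text \<open>Insert U(a) = V(1/a) W(a) V(1/a), a form of \<open>W_alt\<close>, into U(u) + U(v) =
  U(s). Collecting the unipotent terms to the left of the W's produces a product V U V, which is
  minus W(u s/v).\<close>

lemma W_sum:
  assumes u: "u * u' = 1" and v: "v * v' = 1" and s: "s * s' = 1" and e: "s = u + v"
  shows "W u u' + W v v' = W (u * s * v') (u' * s' * v) + W s s'"
proof -
  note c = cancel_inv[OF u] cancel_inv[OF v] cancel_inv[OF s]
  have UW: "U a = V a' + W a a' + V a'" if "a * a' = 1" for a a'
    unfolding W_alt[OF that]
    by (simp add: V_uminus diff_conv_add_uminus add.assoc del: add_uminus_conv_diff)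
  have 1: "u' + v' = s * u' * v'"
    using u v c unfolding e by (simp add: algebra_simps)
  have 2: "u' - s' = u' * s' * v"
  proof -
    have "u' * s' * v = u' * (s' * s) - u' * u * s'" unfolding e by (simp add: algebra_simps)
    thus ?thesis using c by simp
  qed
  have 3: "v' - s' = v' * s' * u"
  proof -
    have "v' * s' * u = v' * (s' * s) - v' * v * s'" unfolding e by (simp add: algebra_simps)
    thus ?thesis using c by simp
  qed
  have e4: "(- (u * s * v')) * (- (u' * s' * v)) = 1" using u v s c by (simp add: mult_ac)
  have "V s' + W s s' + V s' = U u + U v" using UW[OF s] U_add[of u v] e by simp
  also have "\<dots> = V u' + W u u' + V (u' + v') + W v v' + V v'"
    unfolding UW[OF u] UW[OF v] V_add by (simp add: add.assoc)
  also have "W u u' + V (u' + v') = U (- (u * s * v')) + W u u'" for z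
    using conj_move[of "W u u'" "V (u' + v')"] unfolding WV[OF u] 1 using c by (simp add: mult_ac)
  hence "V u' + W u u' + V (u' + v') + W v v' + V v' = V u' + U (- (u * s * v')) + W u u' + W v v' + V v'"
    by (simp add: add.assoc)
  finally have *: "V s' + W s s' + V s' = V u' + U (- (u * s * v')) + W u u' + W v v' + V v'" .
  have "W s s' = - V s' + (V s' + W s s' + V s') - V s'" by (simp add: add.assoc)
  also have "\<dots> = - V s' + (V u' + U (- (u * s * v')) + W u u' + W v v' + V v') - V s'" unfolding * ..
  also have "\<dots> = V (- s' + u') + U (- (u * s * v')) + ((W u u' + W v v') + V (v' - s'))"
    unfolding V_add diff_conv_add_uminus V_uminus by (simp add: add.assoc diff_conv_add_uminus del: add_uminus_conv_diff)
  also have "(W u u' + W v v') + V (v' - s') = V (u' * s' * v) + (W u u' + W v v')"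
    using conj_move[of "W u u' + W v v'" "V (v' - s')"] unfolding conj_comp WV[OF v] WU[OF u] 3 using c
    by (simp add: mult_ac)
  also have "- s' + u' = u' * s' * v" using 2 by simp
  finally have "W s s' = (V (u' * s' * v) + U (- (u * s * v')) + V (u' * s' * v)) + (W u u' + W v v')"
    by (simp add: add.assoc)
  also have "V (u' * s' * v) + U (- (u * s * v')) + V (u' * s' * v) = - W (u * s * v') (u' * s' * v)"
    using W_alt[OF e4] W_uminus[of "u * s * v'" "u' * s' * v"] by simp
  finally show ?thesis by (simp add: add.assoc[symmetric])
qed

section \<open>Torus elements and their commutator symbol\<close>

definition iv :: "'r \<Rightarrow> 'r" where "iv u = (SOME v. u * v = 1)"

lemma iv: "u dvd 1 \<Longrightarrow> u * iv u = 1"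
  unfolding iv_def dvd_def by (rule someI_ex) metis

lemma iv_eq: assumes "u * u' = 1" shows "iv u = u'"
proof -
  have "u * iv u = 1" using assms by (intro iv) (metis dvd_triv_left)
  hence "u' * (u * iv u) = u'" by simp
  thus ?thesis using cancel_inv[OF assms] by simp
qed

text \<open>Corresponds to diag(u, 1/u) = w(u) w(1)^(-1), normalised to vanish at u = 1.\<close>

definition h where "h u = W u (iv u) - W 1 1"

lemma h_eq: "u * u' = 1 \<Longrightarrow> h u = W u u' - W 1 1" by (simp add: h_def iv_eq)

lemma W_h: "u * u' = 1 \<Longrightarrow> W u u' = h u + W 1 1" by (simp add: h_eq)

lemma h_one: "h 1 = 0" by (simp add: h_eq[of 1 1])

lemma h_conj: assumes u: "u * u' = 1" shows "conj (h u) x = conj (W u u') (conj (- W 1 1) x)"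
  unfolding h_eq[OF u] diff_conv_add_uminus conj_comp ..

lemma hU: assumes u: "u * u' = 1" shows "conj (h u) (U a) = U (u * (u * a))"
  unfolding h_conj[OF u] by (simp add: WU' WV[OF u])

lemma hV: assumes u: "u * u' = 1" shows "conj (h u) (V a) = V (u' * (u' * a))"
  unfolding h_conj[OF u] by (simp add: WV' WU[OF u])

lemma hW: assumes u: "u * u' = 1" shows "conj (h u) (W v v') = W (u * (u * v)) (u' * (u' * v'))"
  unfolding W_def conj_plus hU[OF u] hV[OF u] by simp

lemma wh: assumes v: "v * v' = 1" shows "conj (W 1 1) (h v) = h v'"
proof -
  have v': "v' * v = 1" using v by (simp add: mult.commute)
  show ?thesis unfolding h_eq[OF v] h_eq[OF v'] diff_conv_add_uminus conj_plus conj_uminus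
    using WW[OF _ v, of 1 1] by simp
qed

text \<open>Conjugating W v by h u gives W(u^2 v). Written with h, the trailing W 1 has to pass -h
  u, which turns it into -h(1/u).\<close>

lemma h_square_mult: assumes u: "u * u' = 1" and v: "v * v' = 1"
  shows "h u + h v - h u' = h (u * u * v)"
proof -
  have e: "(u * u * v) * (u' * (u' * v')) = 1" using u v cancel_inv[OF u] by (simp add: mult_ac)
  have "conj (h u) (W v v') = h (u * u * v) + W 1 1" using W_h[OF e] hW[OF u, of v v'] by (simp add: mult.assoc)
  hence "h u + (h v + W 1 1) - h u = h (u * u * v) + W 1 1" unfolding W_h[OF v] by (simp add: conj_def)
  moreover have "W 1 1 - h u = - h u' + W 1 1"
    using wh[OF u] conj_move[of "W 1 1" "- h u"] by (simp add: conj_uminus)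
  ultimately have "h u + h v + (- h u' + W 1 1) = h (u * u * v) + W 1 1"
    by (simp add: add.assoc diff_conv_add_uminus del: add_uminus_conv_diff)
  thus ?thesis by (simp add: add.assoc[symmetric])
qed

text \<open>This is \<open>W_sum\<close> with two factors W 1 cancelled on the right; W 1 passing h
  v replaces v by 1/v, whence the inverses in the second summands.\<close>

lemma h_sum: assumes u: "u * u' = 1" and v: "v * v' = 1" and s: "s * s' = 1" and e: "s = u + v"
  shows "h u + h v' = h (u * s * v') + h s'"
proof -
  have 1: "(u * s * v') * (u' * s' * v) = 1" using u v s cancel_inv[OF u] cancel_inv[OF v] by (simp add: mult_ac)
  have 2: "W 1 1 + W v v' = h v' + W 1 1 + W 1 1" if v: "v * v' = 1" for v v'
    using wh[OF v] conj_move[of "W 1 1" "h v"] unfolding W_h[OF v] by (simp add: add.assoc[symmetric])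
  have "h u + (h v' + W 1 1 + W 1 1) = h (u * s * v') + (h s' + W 1 1 + W 1 1)"
    using W_sum[OF u v s e] unfolding W_h[OF u] W_h[OF 1] by (simp add: add.assoc 2[OF v, unfolded add.assoc] 2[OF s, unfolded add.assoc])
  thus ?thesis by (simp add: add.assoc[symmetric])
qed

end

text \<open>The extra assumption holds in any central extension of the special linear group, since
  the defect of multiplicativity of h lies over the identity matrix.\<close>

locale central_steinberg_rep = steinberg_rep M p n t g U V
  for M :: "'r::comm_ring_1 set" and p n t g and U V :: "'r \<Rightarrow> 'e::group_add" +
  assumes h_central0: "u * u' = 1 \<Longrightarrow> v * v' = 1 \<Longrightarrow>
    (W u u' - W 1 1) + (W v v' - W 1 1) - (W (u * v) (u' * v') - W 1 1) \<in> {z. \<forall>x. z + x = x + z}"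
begin

lemma h_central: assumes "u dvd 1" "v dvd 1"
  shows "\<exists>z. (\<forall>x. z + x = x + z) \<and> h u + h v = z + h (u * v)"
proof -
  obtain u' v' where u: "u * u' = 1" and v: "v * v' = 1" using assms by (auto simp: dvd_def)
  have uv: "(u * v) * (u' * v') = 1" using u v cancel_inv[OF u] by (simp add: mult_ac)
  have "\<forall>x. (h u + h v - h (u * v)) + x = x + (h u + h v - h (u * v))"
    using h_central0[OF u v] unfolding h_eq[OF u] h_eq[OF v] h_eq[OF uv] by blast
  moreover have "h u + h v = (h u + h v - h (u * v)) + h (u * v)" by simp
  ultimately show ?thesis by blast
qed

definition \<kappa> where "\<kappa> u v = h u + h v - h u - h v"

lemma kappa_move: "h u + h v = \<kappa> u v + (h v + h u)"
  by (simp add: \<kappa>_def add.assoc[symmetric])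

lemma kappa_central: assumes "u dvd 1" "v dvd 1" shows "\<kappa> u v + x = x + \<kappa> u v"
proof -
  obtain z where z: "\<And>x. z + x = x + z" "h u + h v = z + h (u * v)" using h_central[OF assms] by blast
  obtain y where y: "\<And>x. y + x = x + y" "h v + h u = y + h (v * u)" using h_central[OF assms(2,1)] by blast
  have ym: "- y + x = x + - y" for x
  proof -
    have "y + (x + - y) = x" using y(1)[of "x + - y"] by simp
    hence "- y + (y + (x + - y)) = - y + x" by (simp only:)
    thus ?thesis by (simp only: minus_add_cancel)
  qed
  have "\<kappa> u v = h u + h v - (h v + h u)"
    by (simp add: \<kappa>_def minus_add diff_conv_add_uminus add.assoc del: add_uminus_conv_diff)
  also have "\<dots> = z - y" unfolding z(2) y(2)
    by (simp add: minus_add diff_conv_add_uminus add.assoc mult.commute del: add_uminus_conv_diff)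
  finally have "\<kappa> u v = z + - y" by simp
  thus ?thesis using z(1) ym by (metis add.assoc)
qed

text \<open>h(u w) differs from h u + h w by a central z, which cancels from commutators; the values
  of \<kappa> are central as well and can be collected in front.\<close>

lemma kappa_mult: assumes u: "u dvd 1" and w: "w dvd 1" and v: "v dvd 1"
  shows "\<kappa> (u * w) v = \<kappa> u v + \<kappa> w v"
proof -
  obtain z where z: "\<And>x. z + x = x + z" "h u + h w = z + h (u * w)" using h_central[OF u w] by blast
  have zl: "x + (z + y) = z + (x + y)" for x y
    by (simp only: add.assoc[symmetric] z(1)[of x])
  have "z + (h (u * w) + h v) = h u + (h w + h v)" by (simp only: add.assoc[symmetric] z(2))
  also have "\<dots> = h u + h v + h w + \<kappa> w v"
    unfolding kappa_move[of w] kappa_central[OF w v] by (simp only: add.assoc)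
  also have "\<dots> = \<kappa> u v + (h v + (h u + h w)) + \<kappa> w v"
    unfolding kappa_move[of u v] by (simp add: add.assoc)
  also have "\<dots> = \<kappa> u v + (\<kappa> w v + (h v + (z + h (u * w))))"
    unfolding z(2) kappa_central[OF w v] by (simp only: add.assoc)
  also have "\<dots> = z + (\<kappa> u v + (\<kappa> w v + (h v + h (u * w))))" by (simp only: zl)
  also have "\<dots> = z + ((\<kappa> u v + \<kappa> w v) + (h v + h (u * w)))" by (simp only: add.assoc)
  finally have "h (u * w) + h v = (\<kappa> u v + \<kappa> w v) + (h v + h (u * w))" by simp
  thus ?thesis using kappa_move[of "u * w" v] by simp
qed

lemma kappa_anti: "\<kappa> v u = - \<kappa> u v"
  by (simp add: \<kappa>_def minus_add diff_conv_add_uminus add.assoc del: add_uminus_conv_diff)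

lemma h_square: assumes u: "u * u' = 1" shows "h u - h u' = h (u * u)"
  using h_square_mult[OF u, of 1 1] by (simp add: h_one)

lemma h_square_kappa: assumes u: "u * u' = 1" and v: "v * v' = 1"
  shows "h (u * u * v) = \<kappa> u v + (h v + h (u * u))"
  using h_square_mult[OF u v] unfolding kappa_move[of u v] h_square[OF u, symmetric]
  by (simp add: add.assoc diff_conv_add_uminus del: add_uminus_conv_diff)

lemma kappa_one: "\<kappa> 1 v = 0" by (simp add: \<kappa>_def h_one)

text \<open>For u + v = 1, \<open>h_sum\<close> with s = 1 gives h u + h(1/v) = h(u/v). Applied to v
  = u v + v^2 it expresses the same element as h(u v) + h(v^(-2)), and comparison with
  \<open>h_square_kappa\<close> yields \<kappa>(1/v, u v) = 0. As \<kappa> is bimultiplicative and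
  alternating, this reduces to \<kappa>(u, v) = 0.\<close>

lemma kappa_steinberg: assumes u: "u dvd 1" and v: "v dvd 1" and uv: "u + v = 1"
  shows "\<kappa> u v = 0"
proof -
  obtain u' where u': "u * u' = 1" using u by (auto simp: dvd_def)
  obtain v' where v': "v * v' = 1" using v by (auto simp: dvd_def)
  have vu: "v' dvd 1" using v' by (metis dvd_triv_right)
  have 1: "h u + h v' = h (u * v')" using h_sum[OF u' v', of 1 1] uv by (simp add: h_one)
  have 2: "(u * v) * (u' * v') = 1" "(v * v) * (v' * v') = 1" "v' * v = 1"
    using u' v' cancel_inv[OF v'] by (simp_all add: mult_ac)
  have 3: "v = u * v + v * v"
  proof -
    have "v = (u + v) * v" using uv by simp
    thus ?thesis by (simp add: algebra_simps)
  qed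
  have "h (u * v) + h (v' * v') = h (u * v * v * (v' * v')) + h v'"
    using h_sum[OF 2(1) 2(2) v' 3] .
  also have "u * v * v * (v' * v') = u" using cancel_inv[OF v'] by (simp add: mult_ac)
  also have "h u + h v' = h (v' * v' * (u * v))" unfolding 1 using cancel_inv[OF v'] by (simp add: mult_ac)
  also have "\<dots> = \<kappa> v' (u * v) + (h (u * v) + h (v' * v'))" by (rule h_square_kappa[OF 2(3) 2(1)])
  finally have "0 + (h (u * v) + h (v' * v')) = \<kappa> v' (u * v) + (h (u * v) + h (v' * v'))"
    unfolding add_0_left .
  hence "\<kappa> v' (u * v) = 0" by (simp only: add_right_cancel)
  hence "\<kappa> (u * v) v' = 0" unfolding kappa_anti[of v'] by simp
  hence "\<kappa> u v' + \<kappa> v v' = 0" using kappa_mult[OF u v vu] by simp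
  moreover have "\<kappa> v v' + \<kappa> v' v' = 0" using kappa_mult[OF v vu vu] v' by (simp add: kappa_one)
  hence "\<kappa> v v' = 0" by (simp add: \<kappa>_def[of v' v'])
  ultimately have "\<kappa> u v' = 0" by simp
  hence 4: "\<kappa> v' u = 0" unfolding kappa_anti[of v' u] by simp
  have "\<kappa> (v * v') u = \<kappa> v u + \<kappa> v' u" by (rule kappa_mult[OF v vu u])
  hence "\<kappa> v u = 0" using 4 v' by (simp add: kappa_one)
  thus ?thesis unfolding kappa_anti[of u v] by simp
qed

lemma kappa_zero: assumes u: "u dvd 1" and v: "v dvd 1" shows "\<kappa> u v = 0"
proof -
  define B where "B u v = Abs_center (\<kappa> u v)" for u v
  have rep: "Rep_center (B u v) = \<kappa> u v" if "u dvd 1" "v dvd 1" for u v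
    unfolding B_def using kappa_central[OF that] by (intro Abs_center_inverse) simp
  have "symbol M B"
  proof unfold_locales
    fix u u' v :: 'r assume u: "u dvd 1" and v: "v dvd 1"
    show "B v u = - B u v" using u v by (simp add: Rep_center_inject[symmetric] uminus_center.rep_eq rep kappa_anti[of v u])
    show "B u u = 0" using u by (simp add: Rep_center_inject[symmetric] zero_center.rep_eq rep \<kappa>_def)
    show "B u v = 0" if "u + v = 1"
      using u v that by (simp add: Rep_center_inject[symmetric] zero_center.rep_eq rep kappa_steinberg)
    show "B (u * u') v = B u v + B u' v" if "u' dvd 1"
      using u v that by (simp add: Rep_center_inject[symmetric] plus_center.rep_eq rep kappa_mult unit_mult_iff)
  qed
  hence "B u v = 0" using u v by (rule symbol_zero)
  thus ?thesis using rep[OF u v] by (simp add: zero_center.rep_eq)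
qed

lemma h_comm: "u dvd 1 \<Longrightarrow> v dvd 1 \<Longrightarrow> h u + h v = h v + h u"
  using kappa_move[of u v] kappa_zero[of u v] by simp

lemma h_sq_mult: assumes u: "sq u" and v: "v dvd 1" shows "h (u * v) = h u + h v"
proof -
  obtain a where a: "a dvd 1" "u = a * a" using u by (auto simp: sq_def)
  obtain a' where a': "a * a' = 1" using a by (auto simp: dvd_def)
  obtain v' where v': "v * v' = 1" using v by (auto simp: dvd_def)
  have "h (a * a * v) = h v + h (a * a)" using h_square_kappa[OF a' v'] kappa_zero[OF a(1) v] by simp
  thus ?thesis using h_comm[of u v] v a by (simp add: unit_mult_iff)
qed

text \<open>For nonsquares u and v take nonsquares with a + b = 1, where \<open>h_sum\<close> gives
  h a + h(1/b) = h(a/b). Since u/a and v b are squares, across which h is multiplicative, this one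
  relation settles the case.\<close>

lemma h_mult: assumes u: "u dvd 1" and v: "v dvd 1" shows "h (u * v) = h u + h v"
proof (cases "sq u \<or> sq v")
  case True
  thus ?thesis using h_sq_mult[of u v] h_sq_mult[of v u] h_comm[OF u v] u v by (auto simp: mult.commute)
next
  case False
  obtain a b where ab: "a dvd 1" "b dvd 1" "\<not> sq a" "\<not> sq b" "a + b = 1" using nonsq_sum[OF u] False by blast
  obtain a' b' where a': "a * a' = 1" and b': "b * b' = 1" using ab by (auto simp: dvd_def)
  have b'u: "b' dvd 1" using b' by (metis dvd_triv_right)
  have a'u: "a' dvd 1" using a' by (metis dvd_triv_right)
  have na': "\<not> sq a'" using sq_inverse[of a' a] a' ab by (auto simp: mult.commute)
  have 1: "h a + h b' = h (a * b')" using h_sum[OF a' b', of 1 1] ab by (simp add: h_one)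
  have su: "sq (u * a')" using nonsq_mult[OF u a'u] False na' by blast
  have sv: "sq (v * b)" using nonsq_mult[OF v ab(2)] False ab by blast
  have u2: "u = u * a' * a" and v2: "v = v * b * b'" using a' b' by (simp_all add: cancel_inv mult.assoc)
  have "h u = h (u * a') + h a" using h_sq_mult[OF su ab(1)] u2 by simp
  moreover have "h v = h (v * b) + h b'" using h_sq_mult[OF sv b'u] v2 by simp
  moreover have "u * v = (u * a') * ((v * b) * (a * b'))"
    by (simp add: mult_ac cancel_inv[OF a'] cancel_inv[OF b'])
  hence "h (u * v) = h (u * a') + (h (v * b) + (h a + h b'))"
    unfolding 1 using h_sq_mult[OF su, of "(v * b) * (a * b')"] h_sq_mult[OF sv, of "a * b'"] v ab b'u
    by (simp add: unit_mult_iff)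
  moreover have "h (v * b) + h a = h a + h (v * b)" using v ab by (intro h_comm) (auto simp: unit_mult_iff)
  ultimately show ?thesis by (metis add.assoc)
qed

lemma h_inverse: "u * u' = 1 \<Longrightarrow> h u' = - h u"
  using h_mult[of u u'] minus_unique[of "h u" "h u'"] by (metis dvd_triv_left dvd_triv_right h_one)

lemma h_minus_one: "W 1 1 + W 1 1 = h (- 1)"
proof -
  have "- W 1 1 = h (- 1) + W 1 1" using W_h[of "-1" "-1"] W_uminus[of 1 1] by simp
  hence "h (- 1) + W 1 1 + W 1 1 = - W 1 1 + W 1 1" by (simp only:)
  hence "h (- 1) + (W 1 1 + W 1 1) = 0" by (simp only: add.assoc left_minus)
  hence "W 1 1 + W 1 1 = - h (- 1)" by (rule minus_unique[symmetric])
  also have "\<dots> = h (- 1)" using h_inverse[of "-1" "-1"] by simp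
  finally show ?thesis .
qed

section \<open>The big cell relation and the multiplicative section\<close>

lemma hU_move: "u * u' = 1 \<Longrightarrow> h u + U a = U (u * (u * a)) + h u"
  using conj_move[of "h u" "U a"] by (simp add: hU)

lemma hV_move: "u * u' = 1 \<Longrightarrow> h u + V a = V (u' * (u' * a)) + h u"
  using conj_move[of "h u" "V a"] by (simp add: hV)

text \<open>Lifts the matrix identity y(b) x(c) = x(c s) diag(s, 1/s) y(b s). Expanding U c as
  V(1/c) W(c) V(1/c) merges V b with V(1/c) into V e, where e = 1/(c s); V e opens up as U W U, and
  the two W's combine to h s.\<close>

lemma VU_units:
  assumes b: "b dvd 1" and c: "c dvd 1" and s: "(1 + b * c) * s = 1"
  shows "V b + U c = U (c * s) + h s + V (b * s)"
proof -
  obtain c' where c': "c * c' = 1" using c by (auto simp: dvd_def)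
  have c'u: "c' dvd 1" and su: "s dvd 1" using c' s by (metis dvd_triv_right)+
  have bc: "b * c * s = 1 - s" using s by (simp add: algebra_simps eq_diff_eq)
  define e where "e = b + c'"
  have e: "e = (1 + b * c) * c'" using cancel_inv[OF c'] by (simp add: e_def algebra_simps)
  have ee: "(- (c * s)) * (- e) = 1"
  proof -
    have "(- (c * s)) * (- e) = (c * c') * ((1 + b * c) * s)" unfolding e by (simp only: mult_ac minus_mult_minus)
    thus ?thesis using c' s by simp
  qed
  have Uc: "U c = V c' + W c c' + V c'" unfolding W_alt[OF c']
    by (simp add: V_uminus diff_conv_add_uminus add.assoc del: add_uminus_conv_diff)
  have Ve: "V e = U (c * s) + W (- (c * s)) (- e) + U (c * s)" unfolding W_def
    by (simp add: U_uminus diff_conv_add_uminus add.assoc del: add_uminus_conv_diff)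
  have mv: "U (c * s) + W c c' = W c c' + V (- (c' * s))"
    using conj_move[of "W c c'" "V (- (c' * s))"] WV[OF c', of "- (c' * s)"] cancel_inv[OF c'] by simp
  have 3: "V (- (c' * s)) + V c' = V (b * s)"
  proof -
    have "c' - c' * s = c' * (1 - s)" by (simp add: algebra_simps)
    also have "\<dots> = b * s" unfolding bc[symmetric] by (simp add: mult_ac cancel_inv[OF c'])
    finally show ?thesis by (simp add: V_add[symmetric])
  qed
  have 4: "W (- (c * s)) (- e) + W c c' = h s"
  proof -
    have "W 1 1 + h c = h c' + W 1 1" using conj_move[of "W 1 1" "h c"] wh[OF c'] by simp
    hence "W (- (c * s)) (- e) + W c c' = h (- (c * s)) + (h c' + (W 1 1 + W 1 1))"
      unfolding W_h[OF ee] W_h[OF c'] by (metis add.assoc)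
    also have "\<dots> = h (- (c * s) * (c' * (- 1)))" unfolding h_minus_one using c c'u su
      by (simp add: h_mult unit_mult_iff del: mult_minus_left mult_minus_right mult_minus1_right)
    also have "- (c * s) * (c' * (- 1)) = s" by (simp add: mult_ac cancel_inv[OF c'])
    finally show ?thesis .
  qed
  have "V b + U c = V e + W c c' + V c'" unfolding e_def Uc V_add by (simp add: add.assoc)
  also have "\<dots> = U (c * s) + (W (- (c * s)) (- e) + (U (c * s) + W c c')) + V c'" unfolding Ve by (simp add: add.assoc)
  also have "\<dots> = U (c * s) + (W (- (c * s)) (- e) + W c c') + (V (- (c' * s)) + V c')"
    unfolding mv by (simp add: add.assoc)
  also have "\<dots> = U (c * s) + h s + V (b * s)" unfolding 3 4 ..
  finally show ?thesis .
qed

text \<open>The relation for (b, c) followed by the one for (b s, d) gives the one for (b, c + d),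
  because 1 + b s d = s (1 + b (c + d)). In this way non-unit arguments are reached from unit
  ones.\<close>

lemma VU_add_right:
  assumes s: "(1 + b * c) * s = 1" and r: "(1 + b * (c + d)) * r = 1"
    and 1: "V b + U c = U (c * s) + h s + V (b * s)"
    and 2: "V (b * s) + U d = U (d * (r * (1 + b * c))) + h (r * (1 + b * c)) + V (b * s * (r * (1 + b * c)))"
  shows "V b + U (c + d) = U ((c + d) * r) + h r + V (b * r)"
proof -
  define S where "S = 1 + b * c"
  have sS: "s * S = 1" using s by (simp add: S_def mult.commute)
  have u: "S dvd 1" "s dvd 1" "r dvd 1" using s r sS by (metis dvd_triv_right)+
  note c = cancel_inv[OF sS]
  have "V b + U (c + d) = U (c * s) + h s + (V (b * s) + U d)" unfolding U_add add.assoc[symmetric] 1 ..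
  also have "\<dots> = U (c * s) + (h s + U (d * (r * S))) + (h (r * S) + V (b * s * (r * S)))"
    unfolding 2 S_def[symmetric] by (simp add: add.assoc)
  also have "\<dots> = U (c * s + s * (s * (d * (r * S)))) + (h s + h (r * S)) + V (b * s * (r * S))"
    unfolding hU_move[OF sS] U_add by (simp add: add.assoc)
  also have "h s + h (r * S) = h (s * (r * S))" using u by (simp add: h_mult unit_mult_iff)
  also have "s * (r * S) = r" by (simp only: mult.left_commute[of s r] sS mult_1_right)
  also have "b * s * (r * S) = b * (r * (s * S))" by (simp only: mult_ac)
  also have "\<dots> = b * r" unfolding sS by simp
  also have "c * s + s * (s * (d * (r * S))) = (c + d) * r"
  proof -
    have "c * s + s * (s * (d * (r * S))) = s * (c * 1 + d * r * (s * S))" by (simp add: algebra_simps)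
    also have "\<dots> = s * (c * 1 + d * r)" unfolding sS by simp
    also have "\<dots> = s * (c * ((1 + b * (c + d)) * r) + d * r)" unfolding r ..
    also have "\<dots> = (c + d) * r * (s * S)" unfolding S_def by (simp add: algebra_simps)
    finally show ?thesis using sS by simp
  qed
  finally show ?thesis .
qed

lemma VU_add_left:
  assumes s: "(1 + b * c) * s = 1" and r: "(1 + (a + b) * c) * r = 1"
    and 1: "V b + U c = U (c * s) + h s + V (b * s)"
    and 2: "V a + U (c * s) = U (c * s * (r * (1 + b * c))) + h (r * (1 + b * c)) + V (a * (r * (1 + b * c)))"
  shows "V (a + b) + U c = U (c * r) + h r + V ((a + b) * r)"
proof -
  define S where "S = 1 + b * c"
  have sS: "s * S = 1" and Ss: "S * s = 1" using s by (simp_all add: S_def mult.commute)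
  have u: "S dvd 1" "s dvd 1" "r dvd 1" using s r sS by (metis dvd_triv_right)+
  note c = cancel_inv[OF sS]
  have "V (a + b) + U c = (V a + U (c * s)) + h s + V (b * s)" unfolding V_add add.assoc 1 ..
  also have "\<dots> = U (c * s * (r * S)) + h (r * S) + (V (a * (r * S)) + h s) + V (b * s)"
    unfolding 2 S_def[symmetric] by (simp add: add.assoc)
  also have "V (a * (r * S)) + h s = h s + V (s * (s * (a * (r * S))))"
    unfolding hV_move[OF sS] using c by simp
  also have "U (c * s * (r * S)) + h (r * S) + (h s + V (s * (s * (a * (r * S))))) + V (b * s)
    = U (c * s * (r * S)) + (h (r * S) + h s) + V (s * (s * (a * (r * S))) + b * s)"
    unfolding V_add by (simp add: add.assoc)
  also have "h (r * S) + h s = h (r * S * s)" using u by (simp add: h_mult unit_mult_iff)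
  also have "r * S * s = r" by (simp only: mult.assoc Ss mult_1_right)
  also have "c * s * (r * S) = c * (r * (s * S))" by (simp only: mult_ac)
  also have "\<dots> = c * r" unfolding sS by simp
  also have "s * (s * (a * (r * S))) + b * s = (a + b) * r"
  proof -
    have "s * (s * (a * (r * S))) + b * s = s * (b * 1 + a * r * (s * S))" by (simp add: algebra_simps)
    also have "\<dots> = s * (b * 1 + a * r)" unfolding sS by simp
    also have "\<dots> = s * (b * ((1 + (a + b) * c) * r) + a * r)" unfolding r ..
    also have "\<dots> = (a + b) * r * (s * S)" unfolding S_def by (simp add: algebra_simps)
    finally show ?thesis using sS by simp
  qed
  finally show ?thesis .
qed

lemma VU_unit_left:
  assumes b: "b dvd 1" and s: "(1 + b * c) * s = 1"
  shows "V b + U c = U (c * s) + h s + V (b * s)"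
proof (cases "c dvd 1")
  case True thus ?thesis using VU_units b s by blast
next
  case False
  hence c: "c \<in> M" by (simp add: mem_iff)
  obtain r :: 'r where r: "r dvd 1" "1 - r dvd 1" using three by blast
  obtain b' where b': "b * b' = 1" using b by (auto simp: dvd_def)
  have b'u: "b' dvd 1" using b' by (metis dvd_triv_right)
  \<comment> \<open>Chosen so that 1 + b x = 1 - r; both x and c - x are units, c being in
    M.\<close>
  define x where "x = - (r * b')"
  have x: "x dvd 1" by (simp add: x_def unit_mult_iff r b'u)
  have y: "c - x dvd 1" using unit_add[OF _ c, of "- x"] x by simp
  have 1: "1 + b * x = 1 - r" unfolding x_def by (simp add: mult_ac cancel_inv[OF b'])
  then obtain q where q: "(1 + b * x) * q = 1" using r by (auto simp: dvd_def)
  have qu: "q dvd 1" using q by (metis dvd_triv_right)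
  have 2: "1 + b * q * (c - x) = (1 + b * c) * q"
  proof -
    have "1 + b * q * (c - x) = (1 + b * x) * q + b * q * (c - x)" using q by simp
    thus ?thesis by (simp add: algebra_simps)
  qed
  have 3: "(1 + b * q * (c - x)) * (s * (1 + b * x)) = 1"
  proof -
    have "(1 + b * c) * q * (s * (1 + b * x)) = ((1 + b * c) * s) * ((1 + b * x) * q)" by (simp only: mult_ac)
    thus ?thesis unfolding 2 using q s by simp
  qed
  have "V b + U (x + (c - x)) = U ((x + (c - x)) * s) + h s + V (b * s)"
  proof (rule VU_add_right[OF q])
    show "(1 + b * (x + (c - x))) * s = 1" using s by simp
    show "V b + U x = U (x * q) + h q + V (b * q)" using VU_units[OF b x q] .
    show "V (b * q) + U (c - x) = U ((c - x) * (s * (1 + b * x))) + h (s * (1 + b * x)) + V (b * q * (s * (1 + b * x)))"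
      using b qu by (intro VU_units[OF _ y 3]) (simp add: unit_mult_iff)
  qed
  thus ?thesis by simp
qed

lemma VU:
  assumes s: "(1 + b * c) * s = 1"
  shows "V b + U c = U (c * s) + h s + V (b * s)"
proof (cases "b dvd 1")
  case True thus ?thesis using VU_unit_left s by blast
next
  case False
  hence b: "b \<in> M" by (simp add: mem_iff)
  \<comment> \<open>The form 0 + 1 m encodes that m itself is a unit. Since b lies in M, b - m is
    then a unit too, so both summands of b fall under \<open>VU_unit_left\<close>.\<close>
  have "\<exists>m. 0 + 1 * m dvd 1 \<and> 1 + c * m dvd 1" using three by (intro two_linear_units) auto
  then obtain x where x: "x dvd 1" "1 + x * c dvd 1" by (auto simp: mult.commute)
  then obtain q where q: "(1 + x * c) * q = 1" by (auto simp: dvd_def)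
  have y: "b - x dvd 1" using unit_add[OF _ b, of "- x"] x by simp
  have 2: "1 + (b - x) * (c * q) = (1 + b * c) * q"
  proof -
    have "1 + (b - x) * (c * q) = (1 + x * c) * q + (b - x) * (c * q)" using q by simp
    thus ?thesis by (simp add: algebra_simps)
  qed
  have 3: "(1 + (b - x) * (c * q)) * (s * (1 + x * c)) = 1"
  proof -
    have "(1 + b * c) * q * (s * (1 + x * c)) = ((1 + b * c) * s) * ((1 + x * c) * q)" by (simp only: mult_ac)
    thus ?thesis unfolding 2 using q s by simp
  qed
  have "V ((b - x) + x) + U c = U (c * s) + h s + V (((b - x) + x) * s)"
    using VU_unit_left[OF x(1) q] VU_unit_left[OF y 3] s by (intro VU_add_left[OF q]) auto
  thus ?thesis by simp
qed

text \<open>For unit d this lifts the factorisation x(b/d) diag(1/d, d) y(c/d); for other d the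
  value is arbitrary, as \<open>iv d\<close> is.\<close>

fun cell :: "'r mat \<Rightarrow> 'e" where
  "cell (a, b, c, d) = U (b * iv d) + h (iv d) + V (c * iv d)"

declare cell.simps [simp del]

lemma cell_eq: "d * d' = 1 \<Longrightarrow> cell (a, b, c, d) = U (b * d') + h d' + V (c * d')"
  by (simp add: iv_eq cell.simps)

fun den :: "'r mat \<Rightarrow> 'r" where "den (a, b, c, d) = d"

text \<open>Only the V factor of the normal form meets U k, and \<open>VU\<close> rewrites that
  product. The relation a d = 1 + b c then brings the U coordinate to (a k + b)/(c k + d).\<close>

lemma cell_xm:
  assumes m: "m \<in> SL" and d: "den m dvd 1" and e: "den (mm m (xm k)) dvd 1"
  shows "cell (mm m (xm k)) = cell m + U k"
proof -
  obtain a b c d where m': "m = (a, b, c, d)" by (cases m)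
  have mg: "mm m (xm k) = (a, a * k + b, c, c * k + d)" by (simp add: m' xm_def)
  obtain d' where d': "d * d' = 1" using d by (auto simp: m' dvd_def)
  obtain e' where e': "(c * k + d) * e' = 1" using e unfolding mg by (auto simp: dvd_def)
  have u: "d dvd 1" "d' dvd 1" "e' dvd 1" using d' e' by (metis dvd_triv_left dvd_triv_right)+
  have S: "(1 + c * d' * k) * (d * e') = 1"
  proof -
    have "(1 + c * d' * k) * (d * e') = d * e' + c * k * e' * (d * d')" by (simp add: algebra_simps)
    thus ?thesis unfolding d' using e' by (simp add: algebra_simps)
  qed
  have dd: "d' * (d * z) = z" for z using cancel_inv[OF d'] by simp
  have "cell m + U k = U (b * d') + h d' + (V (c * d') + U k)"
    unfolding m' cell_eq[OF d'] by (simp add: add.assoc)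
  also have "\<dots> = U (b * d') + (h d' + U (k * (d * e'))) + (h (d * e') + V (c * d' * (d * e')))"
    unfolding VU[OF S] by (simp add: add.assoc)
  also have "h d' + U (k * (d * e')) = U (k * d' * e') + h d'"
  proof -
    have "d' * (d' * (k * (d * e'))) = k * d' * e' * (d * d')" by (simp only: mult_ac)
    thus ?thesis using hU_move[OF cancel_inv(3)[OF d'], of "k * (d * e')"] d' by simp
  qed
  also have "U (b * d') + (U (k * d' * e') + h d') + (h (d * e') + V (c * d' * (d * e'))) =
    U (b * d' + k * d' * e') + (h d' + h (d * e')) + V (c * d' * (d * e'))"
    unfolding U_add by (simp add: add.assoc)
  also have "h d' + h (d * e') = h e'" using h_mult[OF u(2), of "d * e'"] u by (simp add: unit_mult_iff dd)
  also have "c * d' * (d * e') = c * e'" by (simp add: mult.assoc dd)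
  also have "b * d' + k * d' * e' = (a * k + b) * e'"
  proof -
    have "b * d' + k * d' * e' = b * d' * ((c * k + d) * e') + k * d' * e'" unfolding e' by simp
    also have "\<dots> = b * e' * (d * d') + k * e' * d' * (1 + b * c)" by (simp add: algebra_simps)
    also have "1 + b * c = a * d" using m unfolding m' SL_def by (simp add: algebra_simps)
    also have "b * e' * (d * d') + k * e' * d' * (a * d) = (b * e' + k * e' * a) * (d * d')" by (simp add: algebra_simps)
    finally show ?thesis unfolding d' by (simp add: algebra_simps)
  qed
  finally show ?thesis unfolding mg cell_eq[OF e'] by simp
qed

text \<open>Some x(k) on the right moves any matrix of determinant 1 into the big cell; by
  \<open>cell_xm\<close> the choice of k does not matter.\<close>

definition sec :: "'r mat \<Rightarrow> 'e" where
  "sec m = (let k = (SOME k. den (mm m (xm k)) dvd 1) in cell (mm m (xm k)) + U (- k))"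

lemma xm_add: "mm (xm k) (xm l) = xm (k + l)" by (simp add: xm_def add.commute)

lemma sec_eq:
  assumes m: "m \<in> SL" and k: "den (mm m (xm k)) dvd 1"
  shows "sec m = cell (mm m (xm k)) + U (- k)"
proof -
  define l where "l = (SOME k. den (mm m (xm k)) dvd 1)"
  have l: "den (mm m (xm l)) dvd 1" unfolding l_def using k by (rule someI)
  have e: "mm (mm m (xm l)) (xm (k - l)) = mm m (xm k)" by (simp add: mm_assoc xm_add)
  have "cell (mm m (xm k)) = cell (mm m (xm l)) + U (k - l)"
    using cell_xm[OF SL_mm[OF m SL_gens(1)] l, of "k - l"] k unfolding e by simp
  hence "cell (mm m (xm k)) + U (- k) = cell (mm m (xm l)) + (U (k - l) + U (- k))" by (simp add: add.assoc)
  also have "U (k - l) + U (- k) = U (- l)" unfolding U_add[symmetric] by simp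
  finally show ?thesis unfolding sec_def l_def[symmetric] by simp
qed

lemma SL_linear:
  assumes m: "m \<in> SL" shows "\<exists>k. den (mm m (xm k)) dvd 1 \<and> 1 - b * k dvd 1"
proof -
  obtain a b' c d where m': "m = (a, b', c, d)" by (cases m)
  have "\<exists>k. d + c * k dvd 1 \<and> 1 + (- b) * k dvd 1"
    using SL_row[of a b' c d] m three by (intro two_linear_units) (auto simp: m')
  thus ?thesis by (simp add: m' xm_def add.commute)
qed

lemma sec_xm:
  assumes m: "m \<in> SL" shows "sec (mm m (xm k)) = sec m + U k"
proof -
  obtain l where l: "den (mm m (xm l)) dvd 1" using SL_linear[OF m] by blast
  have e: "mm (mm m (xm k)) (xm (l - k)) = mm m (xm l)" by (simp add: mm_assoc xm_add)
  have "sec (mm m (xm k)) = cell (mm m (xm l)) + U (k - l)"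
    using sec_eq[OF SL_mm[OF m SL_gens(1)], of k "l - k"] l unfolding e by simp
  also have "U (k - l) = U (- l) + U k" unfolding U_add[symmetric] by simp
  finally show ?thesis using sec_eq[OF m l] by (simp add: add.assoc)
qed

lemma sec_cell: assumes "m \<in> SL" "den m dvd 1" shows "sec m = cell m"
  using sec_eq[OF assms(1), of 0] assms(2) by simp

text \<open>Besides moving m into the big cell, k is chosen to make t = 1 - b k a unit. Then x(-k)
  y(b) = y(b/t) diag(t, 1/t) x(-k/t), and the y and diagonal factors keep a matrix inside the
  cell.\<close>

lemma sec_ym:
  assumes m: "m \<in> SL" shows "sec (mm m (ym b)) = sec m + V b"
proof -
  obtain k where k: "den (mm m (xm k)) dvd 1" "1 - b * k dvd 1" using SL_linear[OF m] by blast
  define f where "f = mm m (xm k)"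
  have f: "f \<in> SL" unfolding f_def using m by (simp add: SL_mm)
  obtain a b' c d where f': "f = (a, b', c, d)" by (cases f)
  obtain d' where d': "d * d' = 1" using k(1) f' by (auto simp: f_def[symmetric] dvd_def)
  define t where "t = 1 - b * k"
  obtain t' where t': "t * t' = 1" using k(2) by (auto simp: t_def dvd_def)
  have u: "t dvd 1" "t' dvd 1" "d' dvd 1" using t' d' by (metis dvd_triv_left dvd_triv_right)+
  \<comment> \<open>\<open>VU\<close> for -b and k, with both sides inverted.\<close>
  have UV: "U (- k) + V b = V (b * t') + h t + U (- (k * t'))"
  proof -
    have 1: "(1 + (- b) * k) * t' = 1" using t' unfolding t_def by simp
    have "- (V (- b) + U k) = - (U (k * t') + h t' + V (- b * t'))" unfolding VU[OF 1] ..
    hence "- U k + - V (- b) = - V (- b * t') + (- h t' + - U (k * t'))"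
      by (simp only: minus_add)
    thus ?thesis using h_inverse[OF t']
      by (simp add: U_uminus V_uminus add.assoc diff_conv_add_uminus del: add_uminus_conv_diff)
  qed
  define f2 where "f2 = mm (mm f (ym (b * t'))) (hm t t')"
  have f2: "f2 \<in> SL" unfolding f2_def using f t' by (intro SL_mm) auto
  have f2': "f2 = (a * t + b' * b * (t * t'), b' * t', c * t + d * b * (t * t'), d * t')"
    unfolding f2_def f' by (simp add: mat_defs algebra_simps)
  have e2: "(d * t') * (d' * t) = 1" using d' t' cancel_inv[OF d'] by (simp add: mult_ac)
  have "cell f2 = cell f + V (b * t') + h t"
  proof -
    have "cell f + V (b * t') + h t = U (b' * d') + h d' + (V (c * d' + b * t') + h t)"
      unfolding f' cell_eq[OF d'] V_add by (simp add: add.assoc)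
    also have "V (c * d' + b * t') + h t = h t + V (t * (t * (c * d' + b * t')))"
      unfolding hV_move[OF t'] using cancel_inv[OF t'] by simp
    also have "U (b' * d') + h d' + (h t + V (t * (t * (c * d' + b * t')))) =
       U (b' * d') + h (d' * t) + V (t * (t * (c * d' + b * t')))" using u by (simp add: h_mult add.assoc)
    also have "b' * d' = b' * t' * (d' * t)"
    proof -
      have "b' * t' * (d' * t) = b' * d' * (t * t')" by (simp only: mult_ac)
      thus ?thesis using t' by simp
    qed
    also have "t * (t * (c * d' + b * t')) = (c * t + d * b * (t * t')) * (d' * t)"
    proof -
      have "(c * t + d * b * (t * t')) * (d' * t) = t * (t * (c * d' + b * t' * (d * d')))" by (simp add: algebra_simps)
      thus ?thesis using d' by simp
    qed
    finally show ?thesis unfolding f2' cell_eq[OF e2] by simp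
  qed
  moreover have "sec f2 = cell f2" using f2 e2 unfolding f2' by (intro sec_cell) (auto simp: dvd_def intro: exI[of _ "d' * t"])
  moreover have "mm f2 (xm (- (k * t'))) = mm m (ym b)"
  proof -
    have 1: "b * (k * t') = t' - 1" using t' unfolding t_def by (simp add: algebra_simps)
    have "mm (mm (ym (b * t')) (hm t t')) (xm (- (k * t'))) = mm (xm (- k)) (ym b)"
    proof -
      have "t * (k * t') = k" "b * (t' * t) = b" using t' cancel_inv[OF t'] by (simp_all add: mult.left_commute)
      moreover have "t = 1 - k * b" by (simp add: t_def mult.commute)
      moreover have "t' - b * t' * t * (k * t') = 1"
      proof -
        have "b * t' * t * (k * t') = (t * t') * (b * (k * t'))" by (simp only: mult_ac)
        thus ?thesis unfolding 1 using t' by simp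
      qed
      ultimately show ?thesis by (simp add: mat_defs mult.assoc)
    qed
    hence "mm f2 (xm (- (k * t'))) = mm f (mm (xm (- k)) (ym b))" unfolding f2_def by (simp only: mm_assoc)
    also have "\<dots> = mm (mm m (mm (xm k) (xm (- k)))) (ym b)" unfolding f_def by (simp only: mm_assoc)
    finally show ?thesis by (simp add: xm_add)
  qed
  ultimately have "sec (mm m (ym b)) = cell f + V (b * t') + h t + U (- (k * t'))"
    using sec_xm[OF f2, of "- (k * t')"] by simp
  also have "\<dots> = cell f + (U (- k) + V b)" unfolding UV by (simp add: add.assoc)
  also have "\<dots> = sec m + V b" using sec_eq[OF m k(1)] unfolding f_def by (simp add: add.assoc)
  finally show ?thesis .
qed

lemma sec_one: "sec (xm 0) = 0"
  using sec_cell[of "xm 0"] cell_eq[of 1 1] by (simp add: xm_def SL_def h_one)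

lemma sec_x: "sec (xm k) = U k" using sec_xm[of "xm 0" k] by (simp add: sec_one)
lemma sec_y: "sec (ym k) = V k" using sec_ym[of "xm 0" k] by (simp add: sec_one)

theorem sec_mm: assumes "f \<in> SL" "m \<in> SL" shows "sec (mm f m) = sec f + sec m"
  using assms(2) assms(1)
proof (induction arbitrary: f rule: SL_induct)
  case (mm m h)
  have "sec (mm f (mm m h)) = sec (mm (mm f m) h)" by (simp only: mm_assoc)
  also have "\<dots> = sec (mm f m) + sec h" using mm by (simp add: SL_mm)
  finally show ?case using mm by (simp add: add.assoc)
qed (simp_all add: sec_xm sec_ym sec_x sec_y)

end

fun minv :: "'r::comm_ring_1 mat \<Rightarrow> 'r mat" where "minv (a, b, c, d) = (d, - b, - c, a)"

lemma minv: "m \<in> SL \<Longrightarrow> mm m (minv m) = xm 0" "m \<in> SL \<Longrightarrow> mm (minv m) m = xm 0"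
  by (auto simp: SL_def xm_def algebra_simps)

section \<open>Central extensions split\<close>

text \<open>An abstract central extension, with \<open>lift\<close> as the graph of its projection
  onto the special linear group. The unit conditions on r are those needed for
  \<open>pr_zero\<close> and for dividing by r^2 - 1.\<close>

locale lift_system = cyclic_chain_ring M p n t g
  for M :: "'r::comm_ring_1 set" and p n t g +
  fixes lift :: "'e::group_add \<Rightarrow> 'r mat \<Rightarrow> bool" and r :: 'r
  assumes lift_ex: "m \<in> SL \<Longrightarrow> \<exists>e. lift e m"
    and lift_plus: "lift e m \<Longrightarrow> lift f k \<Longrightarrow> lift (e + f) (mm m k)"
    and lift_uminus: "lift e m \<Longrightarrow> lift (- e) (minv m)"
    and lift_SL: "lift e m \<Longrightarrow> m \<in> SL"
    and lift_central: "lift e (xm 0) \<Longrightarrow> e + x = x + e"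
    and r: "r dvd 1" "r + 1 dvd 1" "r - 1 dvd 1" "r * r + 1 dvd 1" "r * r - r - 1 dvd 1" "r * r + r - 1 dvd 1"
begin

lemma lift_minus: "lift e m \<Longrightarrow> lift f k \<Longrightarrow> lift (e - f) (mm m (minv k))"
  using lift_plus[OF _ lift_uminus, of e m f k] by simp

lemma lift_diff:
  assumes "lift e m" "lift f m" shows "\<exists>z. e = z + f \<and> (\<forall>x. z + x = x + z)"
proof (intro exI conjI allI)
  show "e = (e - f) + f" by simp
  have "lift (e - f) (xm 0)" using lift_minus[OF assms] lift_SL[OF assms(1)] by (simp add: minv)
  thus "(e - f) + x = x + (e - f)" for x by (rule lift_central)
qed

lemma conj_central: "z + e = e + z \<Longrightarrow> conj e z = (z::'e)"
  by (simp add: conj_def diff_eq_eq)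

lemma conj_unique:
  assumes "lift e m" "lift f m" shows "conj e x = conj f x"
proof -
  obtain z where z: "e = z + f" "\<And>x. z + x = x + z" using lift_diff[OF assms] by blast
  have "conj e x = conj z (conj f x)" unfolding z(1) conj_comp ..
  thus ?thesis using z(2)[of "conj f x"] unfolding conj_def[of z] by simp
qed

text \<open>The commutator of lifts of m and k. Two lifts of a matrix differ by a central element,
  so the choices are immaterial; see \<open>cm_eq\<close>.\<close>

definition cm :: "'r mat \<Rightarrow> 'r mat \<Rightarrow> 'e" where
  "cm m k = conj (SOME e. lift e m) (SOME f. lift f k) - (SOME f. lift f k)"

lemma cm_eq: assumes e: "lift e m" and f: "lift f k" shows "cm m k = conj e f - f"
proof -
  define e' f' where "e' = (SOME e. lift e m)" and "f' = (SOME f. lift f k)"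
  have e': "lift e' m" and f': "lift f' k" unfolding e'_def f'_def using e f by (auto intro: someI)
  obtain z where z: "f' = z + f" "\<And>x. z + x = x + z" using lift_diff[OF f' f] by blast
  have cz: "conj e' z = z" using z(2) by (rule conj_central)
  have "cm m k = conj e' f' - f'" by (simp add: cm_def e'_def f'_def)
  also have "\<dots> = z + conj e' f - f - z" unfolding z(1) conj_plus cz
    by (simp add: diff_conv_add_uminus minus_add add.assoc del: add_uminus_conv_diff)
  also have "\<dots> = conj e' f - f" using z(2)[of "conj e' f - f"] by (simp add: add.assoc diff_conv_add_uminus del: add_uminus_conv_diff)
  finally show ?thesis using conj_unique[OF e' e] by simp
qed

lemma lift_conj: "lift e m \<Longrightarrow> lift f k \<Longrightarrow> lift (conj e f) (mm (mm m k) (minv m))"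
  unfolding conj_def by (intro lift_minus lift_plus)

lemma conj_cm: assumes e: "lift e m" and k: "k \<in> SL" and l: "l \<in> SL"
  shows "conj e (cm k l) = cm (mm (mm m k) (minv m)) (mm (mm m l) (minv m))"
proof -
  obtain x y where x: "lift x k" and y: "lift y l" using lift_ex k l by blast
  have "cm (mm (mm m k) (minv m)) (mm (mm m l) (minv m)) = conj (conj e x) (conj e y) - conj e y"
    using lift_conj[OF e x] lift_conj[OF e y] by (rule cm_eq)
  also have "conj (conj e x) (conj e y) = conj e (conj x y)"
    by (simp add: conj_def diff_conv_add_uminus minus_add add.assoc del: add_uminus_conv_diff)
  also have "\<dots> - conj e y = conj e (conj x y - y)" unfolding diff_conv_add_uminus conj_plus conj_uminus ..
  also have "conj x y - y = cm k l" using cm_eq[OF x y] by simp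
  finally show ?thesis by simp
qed

lemma lift_cm: assumes "k \<in> SL" "l \<in> SL" shows "lift (cm k l) (mm (mm (mm k l) (minv k)) (minv l))"
proof -
  obtain x y where x: "lift x k" and y: "lift y l" using lift_ex assms by blast
  show ?thesis unfolding cm_eq[OF x y] by (intro lift_minus lift_conj x y)
qed

section \<open>The commutator pairing of unitriangular lifts\<close>

lemma xm_comm_central: "cm (xm a) (xm b) + x = x + cm (xm a) (xm b)"
proof -
  have "mm (mm (mm (xm a) (xm b)) (minv (xm a))) (minv (xm b)) = xm 0" by (simp add: xm_def)
  hence "lift (cm (xm a) (xm b)) (xm 0)" using lift_cm[of "xm a" "xm b"] by simp
  thus ?thesis by (rule lift_central)
qed

definition pr :: "'r \<Rightarrow> 'r \<Rightarrow> 'e center" where "pr a b = Abs_center (cm (xm a) (xm b))"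

lemma pr_rep: "Rep_center (pr a b) = cm (xm a) (xm b)"
  unfolding pr_def using xm_comm_central by (intro Abs_center_inverse) simp

lemma pr_add_left: "pr (a + a') b = pr a b + pr a' b"
proof -
  obtain e e' f where l: "lift e (xm a)" "lift e' (xm a')" "lift f (xm b)" using lift_ex SL_gens by metis
  have ee: "lift (e + e') (xm (a + a'))" using lift_plus[OF l(1,2)] by (simp add: xm_def add.commute)
  have "cm (xm (a + a')) (xm b) = conj e (conj e' f) - f" unfolding cm_eq[OF ee l(3)] conj_comp ..
  also have "conj e' f = cm (xm a') (xm b) + f" unfolding cm_eq[OF l(2,3)] by simp
  also have "conj e \<dots> = cm (xm a') (xm b) + conj e f"
    unfolding conj_plus using conj_central[OF xm_comm_central[of a' b e]] by simp
  also have "\<dots> - f = cm (xm a') (xm b) + cm (xm a) (xm b)" unfolding cm_eq[OF l(1,3)] by (simp add: diff_conv_add_uminus add.assoc del: add_uminus_conv_diff)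
  also have "\<dots> = cm (xm a) (xm b) + cm (xm a') (xm b)" by (rule xm_comm_central)
  finally show ?thesis by (simp add: Rep_center_inject[symmetric] plus_center.rep_eq pr_rep)
qed

lemma pr_anti: "pr b a = - pr a b"
proof -
  obtain e f where l: "lift e (xm a)" "lift f (xm b)" using lift_ex SL_gens by metis
  have "cm (xm b) (xm a) = - cm (xm a) (xm b)" unfolding cm_eq[OF l] cm_eq[OF l(2,1)]
    by (simp add: conj_def diff_conv_add_uminus minus_add add.assoc del: add_uminus_conv_diff)
  thus ?thesis by (simp add: Rep_center_inject[symmetric] uminus_center.rep_eq pr_rep)
qed

lemma pr_add_right: "pr a (b + b') = pr a b + pr a b'"
  by (simp add: pr_anti[of a] pr_add_left)

lemma hm_xm: "u * u' = 1 \<Longrightarrow> mm (mm (hm u u') (xm a)) (minv (hm u u')) = xm (u * (u * a))"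
  by (simp add: mat_defs cancel_inv mult_ac)

text \<open>Conjugation by a lift of diag(u, 1/u) multiplies both arguments by u^2, yet it fixes the
  commutator, which is central.\<close>

lemma pr_scale: assumes u: "u * u' = 1" shows "pr (u * (u * a)) (u * (u * b)) = pr a b"
proof -
  obtain e where e: "lift e (hm u u')" using lift_ex SL_gens(3)[OF u] by blast
  have "conj e (cm (xm a) (xm b)) = cm (xm (u * (u * a))) (xm (u * (u * b)))"
    using conj_cm[OF e, of "xm a" "xm b"] unfolding hm_xm[OF u] by simp
  moreover have "conj e (cm (xm a) (xm b)) = cm (xm a) (xm b)"
    using xm_comm_central by (rule conj_central)
  ultimately show ?thesis by (simp add: Rep_center_inject[symmetric] pr_rep)
qed

lemma pr_move: assumes u: "u * u' = 1" shows "pr (u * (u * a)) b = pr a (u' * (u' * b))"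
  using pr_scale[OF u, of a "u' * (u' * b)"] by (simp add: cancel_inv[OF u])

lemma two_unit: "(2::'r) dvd 1"
proof (rule ccontr)
  assume "\<not> ?thesis"
  hence 2: "2 \<in> M" by (simp add: mem_iff)
  obtain k where "p = 2 * k + 1" using p(2) by (elim oddE)
  hence "of_nat p = 2 * of_nat k + (1::'r)" by simp
  hence "1 = of_nat p - 2 * (of_nat k :: 'r)" by simp
  hence "1 \<in> M" using of_nat_p_mem 2 diff_mem mult_mem(1) by metis
  thus False by (simp add: mem_iff)
qed

text \<open>The parallelogram law \<open>(r + 1)\<^sup>2 + (r - 1)\<^sup>2 = 2 r\<^sup>2 + 2\<close> is an additive relation between squares of
  units that the inverses of these squares do not satisfy, not even modulo \<open>M\<close>.\<close>

lemma pr_zero: "pr a b = 0"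
proof -
  obtain i j k where i: "r * i = 1" and j: "(r + 1) * j = 1" and k: "(r - 1) * k = 1" using r by (metis dvd_def)
  define E where "E = j * j + k * k - (i * i + i * i) - (1 + 1)"
  have "pr a (E * b) = 0" for b
  proof -
    have "(r + 1) * ((r + 1) * a) + (r - 1) * ((r - 1) * a) = (r * (r * a) + r * (r * a)) + (a + a)"
      by (simp add: algebra_simps)
    hence "pr ((r + 1) * ((r + 1) * a)) b + pr ((r - 1) * ((r - 1) * a)) b
       = (pr (r * (r * a)) b + pr (r * (r * a)) b) + (pr a b + pr a b)"
      by (simp only: pr_add_left[symmetric])
    hence 1: "pr a (j * (j * b)) + pr a (k * (k * b)) = (pr a (i * (i * b)) + pr a (i * (i * b))) + (pr a b + pr a b)"
      unfolding pr_move[OF i] pr_move[OF j] pr_move[OF k] .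
    have "E * b + ((i * (i * b) + i * (i * b)) + (b + b)) = j * (j * b) + k * (k * b)"
      by (simp add: E_def algebra_simps)
    hence "pr a (E * b) + ((pr a (i * (i * b)) + pr a (i * (i * b))) + (pr a b + pr a b)) = pr a (j * (j * b)) + pr a (k * (k * b))"
      by (simp only: pr_add_right[symmetric])
    thus ?thesis unfolding 1 by simp
  qed
  moreover have "E dvd 1"
  proof -
    \<comment> \<open>Clearing denominators leaves 2 (r^2 + 1)(r^2 - (r^2 - 1)^2), a difference of
      squares in the last factor; its factorisation is the origin of the three quadratic conditions
      on r.\<close>
    let ?s = "r * (r + 1) * (r - 1)"
    have "E * (?s * ?s) = (r * (r - 1)) * (r * (r - 1)) * (((r + 1) * j) * ((r + 1) * j)) +
       (r * (r + 1)) * (r * (r + 1)) * (((r - 1) * k) * ((r - 1) * k))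
       - 2 * ((r + 1) * (r - 1)) * ((r + 1) * (r - 1)) * ((r * i) * (r * i)) - 2 * (?s * ?s)"
      unfolding E_def by (simp add: algebra_simps)
    also have "\<dots> = 2 * (r * r + 1) * (- (r * r - r - 1)) * (r * r + r - 1)"
      unfolding i j k by (simp add: algebra_simps)
    also have "\<dots> dvd 1" using r two_unit by (simp only: unit_mult_iff minus_dvd_iff)
    finally show ?thesis by (simp add: unit_mult_iff)
  qed
  then obtain e where e: "E * e = 1" by (auto simp: dvd_def)
  ultimately have "pr a (E * (e * b)) = 0" by blast
  moreover have "E * (e * b) = b" using e by (simp add: mult.assoc[symmetric])
  ultimately show ?thesis by simp
qed

section \<open>Canonical lifts of the elementary matrices\<close>

lemma lift_xm_comm: assumes "lift e (xm a)" "lift f (xm b)" shows "e + f = f + e"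
proof -
  have "cm (xm a) (xm b) = 0" using pr_rep[of a b] by (simp add: pr_zero zero_center.rep_eq)
  hence "conj e f = f" unfolding cm_eq[OF assms] by simp
  thus ?thesis using conj_move[of e f] by simp
qed

definition r' where "r' = (SOME x. r * x = 1)"
definition q where "q = (SOME x. (r * r - 1) * x = 1)"

lemma r': "r * r' = 1" unfolding r'_def using r(1) by (intro someI_ex[of "\<lambda>x. r * x = 1"]) (auto simp: dvd_def)

lemma q: "(r * r - 1) * q = 1"
proof -
  have "r * r - 1 = (r + 1) * (r - 1)" by (simp add: algebra_simps)
  hence "r * r - 1 dvd 1" using r by (simp add: unit_mult_iff)
  thus ?thesis unfolding q_def by (intro someI_ex[of "\<lambda>x. (r * r - 1) * x = 1"]) (auto simp: dvd_def)
qed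

text \<open>A commutator in a central extension does not depend on the chosen lifts, and this one lifts
  \<open>xm a\<close> because \<open>(r\<^sup>2 - 1) q = 1\<close>.\<close>

definition UU :: "'r \<Rightarrow> 'e" where "UU a = cm (hm r r') (xm (q * a))"

lemma lift_UU: "lift (UU a) (xm a)"
proof -
  have "r * (r * (q * a)) - q * a = (r * r - 1) * q * a" by (simp add: algebra_simps)
  also have "\<dots> = a" unfolding q by simp
  finally have 1: "r * (r * (q * a)) - q * a = a" .
  have "mm (mm (mm (hm r r') (xm (q * a))) (minv (hm r r'))) (minv (xm (q * a))) = xm (r * (r * (q * a)) - q * a)"
    unfolding hm_xm[OF r'] by (simp add: xm_def)
  thus ?thesis using lift_cm[OF SL_gens(3)[OF r'] SL_gens(1), of "q * a"] unfolding UU_def 1 by simp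
qed

text \<open>Conjugation by a lift of the torus element is additive; reordering the remaining terms
  is where commuting lifts of unitriangular matrices are required.\<close>

lemma UU_add: "UU (a + b) = UU a + UU b"
proof -
  obtain x where x: "lift x (hm r r')" using lift_ex SL_gens(3)[OF r'] by blast
  obtain e f where l: "lift e (xm (q * a))" "lift f (xm (q * b))" using lift_ex SL_gens by metis
  have ef: "lift (e + f) (xm (q * (a + b)))" using lift_plus[OF l] by (simp add: xm_def algebra_simps)
  have "UU (a + b) = conj x e + conj x f - (e + f)" unfolding UU_def cm_eq[OF x ef] conj_plus ..
  also have "\<dots> = conj x e + UU b - e" unfolding UU_def cm_eq[OF x l(2)]
    by (simp add: diff_conv_add_uminus minus_add add.assoc del: add_uminus_conv_diff)
  also have "\<dots> = conj x e + (UU b + - e)" by (simp add: diff_conv_add_uminus add.assoc del: add_uminus_conv_diff)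
  also have "UU b + - e = - e + UU b"
    using lift_UU[of b] lift_uminus[OF l(1)] by (intro lift_xm_comm) (auto simp: xm_def)
  also have "conj x e + (- e + UU b) = UU a + UU b" unfolding UU_def[of a] cm_eq[OF x l(1)]
    by (simp add: diff_conv_add_uminus add.assoc del: add_uminus_conv_diff)
  finally show ?thesis .
qed

text \<open>Diagonal matrices commute, so conjugation leaves the torus entry of the commutator alone
  and rescales the unitriangular one.\<close>

lemma conj_UU: assumes u: "u * u' = 1" and e: "lift e (hm u u')" shows "conj e (UU a) = UU (u * (u * a))"
proof -
  have 1: "mm (mm (hm u u') (hm r r')) (minv (hm u u')) = hm r r'"
    using u by (simp add: hm_def mult_ac cancel_inv[OF u])
  have 2: "u * (u * (q * a)) = q * (u * (u * a))" by (simp only: mult_ac)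
  show ?thesis using conj_cm[OF e SL_gens(3)[OF r'] SL_gens(1), of "q * a"] unfolding UU_def 1 hm_xm[OF u] 2 .
qed

definition wm :: "'r mat" where "wm = (0, 1, - 1, 0)"
definition w where "w = (SOME e. lift e wm)"

lemma lift_w: "lift w wm"
  unfolding w_def using lift_ex[of wm] by (intro someI_ex[of "\<lambda>e. lift e wm"]) (simp add: wm_def SL_def)

text \<open>The sign reflects that conjugating x(-a) by the Weyl matrix \<open>wm\<close> gives
  y(a).\<close>

definition VV :: "'r \<Rightarrow> 'e" where "VV a = conj w (UU (- a))"

lemma lift_VV: "lift (VV a) (ym a)"
  using lift_conj[OF lift_w lift_UU, of "- a"] by (simp add: VV_def wm_def mat_defs)

lemma VV_add: "VV (a + b) = VV a + VV b"
proof -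
  have "- (a + b) = - a + - b" by simp
  thus ?thesis unfolding VV_def by (simp only: UU_add conj_plus)
qed

lemma conj_VV: assumes u: "u * u' = 1" and e: "lift e (hm u u')" shows "conj e (VV a) = VV (u' * (u' * a))"
proof -
  have u': "u' * u = 1" using u by (simp add: mult.commute)
  obtain f where f: "lift f (hm u' u)" using lift_ex SL_gens(3)[OF u'] by blast
  have 1: "mm (hm u u') wm = mm wm (hm u' u)" by (simp add: hm_def wm_def)
  have "conj e (VV a) = conj (e + w) (UU (- a))" by (simp add: VV_def conj_comp)
  also have "\<dots> = conj (w + f) (UU (- a))"
    using lift_plus[OF e lift_w] lift_plus[OF lift_w f] unfolding 1 by (rule conj_unique)
  also have "\<dots> = VV (u' * (u' * a))" by (simp add: conj_comp conj_UU[OF u' f] VV_def)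
  finally show ?thesis .
qed

lemma lift_W: "u * u' = 1 \<Longrightarrow> lift (UU u + VV (- u') + UU u) (mm (hm u u') wm)"
  using lift_plus[OF lift_plus[OF lift_UU[of u] lift_VV[of "- u'"]] lift_UU[of u]]
  by (simp add: wm_def mat_defs cancel_inv)

lemma conj_W: assumes u: "u * u' = 1" and e: "lift e (hm u u')"
  shows "conj (UU u + VV (- u') + UU u) x = conj e (conj w x)"
  using conj_unique[OF lift_W[OF u] lift_plus[OF e lift_w]] by (simp add: conj_comp)

lemma conj_w_UU: "conj w (UU a) = VV (- a)" by (simp add: VV_def)

text \<open>The square of \<open>wm\<close> is diag(-1, -1), and a lift of it fixes every
  \<open>UU a\<close>.\<close>

lemma conj_w_VV: "conj w (VV a) = UU (- a)"
proof -
  have "lift (w + w) (hm (- 1) (- 1))" using lift_plus[OF lift_w lift_w] by (simp add: wm_def hm_def)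
  hence "conj (w + w) (UU (- a)) = UU (- a)" using conj_UU[of "-1" "-1"] by simp
  thus ?thesis by (simp add: VV_def conj_comp)
qed

lemma lift_WW: assumes u: "u * u' = 1"
  shows "lift ((UU u + VV (- u') + UU u) - (UU 1 + VV (- 1) + UU 1)) (hm u u')"
proof -
  have 1: "1 * 1 = (1::'r)" by simp
  have "mm (mm (hm u u') wm) (minv (mm (hm 1 1) wm)) = hm u u'" by (simp add: wm_def hm_def)
  thus ?thesis using lift_minus[OF lift_W[OF u] lift_W[OF 1]] by simp
qed

sublocale steinberg_rep M p n t g UU VV
proof unfold_locales
  fix u u' a :: 'r assume u: "u * u' = 1"
  obtain e where e: "lift e (hm u u')" using lift_ex SL_gens(3)[OF u] by blast
  show "conj (UU u + VV (- u') + UU u) (UU a) = VV (- (u' * (u' * a)))"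
    by (simp add: conj_W[OF u e] conj_w_UU conj_VV[OF u e])
  show "conj (UU u + VV (- u') + UU u) (VV a) = UU (- (u * (u * a)))"
    by (simp add: conj_W[OF u e] conj_w_VV conj_UU[OF u e])
qed (simp_all add: UU_add VV_add)

sublocale central_steinberg_rep M p n t g UU VV
proof unfold_locales
  fix u u' v v' :: 'r assume u: "u * u' = 1" and v: "v * v' = 1"
  have uv: "(u * v) * (u' * v') = 1" using u v by (simp add: mult_ac cancel_inv[OF u])
  have "mm (mm (hm u u') (hm v v')) (minv (hm (u * v) (u' * v'))) = xm 0"
    using uv by (simp add: hm_def xm_def mult_ac)
  hence "lift ((W u u' - W 1 1) + (W v v' - W 1 1) - (W (u * v) (u' * v') - W 1 1)) (xm 0)"
    using lift_minus[OF lift_plus[OF lift_WW[OF u] lift_WW[OF v]] lift_WW[OF uv]] unfolding W_def by simp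
  thus "(W u u' - W 1 1) + (W v v' - W 1 1) - (W (u * v) (u' * v') - W 1 1) \<in> {z. \<forall>x. z + x = x + z}"
    using lift_central by blast
qed

theorem lift_section: "\<exists>S. (\<forall>m\<in>SL. lift (S m) m) \<and> (\<forall>m\<in>SL. \<forall>k\<in>SL. S (mm m k) = S m + S k)"
proof -
  have "lift (sec m) m" if "m \<in> SL" for m
    using that by (induction rule: SL_induct) (simp_all add: sec_x sec_y lift_UU lift_VV sec_mm lift_plus)
  thus ?thesis using sec_mm by blast
qed

end

section \<open>The universal cocycle extension\<close>

lemma bar_boundary_diff: "bar_boundary G (a - b) = bar_boundary G a - bar_boundary G b"
  by (simp add: bar_boundary_def frag_extend_diff)

lemma bar_boundary_add: "bar_boundary G (a + b) = bar_boundary G a + bar_boundary G b"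
  by (simp add: bar_boundary_def frag_extend_add)

lemma bar_boundary_0 [simp]: "bar_boundary G 0 = 0" by (simp add: bar_boundary_def)

lemma bar_boundary_2: "bar_boundary G (frag_of [x, y]) = frag_of [y] - frag_of [x \<otimes>\<^bsub>G\<^esub> y] + frag_of [x]"
  by (simp add: bar_boundary_def bar_face_def atMost_Suc)

lemma bar_boundary_3: "bar_boundary G (frag_of [x, y, z]) =
    frag_of [y, z] - frag_of [x \<otimes>\<^bsub>G\<^esub> y, z] + frag_of [x, y \<otimes>\<^bsub>G\<^esub> z] - frag_of [x, y]"
  by (simp add: bar_boundary_def bar_face_def atMost_Suc)

lemma length_2_cases: assumes "length gs = 2" obtains x y where "gs = [x, y]"
  using assms by (auto simp: numeral_2_eq_2 length_Suc_conv)

lemma length_3_cases: assumes "length gs = 3" obtains x y z where "gs = [x, y, z]"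
  using assms by (auto simp: numeral_3_eq_3 length_Suc_conv)

lemma carrier_bar_chain_group: "c \<in> carrier (bar_chain_group G n) \<longleftrightarrow> Poly_Mapping.keys c \<subseteq> {gs. length gs = n \<and> set gs \<subseteq> carrier G}"
  by (simp add: bar_chain_group_def)

lemma group_bar_chain_group: "group (bar_chain_group G n)" "comm_group (bar_chain_group G n)"
  by (simp_all add: bar_chain_group_def abelian_free_Abelian_group)

lemma bar_cycles_iff: "c \<in> bar_cycles G n \<longleftrightarrow> c \<in> carrier (bar_chain_group G n) \<and> bar_boundary G c = 0"
  by (auto simp: bar_cycles_def kernel_def bar_chain_group_def)

lemma bar_chain_add: "a \<in> carrier (bar_chain_group G n) \<Longrightarrow> b \<in> carrier (bar_chain_group G n) \<Longrightarrow>
    a + b \<in> carrier (bar_chain_group G n)"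
  unfolding carrier_bar_chain_group by (intro order_trans[OF keys_add] Un_least)

lemma bar_chain_diff: "a \<in> carrier (bar_chain_group G n) \<Longrightarrow> b \<in> carrier (bar_chain_group G n) \<Longrightarrow>
    a - b \<in> carrier (bar_chain_group G n)"
  unfolding carrier_bar_chain_group by (intro order_trans[OF keys_diff] Un_least)

lemma bar_boundary_3_cycle:
  assumes G: "group G" and c: "c \<in> carrier (bar_chain_group G 3)"
  shows "bar_boundary G c \<in> bar_cycles G 2"
  using c unfolding carrier_bar_chain_group
proof (induction c rule: frag_induction)
  case (one gs)
  then obtain x y z where gs: "gs = [x, y, z]" "x \<in> carrier G" "y \<in> carrier G" "z \<in> carrier G"
    by (auto elim!: length_3_cases)
  interpret group G by fact
  have "bar_boundary G (frag_of gs) \<in> carrier (bar_chain_group G 2)" unfolding gs bar_boundary_3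
    using gs by (intro bar_chain_add bar_chain_diff) (simp_all add: carrier_bar_chain_group)
  moreover have "bar_boundary G (bar_boundary G (frag_of gs)) = 0"
    unfolding gs bar_boundary_3 bar_boundary_diff bar_boundary_add bar_boundary_2 using gs by (simp add: m_assoc)
  ultimately show ?case by (simp add: bar_cycles_iff)
next
  case (diff a b)
  thus ?case unfolding bar_boundary_diff bar_cycles_iff by (simp add: bar_boundary_diff bar_chain_diff)
qed (simp add: bar_cycles_iff carrier_bar_chain_group)

lemma bar_boundaries_2: "bar_boundaries G 2 = bar_boundary G ` carrier (bar_chain_group G 3)"
  by (simp add: bar_boundaries_def numeral_3_eq_3 numeral_2_eq_2)

lemma bar_boundaries_diff: "a \<in> bar_boundaries G n \<Longrightarrow> b \<in> bar_boundaries G n \<Longrightarrow> a - b \<in> bar_boundaries G n"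
proof -
  assume "a \<in> bar_boundaries G n" "b \<in> bar_boundaries G n"
  then obtain x y where xy: "a = bar_boundary G x" "b = bar_boundary G y"
     "x \<in> carrier (bar_chain_group G (Suc n))" "y \<in> carrier (bar_chain_group G (Suc n))" by (auto simp: bar_boundaries_def)
  have "x - y \<in> carrier (bar_chain_group G (Suc n))" using xy
    unfolding carrier_bar_chain_group by (intro order_trans[OF keys_diff] Un_least)
  moreover have "a - b = bar_boundary G (x - y)" by (simp add: xy bar_boundary_diff)
  ultimately show ?thesis unfolding bar_boundaries_def by blast
qed

lemma bar_boundaries_0: "0 \<in> bar_boundaries G n"
  unfolding bar_boundaries_def by (rule image_eqI[of _ _ 0]) (simp_all add: carrier_bar_chain_group)

lemma bar_boundaries_uminus: "a \<in> bar_boundaries G n \<Longrightarrow> - a \<in> bar_boundaries G n"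
  using bar_boundaries_diff[OF bar_boundaries_0] by fastforce

lemma bar_boundaries_add: "a \<in> bar_boundaries G n \<Longrightarrow> b \<in> bar_boundaries G n \<Longrightarrow> a + b \<in> bar_boundaries G n"
  using bar_boundaries_diff[of a G n "- b"] bar_boundaries_uminus by fastforce

lemma trivial_group_homology_2:
  assumes G: "group G" and "bar_cycles G 2 \<subseteq> bar_boundaries G 2"
  shows "trivial_group (group_homology 2 G)"
proof -
  let ?C = "bar_chain_group G 2" and ?Z = "bar_cycles G 2" and ?B = "bar_boundaries G 2"
  interpret C: comm_group ?C by (rule group_bar_chain_group)
  have ZB: "?Z = ?B" using assms(2) bar_boundary_3_cycle[OF G] by (auto simp: bar_boundaries_2)
  have inv: "inv\<^bsub>?C\<^esub> c = - c" if "c \<in> carrier ?C" for c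
    using that unfolding bar_chain_group_def by simp
  have Z: "subgroup ?Z ?C"
  proof (rule C.subgroupI)
    show "?Z \<subseteq> carrier ?C" by (auto simp: bar_cycles_iff)
    show "?Z \<noteq> {}" unfolding ZB using bar_boundaries_0 by blast
    show "inv\<^bsub>?C\<^esub> c \<in> ?Z" if "c \<in> ?Z" for c
      using that bar_boundaries_uminus inv unfolding ZB[symmetric] by (metis ZB bar_cycles_iff)
    show "a \<otimes>\<^bsub>?C\<^esub> b \<in> ?Z" if "a \<in> ?Z" "b \<in> ?Z" for a b
      using that bar_boundaries_add unfolding ZB by (simp add: bar_chain_group_def)
  qed
  let ?H = "subgroup_generated ?C ?Z"
  have cH: "carrier ?H = ?B" using subgroup.carrier_subgroup_generated_subgroup[OF Z] ZB by simp
  interpret H: group ?H by (rule C.group_subgroup_generated)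
  have "subgroup ?B ?H" using H.subgroup_self unfolding cH .
  moreover have "comm_group ?H" by (rule C.abelian_subgroup_generated[OF group_bar_chain_group(2)])
  ultimately have N: "?B \<lhd> ?H" using comm_group.subgroup_imp_normal by blast
  have "carrier (?H Mod ?B) = {?B}"
    using H.coset_join2[OF _ \<open>subgroup ?B ?H\<close>] subgroup.one_closed[OF \<open>subgroup ?B ?H\<close>]
    by (auto simp: FactGroup_def RCOSETS_def cH)
  thus ?thesis using normal.factorgroup_is_group[OF N] by (simp add: trivial_group_def group_homology_def FactGroup_def)
qed

text \<open>A cochain \<open>s\<close> splitting the universal cocycle \<open>[x|y]\<close> modulo boundaries gives a retraction of
  \<open>C\<^sub>2 / B\<^sub>2 \<rightarrow> C\<^sub>1\<close>, so that the cycles are boundaries.\<close>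

lemma trivial_homology_if_split:
  fixes G :: "('g, 'm) monoid_scheme" and s :: "'g \<Rightarrow> 'g list \<Rightarrow>\<^sub>0 int"
  assumes G: "group G"
    and s: "\<And>x y. x \<in> carrier G \<Longrightarrow> y \<in> carrier G \<Longrightarrow>
      frag_of [x, y] + s x + s y - s (x \<otimes>\<^bsub>G\<^esub> y) \<in> bar_boundaries G 2"
  shows "trivial_group (group_homology 2 G)"
proof (rule trivial_group_homology_2[OF G], rule subsetI)
  fix c assume "c \<in> bar_cycles G 2"
  hence c: "Poly_Mapping.keys c \<subseteq> {gs. length gs = 2 \<and> set gs \<subseteq> carrier G}" "bar_boundary G c = 0"
    by (auto simp: bar_cycles_iff carrier_bar_chain_group)
  let ?f = "frag_extend (\<lambda>l. s (hd l))"
  have "c + ?f (bar_boundary G c) \<in> bar_boundaries G 2" using c(1)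
  proof (induction c rule: frag_induction)
    case (one gs)
    then obtain x y where gs: "gs = [x, y]" "x \<in> carrier G" "y \<in> carrier G" by (auto elim!: length_2_cases)
    thus ?case using s[OF gs(2,3)] by (simp add: bar_boundary_2 frag_extend_add frag_extend_diff algebra_simps)
  next
    case (diff a b)
    have "a - b + ?f (bar_boundary G (a - b)) = (a + ?f (bar_boundary G a)) - (b + ?f (bar_boundary G b))"
      by (simp add: bar_boundary_diff frag_extend_diff)
    thus ?case using diff bar_boundaries_diff by metis
  qed (simp add: bar_boundaries_0)
  thus "c \<in> bar_boundaries G 2" using c(2) by simp
qed

text \<open>An element of the universal cocycle extension of \<open>G\<close> is a pair \<open>(c + B\<^sub>2, x)\<close>, encoded as the set
  of all \<open>(c', x)\<close> with \<open>c'\<close> in that coset.\<close>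

definition ext :: "('g, 'm) monoid_scheme \<Rightarrow> ('g list \<Rightarrow>\<^sub>0 int) \<Rightarrow> 'g \<Rightarrow> (('g list \<Rightarrow>\<^sub>0 int) \<times> 'g) set" where
  "ext G c x = {(c + b, x) |b. b \<in> bar_boundaries G 2}"

definition ext_mult :: "('g, 'm) monoid_scheme \<Rightarrow> (('g list \<Rightarrow>\<^sub>0 int) \<times> 'g) set \<Rightarrow> (('g list \<Rightarrow>\<^sub>0 int) \<times> 'g) set \<Rightarrow> (('g list \<Rightarrow>\<^sub>0 int) \<times> 'g) set" where
  "ext_mult G P Q = {(c + d + frag_of [x, y], x \<otimes>\<^bsub>G\<^esub> y) |c x d y. (c, x) \<in> P \<and> (d, y) \<in> Q}"

lemma ext_eq_iff: "ext G c x = ext G d y \<longleftrightarrow> x = y \<and> c - d \<in> bar_boundaries G 2"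
proof
  assume e: "ext G c x = ext G d y"
  have "(c, x) \<in> ext G c x" unfolding ext_def using bar_boundaries_0 by force
  hence "(c, x) \<in> ext G d y" using e by simp
  thus "x = y \<and> c - d \<in> bar_boundaries G 2" by (auto simp: ext_def)
next
  assume a: "x = y \<and> c - d \<in> bar_boundaries G 2"
  have "(c + b, y) \<in> ext G d y" if "b \<in> bar_boundaries G 2" for b
    unfolding ext_def using a that bar_boundaries_add[of "c - d" G 2 b]
    by (auto intro!: exI[of _ "c - d + b"])
  moreover have "(d + b, y) \<in> ext G c y" if "b \<in> bar_boundaries G 2" for b
    unfolding ext_def using a that bar_boundaries_diff[of b G 2 "c - d"]
    by (auto intro!: exI[of _ "b - (c - d)"])
  ultimately show "ext G c x = ext G d y" using a unfolding ext_def[of G c] ext_def[of G d]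
    by (auto simp: ext_def)
qed

lemma ext_mult: "ext_mult G (ext G c x) (ext G d y) = ext G (c + d + frag_of [x, y]) (x \<otimes>\<^bsub>G\<^esub> y)"
proof (intro equalityI subsetI)
  fix z assume "z \<in> ext_mult G (ext G c x) (ext G d y)"
  then obtain b b' where "b \<in> bar_boundaries G 2" "b' \<in> bar_boundaries G 2"
    "z = (c + d + frag_of [x, y] + (b + b'), x \<otimes>\<^bsub>G\<^esub> y)" by (auto simp: ext_mult_def ext_def algebra_simps)
  thus "z \<in> ext G (c + d + frag_of [x, y]) (x \<otimes>\<^bsub>G\<^esub> y)" unfolding ext_def using bar_boundaries_add by blast
next
  fix z assume "z \<in> ext G (c + d + frag_of [x, y]) (x \<otimes>\<^bsub>G\<^esub> y)"
  then obtain b where b: "b \<in> bar_boundaries G 2" "z = (c + b + (d + 0) + frag_of [x, y], x \<otimes>\<^bsub>G\<^esub> y)"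
    by (auto simp: ext_def algebra_simps)
  moreover have "(c + b, x) \<in> ext G c x" using b by (auto simp: ext_def)
  moreover have "(d + 0, y) \<in> ext G d y" using bar_boundaries_0 unfolding ext_def by blast
  ultimately show "z \<in> ext_mult G (ext G c x) (ext G d y)" unfolding ext_mult_def by blast
qed

lemma cocycle:
  assumes "x \<in> carrier G" "y \<in> carrier G" "z \<in> carrier G"
  shows "frag_of [y, z] - frag_of [x \<otimes>\<^bsub>G\<^esub> y, z] + frag_of [x, y \<otimes>\<^bsub>G\<^esub> z] - frag_of [x, y] \<in> bar_boundaries G 2"
  unfolding bar_boundary_3[symmetric] bar_boundaries_2 using assms
  by (intro imageI) (simp add: carrier_bar_chain_group)

definition ext_carrier :: "('g, 'm) monoid_scheme \<Rightarrow> (('g list \<Rightarrow>\<^sub>0 int) \<times> 'g) set set" where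
  "ext_carrier G = {ext G c x |c x. x \<in> carrier G}"

text \<open>The bar cocycle is not normalised, and the correction -[1|1] compensates for
  that.\<close>

definition ext_one :: "('g, 'm) monoid_scheme \<Rightarrow> (('g list \<Rightarrow>\<^sub>0 int) \<times> 'g) set" where
  "ext_one G = ext G (- frag_of [\<one>\<^bsub>G\<^esub>, \<one>\<^bsub>G\<^esub>]) \<one>\<^bsub>G\<^esub>"

definition ext_inv :: "('g, 'm) monoid_scheme \<Rightarrow> (('g list \<Rightarrow>\<^sub>0 int) \<times> 'g) set \<Rightarrow> (('g list \<Rightarrow>\<^sub>0 int) \<times> 'g) set" where
  "ext_inv G P = (SOME Q. Q \<in> ext_carrier G \<and> ext_mult G Q P = ext_one G)"

context group begin

lemma ext_mult_closed: "P \<in> ext_carrier G \<Longrightarrow> Q \<in> ext_carrier G \<Longrightarrow> ext_mult G P Q \<in> ext_carrier G"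
  unfolding ext_carrier_def by (clarsimp simp: ext_mult) (blast intro: m_closed)

lemma ext_one_closed: "ext_one G \<in> ext_carrier G" by (auto simp: ext_carrier_def ext_one_def)

lemma ext_assoc: "P \<in> ext_carrier G \<Longrightarrow> Q \<in> ext_carrier G \<Longrightarrow> R \<in> ext_carrier G \<Longrightarrow>
  ext_mult G (ext_mult G P Q) R = ext_mult G P (ext_mult G Q R)"
proof -
  assume "P \<in> ext_carrier G" "Q \<in> ext_carrier G" "R \<in> ext_carrier G"
  then obtain c x d y e z where P: "P = ext G c x" "x \<in> carrier G" "Q = ext G d y" "y \<in> carrier G"
     "R = ext G e z" "z \<in> carrier G" by (auto simp: ext_carrier_def)
  show ?thesis using bar_boundaries_uminus[OF cocycle[of x G y z]] P
    by (simp add: ext_mult ext_eq_iff m_assoc algebra_simps)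
qed

lemma ext_one_left: "P \<in> ext_carrier G \<Longrightarrow> ext_mult G (ext_one G) P = P"
proof -
  assume "P \<in> ext_carrier G"
  then obtain c x where P: "P = ext G c x" "x \<in> carrier G" by (auto simp: ext_carrier_def)
  show ?thesis using cocycle[of \<one> G \<one> x] P
    by (simp add: ext_mult ext_eq_iff ext_one_def algebra_simps)
qed

lemma ext_inv: assumes "P \<in> ext_carrier G"
  shows "ext_inv G P \<in> ext_carrier G" "ext_mult G (ext_inv G P) P = ext_one G"
proof -
  obtain c x where P: "P = ext G c x" "x \<in> carrier G" using assms by (auto simp: ext_carrier_def)
  have "ext G (- frag_of [\<one>, \<one>] - c - frag_of [inv x, x]) (inv x) \<in> ext_carrier G" using P by (auto simp: ext_carrier_def)
  moreover have "ext_mult G (ext G (- frag_of [\<one>, \<one>] - c - frag_of [inv x, x]) (inv x)) P = ext_one G"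
    using P by (simp add: ext_mult ext_eq_iff ext_one_def bar_boundaries_0)
  ultimately have "\<exists>Q. Q \<in> ext_carrier G \<and> ext_mult G Q P = ext_one G" by blast
  from someI_ex[OF this] show "ext_inv G P \<in> ext_carrier G" "ext_mult G (ext_inv G P) P = ext_one G"
    unfolding ext_inv_def by blast+
qed

text \<open>Modulo boundaries, [1|x] and [x|1] both agree with [1|1], as the boundaries of [1|1|x]
  and [x|1|1] show.\<close>

lemma ext_central: assumes x: "x \<in> carrier G"
  shows "ext_mult G (ext G c \<one>) (ext G d x) = ext_mult G (ext G d x) (ext G c \<one>)"
proof -
  have 1: "frag_of [\<one>, x] - frag_of [\<one>, \<one>] \<in> bar_boundaries G 2"
    using cocycle[of \<one> G \<one> x] x by (simp add: algebra_simps)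
  have 2: "frag_of [\<one>, \<one>] - frag_of [x, \<one>] \<in> bar_boundaries G 2"
    using cocycle[of x G \<one> \<one>] x by (simp add: algebra_simps)
  show ?thesis using bar_boundaries_add[OF 1 2] x by (simp add: ext_mult ext_eq_iff algebra_simps)
qed

end

section \<open>Passage to rings given by carrier sets\<close>

lemma (in cring) SL2_group: "group (SL2 R)"
proof -
  have a: "a \<otimes> d \<ominus> b \<otimes> c = \<one> \<Longrightarrow> a' \<otimes> d' \<ominus> b' \<otimes> c' = \<one> \<Longrightarrow>
     a \<in> carrier R \<Longrightarrow> b \<in> carrier R \<Longrightarrow> c \<in> carrier R \<Longrightarrow> d \<in> carrier R \<Longrightarrow>
     a' \<in> carrier R \<Longrightarrow> b' \<in> carrier R \<Longrightarrow> c' \<in> carrier R \<Longrightarrow> d' \<in> carrier R \<Longrightarrow>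
     (a \<otimes> a' \<oplus> b \<otimes> c') \<otimes> (c \<otimes> b' \<oplus> d \<otimes> d') \<ominus> (a \<otimes> b' \<oplus> b \<otimes> d') \<otimes> (c \<otimes> a' \<oplus> d \<otimes> c') = \<one>" for a b c d a' b' c' d'
  proof -
    assume h: "a \<otimes> d \<ominus> b \<otimes> c = \<one>" "a' \<otimes> d' \<ominus> b' \<otimes> c' = \<one>"
     "a \<in> carrier R" "b \<in> carrier R" "c \<in> carrier R" "d \<in> carrier R"
     "a' \<in> carrier R" "b' \<in> carrier R" "c' \<in> carrier R" "d' \<in> carrier R"
    have "(a \<otimes> a' \<oplus> b \<otimes> c') \<otimes> (c \<otimes> b' \<oplus> d \<otimes> d') \<ominus> (a \<otimes> b' \<oplus> b \<otimes> d') \<otimes> (c \<otimes> a' \<oplus> d \<otimes> c')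
      = (a \<otimes> d \<ominus> b \<otimes> c) \<otimes> (a' \<otimes> d' \<ominus> b' \<otimes> c')" using h(3-) by algebra
    thus ?thesis using h by simp
  qed
  have as: "(a \<otimes> x \<oplus> b \<otimes> y) \<otimes> v \<oplus> (a \<otimes> z \<oplus> b \<otimes> w) \<otimes> u = a \<otimes> (x \<otimes> v \<oplus> z \<otimes> u) \<oplus> b \<otimes> (y \<otimes> v \<oplus> w \<otimes> u)"
    if "a \<in> carrier R" "b \<in> carrier R" "x \<in> carrier R" "y \<in> carrier R" "z \<in> carrier R" "w \<in> carrier R"
      "v \<in> carrier R" "u \<in> carrier R" for a b x y z w u v
    using that by algebra
  have one_minus_zero: "\<one> \<ominus> \<zero> = \<one>" by algebra
  show ?thesis
  proof (rule groupI)
    fix x y z assume "x \<in> carrier (SL2 R)" "y \<in> carrier (SL2 R)" "z \<in> carrier (SL2 R)"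
    thus "x \<otimes>\<^bsub>SL2 R\<^esub> y \<otimes>\<^bsub>SL2 R\<^esub> z = x \<otimes>\<^bsub>SL2 R\<^esub> (y \<otimes>\<^bsub>SL2 R\<^esub> z)"
      by (auto simp: SL2_def as)
  next
    fix x assume "x \<in> carrier (SL2 R)"
    then obtain a b c d where x: "x = (a,b,c,d)" "a \<in> carrier R" "b \<in> carrier R" "c \<in> carrier R" "d \<in> carrier R"
      "a \<otimes> d \<ominus> b \<otimes> c = \<one>" by (auto simp: SL2_def)
    have 1: "d \<otimes> a \<ominus> (\<ominus> b) \<otimes> (\<ominus> c) = \<one>" "d \<otimes> a \<oplus> (\<ominus> b) \<otimes> c = \<one>" "(\<ominus> c) \<otimes> b \<oplus> a \<otimes> d = \<one>"
     "d \<otimes> b \<oplus> (\<ominus> b) \<otimes> d = \<zero>" "(\<ominus> c) \<otimes> a \<oplus> a \<otimes> c = \<zero>"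
      using x by algebra+
    show "\<exists>y\<in>carrier (SL2 R). y \<otimes>\<^bsub>SL2 R\<^esub> x = \<one>\<^bsub>SL2 R\<^esub>"
      using x 1 by (intro bexI[of _ "(d, \<ominus> b, \<ominus> c, a)"]) (simp_all add: SL2_def)
  qed (auto simp: SL2_def a one_minus_zero)
qed

text \<open>The axioms of \<open>cyclic_chain_ring\<close> and the conditions on r from
  \<open>lift_system\<close>, in terms of carrier sets and as one predicate, so that a ring
  satisfying them can be picked by choice.\<close>

definition good_param :: "('a, 'r) ring_scheme \<Rightarrow> nat \<Rightarrow> nat \<Rightarrow> 'a \<Rightarrow> 'a \<Rightarrow> 'a \<Rightarrow> bool" where
  "good_param A p n t g r \<longleftrightarrow>
     Factorial_Ring.prime p \<and> odd p \<and> t \<in> carrier A \<and> t [^]\<^bsub>A\<^esub> n = \<zero>\<^bsub>A\<^esub> \<and>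
     (\<forall>a\<in>carrier A. a \<in> Units A \<longleftrightarrow> \<not> (\<exists>b\<in>carrier A. a = t \<otimes>\<^bsub>A\<^esub> b)) \<and>
     (add_pow A p \<one>\<^bsub>A\<^esub> = \<zero>\<^bsub>A\<^esub> \<or> (\<exists>w\<in>Units A. add_pow A p \<one>\<^bsub>A\<^esub> = t \<otimes>\<^bsub>A\<^esub> w)) \<and>
     (\<forall>a\<in>carrier A. \<exists>b\<in>carrier A. \<exists>c\<in>carrier A. a = b [^]\<^bsub>A\<^esub> p \<oplus>\<^bsub>A\<^esub> t \<otimes>\<^bsub>A\<^esub> c) \<and>
     g \<in> Units A \<and> (\<forall>u\<in>Units A. \<exists>i::nat. \<exists>c\<in>carrier A. u = g [^]\<^bsub>A\<^esub> i \<oplus>\<^bsub>A\<^esub> t \<otimes>\<^bsub>A\<^esub> c) \<and>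
     r \<in> Units A \<and> r \<oplus>\<^bsub>A\<^esub> \<one>\<^bsub>A\<^esub> \<in> Units A \<and> r \<ominus>\<^bsub>A\<^esub> \<one>\<^bsub>A\<^esub> \<in> Units A \<and> r \<otimes>\<^bsub>A\<^esub> r \<oplus>\<^bsub>A\<^esub> \<one>\<^bsub>A\<^esub> \<in> Units A \<and>
     r \<otimes>\<^bsub>A\<^esub> r \<ominus>\<^bsub>A\<^esub> r \<ominus>\<^bsub>A\<^esub> \<one>\<^bsub>A\<^esub> \<in> Units A \<and> r \<otimes>\<^bsub>A\<^esub> r \<oplus>\<^bsub>A\<^esub> r \<ominus>\<^bsub>A\<^esub> \<one>\<^bsub>A\<^esub> \<in> Units A"

definition bad :: "('a, 'r) ring_scheme \<Rightarrow> bool" where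
  "bad A \<longleftrightarrow> cring A \<and> \<one>\<^bsub>A\<^esub> \<noteq> \<zero>\<^bsub>A\<^esub> \<and> (\<exists>p n t g r. good_param A p n t g r) \<and> \<not> trivial_group (group_homology 2 (SL2 A))"

text \<open>The arguments above are about type classes. To apply them to a ring given by a carrier set, a
  hypothetical counterexample is fixed by a constant and turned into a type; if there is no
  counterexample, that type is a copy of \<open>\<int>\<close>.\<close>

definition bad_ring :: "('a, 'r) ring_scheme" where
  "bad_ring = (if \<exists>A :: ('a, 'r) ring_scheme. bad A then SOME A. bad A
     else \<lparr>carrier = {undefined}, monoid.mult = (\<lambda>_ _. undefined), one = undefined,
            ring.zero = undefined, ring.add = (\<lambda>_ _. undefined), \<dots> = undefined\<rparr>)"

lemma bad_ring: "bad (A :: ('a, 'r) ring_scheme) \<Longrightarrow> bad (bad_ring :: ('a, 'r) ring_scheme)"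
proof -
  assume "bad A"
  hence ex: "\<exists>A :: ('a, 'r) ring_scheme. bad A" by (rule exI)
  show ?thesis unfolding bad_ring_def if_P[OF ex] using ex by (rule someI_ex)
qed

lemma cring_bad_ring: "cring (bad_ring :: ('a, 'r) ring_scheme)"
proof (cases "\<exists>A :: ('a, 'r) ring_scheme. bad A")
  case True
  thus ?thesis using bad_ring unfolding bad_def by blast
next
  case False
  thus ?thesis unfolding bad_ring_def by (auto intro!: cringI abelian_groupI comm_monoidI)
qed

typedef (overloaded) ('a, 'r) sl2_ext = "ext_carrier (SL2 (bad_ring :: ('a, 'r) ring_scheme))"
  using group.ext_one_closed[OF cring.SL2_group[OF cring_bad_ring]] by blast

instantiation sl2_ext :: (type, type) group_add
begin
definition plus_sl2_ext :: "('a, 'b) sl2_ext \<Rightarrow> ('a, 'b) sl2_ext \<Rightarrow> ('a, 'b) sl2_ext" where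
  "x + y = Abs_sl2_ext (ext_mult (SL2 (bad_ring :: ('a, 'b) ring_scheme)) (Rep_sl2_ext x) (Rep_sl2_ext y))"
definition zero_sl2_ext :: "('a, 'b) sl2_ext" where
  "0 = Abs_sl2_ext (ext_one (SL2 (bad_ring :: ('a, 'b) ring_scheme)))"
definition uminus_sl2_ext :: "('a, 'b) sl2_ext \<Rightarrow> ('a, 'b) sl2_ext" where
  "- x = Abs_sl2_ext (ext_inv (SL2 (bad_ring :: ('a, 'b) ring_scheme)) (Rep_sl2_ext x))"
definition minus_sl2_ext :: "('a, 'b) sl2_ext \<Rightarrow> ('a, 'b) sl2_ext \<Rightarrow> ('a, 'b) sl2_ext" where "minus_sl2_ext x y = x + - y"

lemma Rep_sl2_ext_ops:
  fixes x y :: "('a, 'b) sl2_ext"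
  shows "Rep_sl2_ext (x + y) = ext_mult (SL2 (bad_ring :: ('a, 'b) ring_scheme)) (Rep_sl2_ext x) (Rep_sl2_ext y)"
    "Rep_sl2_ext (0 :: ('a, 'b) sl2_ext) = ext_one (SL2 (bad_ring :: ('a, 'b) ring_scheme))"
    "Rep_sl2_ext (- x) = ext_inv (SL2 (bad_ring :: ('a, 'b) ring_scheme)) (Rep_sl2_ext x)"
proof -
  interpret G: group "SL2 (bad_ring :: ('a, 'b) ring_scheme)" by (rule cring.SL2_group[OF cring_bad_ring])
  note c = Rep_sl2_ext[of x] Rep_sl2_ext[of y]
  show "Rep_sl2_ext (x + y) = ext_mult (SL2 (bad_ring :: ('a, 'b) ring_scheme)) (Rep_sl2_ext x) (Rep_sl2_ext y)"
    "Rep_sl2_ext (0 :: ('a, 'b) sl2_ext) = ext_one (SL2 (bad_ring :: ('a, 'b) ring_scheme))"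
    "Rep_sl2_ext (- x) = ext_inv (SL2 (bad_ring :: ('a, 'b) ring_scheme)) (Rep_sl2_ext x)"
    unfolding plus_sl2_ext_def zero_sl2_ext_def uminus_sl2_ext_def
    using c G.ext_mult_closed G.ext_one_closed G.ext_inv by (simp_all add: Abs_sl2_ext_inverse)
qed

instance
proof
  interpret G: group "SL2 (bad_ring :: ('a, 'b) ring_scheme)" by (rule cring.SL2_group[OF cring_bad_ring])
  fix x y z :: "('a, 'b) sl2_ext"
  note c = Rep_sl2_ext[of x] Rep_sl2_ext[of y] Rep_sl2_ext[of z]
  note i = G.ext_inv[OF c(1)]
  show "x + y + z = x + (y + z)" "0 + x = x" "- x + x = 0"
    using c by (simp_all add: Rep_sl2_ext_inject[symmetric] Rep_sl2_ext_ops G.ext_assoc G.ext_one_left G.ext_inv)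
  have o: "ext_one (SL2 (bad_ring :: ('a, 'b) ring_scheme)) \<in> ext_carrier (SL2 (bad_ring :: ('a, 'b) ring_scheme))" by (rule G.ext_one_closed)
  show "x + - y = x - y" by (simp add: minus_sl2_ext_def)
  \<comment> \<open>The extension comes with left neutral and left inverse laws only. With b a left
    inverse of a and d one of b, the right law follows by inserting d b in front of a.\<close>
  show "x + 0 = x"
  proof -
    define m where "m = ext_mult (SL2 (bad_ring :: ('a, 'b) ring_scheme))"
    define C where "C = ext_carrier (SL2 (bad_ring :: ('a, 'b) ring_scheme))"
    define e where "e = ext_one (SL2 (bad_ring :: ('a, 'b) ring_scheme))"
    define a where "a = Rep_sl2_ext x"
    obtain b where b: "b \<in> C" "m b a = e" using i unfolding m_def C_def e_def a_def by blast
    obtain d where d: "d \<in> C" "m d b = e" using G.ext_inv[of b] b(1) unfolding m_def C_def e_def by blast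
    have a: "a \<in> C" using c unfolding a_def C_def by simp
    have ass: "m (m u v) w = m u (m v w)" if "u \<in> C" "v \<in> C" "w \<in> C" for u v w
      using that G.ext_assoc unfolding m_def C_def by blast
    have one: "m e u = u" if "u \<in> C" for u using that G.ext_one_left unfolding m_def C_def e_def by blast
    have cl: "e \<in> C" "m u v \<in> C" if "u \<in> C" "v \<in> C" for u v
      using that G.ext_mult_closed o unfolding m_def C_def e_def by blast+
    have "m a e = m (m (m d b) a) e" using one a d by simp
    also have "\<dots> = m (m d b) (m a e)" using ass a b d cl by metis
    also have "\<dots> = m d (m b (m a e))" using ass a b d cl by metis
    also have "m b (m a e) = m (m b a) e" using ass a b d cl by metis
    also have "\<dots> = m b a" using b one cl by metis
    also have "m d (m b a) = m (m d b) a" using ass a b d by metis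
    also have "\<dots> = a" using d one a by simp
    finally show ?thesis by (simp add: Rep_sl2_ext_inject[symmetric] Rep_sl2_ext_ops m_def e_def a_def)
  qed
qed

end

text \<open>The class \<open>comm_ring_1\<close> demands 0 \<noteq> 1, while the type
  \<open>'a\<close> may have a single element; the sum with \<open>int\<close> leaves room for the
  fallback ring. The \<open>itself\<close> argument records \<open>'r\<close>, which the result type
  does not mention.\<close>

definition bad_ring' :: "'r itself \<Rightarrow> ('a + int) ring" where
  "bad_ring' _ = (if \<exists>A :: ('a, 'r) ring_scheme. bad A then image_ring Inl (bad_ring :: ('a, 'r) ring_scheme)
     else image_ring Inr int_ring)"

lemma (in cring) image_ring_cring: assumes "inj f" shows "cring (image_ring f R)"
  using ring_iso_imp_img_cring[OF inj_imp_image_ring_iso[OF inj_on_subset[OF assms subset_UNIV]]]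
  by (simp add: image_ring_def monoid.defs)

lemma bad_ring': "cring (bad_ring' TYPE('r) :: ('a + int) ring)"
  "\<one>\<^bsub>(bad_ring' TYPE('r) :: ('a + int) ring)\<^esub> \<noteq> \<zero>\<^bsub>(bad_ring' TYPE('r) :: ('a + int) ring)\<^esub>"
proof -
  have "cring (image_ring Inl (bad_ring :: ('a, 'r) ring_scheme) :: ('a + int) ring)"
    by (rule cring.image_ring_cring[OF cring_bad_ring inj_Inl])
  moreover have "cring (image_ring Inr int_ring :: ('a + int) ring)"
    by (rule cring.image_ring_cring[OF int_is_cring inj_Inr])
  ultimately show "cring (bad_ring' TYPE('r) :: ('a + int) ring)" by (simp add: bad_ring'_def)
  show "\<one>\<^bsub>(bad_ring' TYPE('r) :: ('a + int) ring)\<^esub> \<noteq> \<zero>\<^bsub>(bad_ring' TYPE('r) :: ('a + int) ring)\<^esub>"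
  proof (cases "\<exists>A :: ('a, 'r) ring_scheme. bad A")
    case True
    hence "\<one>\<^bsub>(bad_ring :: ('a, 'r) ring_scheme)\<^esub> \<noteq> \<zero>\<^bsub>(bad_ring :: ('a, 'r) ring_scheme)\<^esub>"
      using bad_ring unfolding bad_def[of bad_ring] by blast
    thus ?thesis using True by (simp add: bad_ring'_def image_ring_one image_ring_zero)
  qed (simp add: bad_ring'_def image_ring_one image_ring_zero)
qed

typedef (overloaded) ('a, 'r) rng = "carrier (bad_ring' TYPE('r) :: ('a + int) ring)"
  using monoid.one_closed[OF ring.is_monoid[OF cring.axioms(1)[OF bad_ring'(1)]]] by blast

instantiation rng :: (type, type) comm_ring_1
begin
definition plus_rng :: "('a, 'b) rng \<Rightarrow> ('a, 'b) rng \<Rightarrow> ('a, 'b) rng" where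
  "x + y = Abs_rng (Rep_rng x \<oplus>\<^bsub>bad_ring' TYPE('b)\<^esub> Rep_rng (y :: ('a, 'b) rng))"
definition times_rng :: "('a, 'b) rng \<Rightarrow> ('a, 'b) rng \<Rightarrow> ('a, 'b) rng" where
  "x * y = Abs_rng (Rep_rng x \<otimes>\<^bsub>bad_ring' TYPE('b)\<^esub> Rep_rng (y :: ('a, 'b) rng))"
definition uminus_rng :: "('a, 'b) rng \<Rightarrow> ('a, 'b) rng" where
  "- x = Abs_rng (\<ominus>\<^bsub>bad_ring' TYPE('b)\<^esub> Rep_rng (x :: ('a, 'b) rng))"
definition minus_rng :: "('a, 'b) rng \<Rightarrow> ('a, 'b) rng \<Rightarrow> ('a, 'b) rng" where "minus_rng x y = x + - y"
definition zero_rng :: "('a, 'b) rng" where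
  "0 = (Abs_rng (\<zero>\<^bsub>bad_ring' TYPE('b)\<^esub>) :: ('a, 'b) rng)"
definition one_rng :: "('a, 'b) rng" where
  "1 = (Abs_rng (\<one>\<^bsub>bad_ring' TYPE('b)\<^esub>) :: ('a, 'b) rng)"

lemma Rep_rng_ops:
  fixes x y :: "('a, 'b) rng"
  shows "Rep_rng (x + y) = Rep_rng x \<oplus>\<^bsub>bad_ring' TYPE('b)\<^esub> Rep_rng y"
    "Rep_rng (x * y) = Rep_rng x \<otimes>\<^bsub>bad_ring' TYPE('b)\<^esub> Rep_rng y"
    "Rep_rng (- x) = \<ominus>\<^bsub>bad_ring' TYPE('b)\<^esub> Rep_rng x"
    "Rep_rng (0 :: ('a, 'b) rng) = \<zero>\<^bsub>bad_ring' TYPE('b)\<^esub>"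
    "Rep_rng (1 :: ('a, 'b) rng) = \<one>\<^bsub>bad_ring' TYPE('b)\<^esub>"
proof -
  interpret cring "bad_ring' TYPE('b) :: ('a + int) ring" by (rule bad_ring')
  note Rep_rng[of x] Rep_rng[of y]
  thus "Rep_rng (x + y) = Rep_rng x \<oplus>\<^bsub>bad_ring' TYPE('b)\<^esub> Rep_rng y"
    "Rep_rng (x * y) = Rep_rng x \<otimes>\<^bsub>bad_ring' TYPE('b)\<^esub> Rep_rng y"
    "Rep_rng (- x) = \<ominus>\<^bsub>bad_ring' TYPE('b)\<^esub> Rep_rng x"
    "Rep_rng (0 :: ('a, 'b) rng) = \<zero>\<^bsub>bad_ring' TYPE('b)\<^esub>"
    "Rep_rng (1 :: ('a, 'b) rng) = \<one>\<^bsub>bad_ring' TYPE('b)\<^esub>"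
    unfolding plus_rng_def times_rng_def uminus_rng_def zero_rng_def one_rng_def
    by (simp_all add: Abs_rng_inverse)
qed

instance
proof
  interpret cring "bad_ring' TYPE('b) :: ('a + int) ring" by (rule bad_ring')
  fix x y z :: "('a, 'b) rng"
  note c = Rep_rng[of x] Rep_rng[of y] Rep_rng[of z]
  note r = Rep_rng_inject[symmetric] Rep_rng_ops
  show "x + y + z = x + (y + z)" using c by (simp add: r a_assoc)
  show "x + y = y + x" unfolding r using c(1,2) by (rule a_comm)
  show "x * y * z = x * (y * z)" using c by (simp add: r m_assoc)
  show "x * y = y * x" unfolding r using c(1,2) by (rule m_comm)
  show "(x + y) * z = x * z + y * z" using c by (simp add: r l_distr)
  show "0 + x = x" "- x + x = 0" "1 * x = x" using c by (simp_all add: r l_neg)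
  show "x - y = x + - y" by (simp add: minus_rng_def)
  show "0 \<noteq> (1 :: ('a, 'b) rng)" using bad_ring'(2)[where ?'a = 'a and ?'r = 'b] by (simp add: r)
qed

end

section \<open>Transfer between rings as types and rings on carrier sets\<close>

locale ring_transfer = cring R for R :: "('a, 'r) ring_scheme" (structure) +
  fixes f :: "'t::comm_ring_1 \<Rightarrow> 'a"
  assumes bij: "bij_betw f UNIV (carrier R)"
    and f_add: "f (x + y) = f x \<oplus> f y" and f_mult: "f (x * y) = f x \<otimes> f y" and f_one: "f 1 = \<one>"
begin

lemma f_closed [simp]: "f x \<in> carrier R" using bij by (auto simp: bij_betw_def)

lemma f_inj [simp]: "f x = f y \<longleftrightarrow> x = y" using bij by (auto simp: bij_betw_def inj_def)

lemma f_surj: "a \<in> carrier R \<Longrightarrow> \<exists>x. a = f x" using bij by (auto simp: bij_betw_def)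

lemma f_zero: "f 0 = \<zero>"
  using f_add[of 0 0] by (metis add.r_cancel_one f_closed add_0)

lemma f_uminus: "f (- x) = \<ominus> f x"
  using f_add[of "- x" x] by (simp add: f_zero minus_equality)

lemma f_minus: "f (x - y) = f x \<ominus> f y"
  using f_add[of x "- y"] by (simp add: f_uminus a_minus_def)

lemma f_power: "f (x ^ k) = f x [^] k"
  by (induction k) (simp_all add: f_one f_mult m_comm)

lemma f_of_nat: "f (of_nat k) = add_pow R k \<one>"
  by (induction k) (simp_all add: f_zero f_add f_one a_comm)

lemma f_unit: "f x \<in> Units R \<longleftrightarrow> x dvd 1"
proof
  assume "f x \<in> Units R"
  hence "f x \<otimes> inv (f x) = \<one>" "inv (f x) \<in> carrier R" by auto
  then obtain y where "f x \<otimes> f y = \<one>" using f_surj by metis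
  hence "f (x * y) = f 1" by (simp add: f_mult f_one)
  hence "1 = x * y" by simp
  thus "x dvd 1" by (rule dvdI)
next
  assume "x dvd 1"
  then obtain y where y: "x * y = 1" by (auto simp: dvd_def)
  hence "f x \<otimes> f y = \<one>" "f y \<otimes> f x = \<one>" by (simp_all add: f_mult[symmetric] f_one[symmetric] mult.commute)
  thus "f x \<in> Units R" unfolding Units_def by (auto intro: bexI[of _ "f y"])
qed

lemma f_bex: "(\<exists>a\<in>carrier R. P a) \<longleftrightarrow> (\<exists>x. P (f x))"
  using f_surj f_closed by metis

lemma f_ball: "(\<forall>a\<in>carrier R. P a) \<longleftrightarrow> (\<forall>x. P (f x))"
  using f_surj f_closed by metis

lemma f_units_bex: "(\<exists>a\<in>Units R. P a) \<longleftrightarrow> (\<exists>x. x dvd 1 \<and> P (f x))"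
  using f_surj f_unit by (metis Units_closed)

lemma f_units_ball: "(\<forall>a\<in>Units R. P a) \<longleftrightarrow> (\<forall>x. x dvd 1 \<longrightarrow> P (f x))"
  using f_surj f_unit by (metis Units_closed)

lemmas f_rules = f_add[symmetric] f_mult[symmetric] f_one[symmetric] f_zero[symmetric] f_minus[symmetric] f_power[symmetric]

lemma transfer_param:
  assumes "good_param R p n (f t) (f g) (f r)"
  shows "cyclic_chain_ring (range ((*) t)) p n t g"
    and "r dvd 1" "r + 1 dvd 1" "r - 1 dvd 1" "r * r + 1 dvd 1" "r * r - r - 1 dvd 1" "r * r + r - 1 dvd 1"
proof -
  note h = assms[unfolded good_param_def f_of_nat[symmetric], unfolded f_bex f_ball f_units_bex f_units_ball f_rules f_unit f_inj]
  have r: "r dvd 1" "r + 1 dvd 1" "r - 1 dvd 1" "r * r + 1 dvd 1" "r * r - r - 1 dvd 1" "r * r + r - 1 dvd 1"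
    and basic: "Factorial_Ring.prime p" "odd p" "t ^ n = 0" "g dvd 1" "of_nat p = (0::'t) \<or> (\<exists>w. w dvd 1 \<and> of_nat p = t * w)"
    and mem': "\<forall>a. a dvd 1 \<longleftrightarrow> \<not> (\<exists>b. a = t * b)"
    and perf: "\<forall>a. \<exists>b c. a = b ^ p + t * c"
    and gen: "\<forall>u. u dvd 1 \<longrightarrow> (\<exists>i c. u = g ^ i + t * c)"
    using h by - (elim conjE, assumption)+
  show "r dvd 1" "r + 1 dvd 1" "r - 1 dvd 1" "r * r + 1 dvd 1" "r * r - r - 1 dvd 1" "r * r + r - 1 dvd 1" by fact+
  have mem: "a \<in> range ((*) t) \<longleftrightarrow> \<not> a dvd 1" for a
    unfolding mem'[rule_format, of a] by auto
  show "cyclic_chain_ring (range ((*) t)) p n t g"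
  proof unfold_locales
    show "a \<in> range ((*) t) \<longleftrightarrow> \<not> a dvd 1" for a by (rule mem)
    show "a + b \<in> range ((*) t)" if "a \<in> range ((*) t)" "b \<in> range ((*) t)" for a b
      using that by (auto simp: distrib_left[symmetric])
    show "\<exists>b. a - b ^ p \<in> range ((*) t)" for a
    proof -
      obtain b c where "a = b ^ p + t * c" using perf by blast
      hence "a - b ^ p = t * c" by simp
      thus ?thesis by blast
    qed
    show "\<exists>i. u - g ^ i \<in> range ((*) t)" if "u dvd 1" for u
    proof -
      obtain i c where "u = g ^ i + t * c" using gen \<open>u dvd 1\<close> by blast
      hence "u - g ^ i = t * c" by simp
      thus ?thesis by blast
    qed
    have "1 - r dvd 1" using r(3) minus_dvd_iff[of "r - 1" 1] by simp
    thus "\<exists>r. r dvd 1 \<and> 1 - r dvd (1::'t)" using r(1) by blast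
  qed (use basic in auto)
qed

fun fm :: "'t mat \<Rightarrow> 'a \<times> 'a \<times> 'a \<times> 'a" where "fm (a, b, c, d) = (f a, f b, f c, f d)"

lemma fm_SL: "fm m \<in> carrier (SL2 R) \<longleftrightarrow> m \<in> SL"
  by (cases m) (simp add: SL2_def SL_def f_rules)

lemma fm_mm: "fm (mm m k) = fm m \<otimes>\<^bsub>SL2 R\<^esub> fm k"
  by (cases m; cases k) (simp add: SL2_def f_add f_mult)

lemma fm_one: "fm (xm 0) = \<one>\<^bsub>SL2 R\<^esub>" by (simp add: SL2_def xm_def f_one f_zero)

lemma fm_inj: "fm m = fm k \<longleftrightarrow> m = k" by (cases m; cases k) simp

lemma fm_surj: "x \<in> carrier (SL2 R) \<Longrightarrow> \<exists>m\<in>SL. x = fm m"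
proof -
  assume x: "x \<in> carrier (SL2 R)"
  obtain a b c d where abcd: "x = (a, b, c, d)" by (cases x)
  hence "a \<in> carrier R" "b \<in> carrier R" "c \<in> carrier R" "d \<in> carrier R" using x by (auto simp: SL2_def)
  then obtain a' b' c' d' where "x = fm (a', b', c', d')" using f_surj unfolding abcd by (metis fm.simps)
  thus ?thesis using x fm_SL by blast
qed

end

lemma bad_ring_transfer:
  assumes "bad (A :: ('a, 'r) ring_scheme)"
  shows "\<exists>f. ring_transfer (bad_ring :: ('a, 'r) ring_scheme) (f :: ('a, 'r) rng \<Rightarrow> 'a)"
proof -
  let ?R = "bad_ring :: ('a, 'r) ring_scheme" and ?S = "bad_ring' TYPE('r) :: ('a + int) ring"
  interpret cring ?R by (rule cring_bad_ring)
  have S: "?S = image_ring Inl ?R" using assms by (auto simp: bad_ring'_def)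
  have iso: "Inl \<in> ring_iso ?R ?S" unfolding S by (rule inj_imp_image_ring_iso[OF inj_Inl])
  define f where "f x = projl (Rep_rng x)" for x :: "('a, 'r) rng"
  have f: "Rep_rng x = Inl (f x)" "f x \<in> carrier ?R" for x
    using Rep_rng[of x] unfolding S image_ring_carrier f_def by auto
  have "ring_transfer ?R f"
  proof unfold_locales
    fix x y
    note h = ring_iso_memE[OF iso]
    have "Inl (f (x + y)) = (Inl (f x \<oplus>\<^bsub>?R\<^esub> f y) :: 'a + int)" "Inl (f (x * y)) = (Inl (f x \<otimes>\<^bsub>?R\<^esub> f y) :: 'a + int)"
      "Inl (f 1) = (Inl \<one>\<^bsub>?R\<^esub> :: 'a + int)"
      using f(2) h by (simp_all add: f(1)[symmetric] Rep_rng_ops)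
    thus "f (x + y) = f x \<oplus>\<^bsub>?R\<^esub> f y" "f (x * y) = f x \<otimes>\<^bsub>?R\<^esub> f y" "f 1 = \<one>\<^bsub>?R\<^esub>" by simp_all
  next
    show "bij_betw f UNIV (carrier ?R)"
    proof (rule bij_betwI')
      fix x y show "(f x = f y) = (x = y)" using f(1) by (metis Rep_rng_inject)
    next
      fix a assume "a \<in> carrier ?R"
      hence "Inl a \<in> carrier ?S" unfolding S image_ring_carrier by blast
      hence "Rep_rng (Abs_rng (Inl a) :: ('a, 'r) rng) = Inl a" by (rule Abs_rng_inverse)
      thus "\<exists>x\<in>UNIV. a = f x" by (metis f(1) Inl_inject UNIV_I)
    qed (use f in auto)
  qed
  thus ?thesis by blast
qed

theorem good_param_trivial_homology:
  fixes A :: "('a, 'r) ring_scheme"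
  assumes "cring A" "\<one>\<^bsub>A\<^esub> \<noteq> \<zero>\<^bsub>A\<^esub>" "good_param A p n t g r"
  shows "trivial_group (group_homology 2 (SL2 A))"
proof (rule ccontr)
  assume "\<not> ?thesis"
  hence bA: "bad A" using assms unfolding bad_def by blast
  let ?R = "bad_ring :: ('a, 'r) ring_scheme"
  have b: "bad ?R" using bad_ring[OF bA] .
  obtain f where "ring_transfer ?R (f :: ('a, 'r) rng \<Rightarrow> 'a)" using bad_ring_transfer[OF bA] by blast
  then interpret ring_transfer ?R f .
  interpret G: group "SL2 ?R" by (rule SL2_group)
  \<comment> \<open>The ring selected by choice need not be A, so it brings its own
    parameters.\<close>
  obtain p n t' g' r' where gp: "good_param ?R p n t' g' r'" using b unfolding bad_def by blast
  have "t' \<in> carrier ?R" "g' \<in> carrier ?R" "r' \<in> carrier ?R" using gp by (auto simp: good_param_def)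
  then obtain t g r where tgr: "t' = f t" "g' = f g" "r' = f r" using f_surj by metis
  note tp = transfer_param[OF gp[unfolded tgr]]
  define lift :: "('a, 'r) sl2_ext \<Rightarrow> ('a, 'r) rng mat \<Rightarrow> bool" where
    "lift e m \<longleftrightarrow> m \<in> SL \<and> (\<exists>c. Rep_sl2_ext e = ext (SL2 ?R) c (fm m))" for e m
  interpret C: cyclic_chain_ring "range ((*) t)" p n t g by (rule tp(1))
  have Rep_ex: "\<exists>c m. Rep_sl2_ext e = ext (SL2 ?R) c (fm m) \<and> m \<in> SL" for e :: "('a, 'r) sl2_ext"
    using Rep_sl2_ext[of e] fm_surj unfolding ext_carrier_def by blast
  interpret L: lift_system "range ((*) t)" p n t g lift r
  proof unfold_locales
    fix e f :: "('a, 'r) sl2_ext" and m k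
    show "\<exists>e. lift e m" if "m \<in> SL"
    proof -
      have "ext (SL2 ?R) 0 (fm m) \<in> ext_carrier (SL2 ?R)" using that fm_SL unfolding ext_carrier_def by blast
      hence "Rep_sl2_ext (Abs_sl2_ext (ext (SL2 ?R) 0 (fm m)) :: ('a, 'r) sl2_ext) = ext (SL2 ?R) 0 (fm m)"
        by (rule Abs_sl2_ext_inverse)
      thus ?thesis using that unfolding lift_def by blast
    qed
    show plus: "lift (e + f) (mm m k)" if "lift e m" "lift f k"
      using that unfolding lift_def by (auto simp: Rep_sl2_ext_ops ext_mult fm_mm SL_mm)
    show "m \<in> SL" if "lift e m" using that by (simp add: lift_def)
    \<comment> \<open>Inverses in the extension are chosen abstractly; the matrix below -e is
      recovered from -e + e = 0.\<close>
    show "lift (- e) (minv m)" if l: "lift e m"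
    proof -
      obtain c k where k: "Rep_sl2_ext (- e) = ext (SL2 ?R) c (fm k)" "k \<in> SL" using Rep_ex by blast
      obtain d where d: "Rep_sl2_ext e = ext (SL2 ?R) d (fm m)" "m \<in> SL" using l unfolding lift_def by blast
      have "Rep_sl2_ext (- e + e) = ext_one (SL2 ?R)" by (simp add: Rep_sl2_ext_ops)
      hence "fm k \<otimes>\<^bsub>SL2 ?R\<^esub> fm m = \<one>\<^bsub>SL2 ?R\<^esub>"
        unfolding Rep_sl2_ext_ops(1) k d ext_mult ext_one_def ext_eq_iff by blast
      hence "mm k m = xm 0" unfolding fm_mm[symmetric] fm_one[symmetric] fm_inj .
      hence "mm (mm k m) (minv m) = minv m" by simp
      hence "k = minv m" using d(2) by (simp add: mm_assoc minv)
      thus ?thesis using k unfolding lift_def by blast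
    qed
    show "e + f = f + e" if l0: "lift e (xm 0)"
    proof -
      obtain c where c: "Rep_sl2_ext e = ext (SL2 ?R) c \<one>\<^bsub>SL2 ?R\<^esub>" using l0 fm_one unfolding lift_def by auto
      obtain d k where d: "Rep_sl2_ext f = ext (SL2 ?R) d (fm k)" "k \<in> SL" using Rep_ex by blast
      show ?thesis using G.ext_central[of "fm k" c d] fm_SL d(2)
        by (simp add: Rep_sl2_ext_inject[symmetric] Rep_sl2_ext_ops c d(1))
    qed
  qed (use tp in auto)
  obtain S where S: "\<forall>m\<in>SL. lift (S m) m" "\<forall>m\<in>SL. \<forall>k\<in>SL. S (mm m k) = S m + S k"
    using L.lift_section by blast
  have "\<forall>m\<in>SL. \<exists>c. Rep_sl2_ext (S m) = ext (SL2 ?R) c (fm m)" using S(1) unfolding lift_def by blast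
  then obtain s where s: "\<And>m. m \<in> SL \<Longrightarrow> Rep_sl2_ext (S m) = ext (SL2 ?R) (s m) (fm m)" by metis
  define u where "u x = s (SOME m. m \<in> SL \<and> fm m = x)" for x
  have u: "u (fm m) = s m" if "m \<in> SL" for m
  proof -
    have "(SOME k. k \<in> SL \<and> fm k = fm m) = m" using that by (intro some_equality) (auto simp: fm_inj)
    thus ?thesis by (simp add: u_def)
  qed
  have "trivial_group (group_homology 2 (SL2 ?R))"
  proof (rule trivial_homology_if_split[OF G.is_group])
    fix x y assume "x \<in> carrier (SL2 ?R)" "y \<in> carrier (SL2 ?R)"
    then obtain m k where mk: "x = fm m" "m \<in> SL" "y = fm k" "k \<in> SL" using fm_surj by metis
    have "Rep_sl2_ext (S m + S k) = Rep_sl2_ext (S (mm m k))" using S(2) mk by simp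
    hence "s m + s k + frag_of [x, y] - s (mm m k) \<in> bar_boundaries (SL2 ?R) 2"
      unfolding Rep_sl2_ext_ops(1) s[OF mk(2)] s[OF mk(4)] s[OF SL_mm[OF mk(2,4)]] ext_mult ext_eq_iff mk by blast
    thus "frag_of [x, y] + u x + u y - u (x \<otimes>\<^bsub>SL2 ?R\<^esub> y) \<in> bar_boundaries (SL2 ?R) 2"
      using mk by (simp add: u SL_mm fm_mm[symmetric] algebra_simps)
  qed
  thus False using b unfolding bad_def by blast
qed

section \<open>Residue fields\<close>

context field begin

lemma card_quadratic_roots:
  assumes b: "b \<in> carrier R" and c: "c \<in> carrier R"
  shows "finite {x \<in> carrier R. x \<otimes> x \<oplus> b \<otimes> x \<oplus> c = \<zero>}"
    "card {x \<in> carrier R. x \<otimes> x \<oplus> b \<otimes> x \<oplus> c = \<zero>} \<le> 2"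
proof -
  let ?S = "{x \<in> carrier R. x \<otimes> x \<oplus> b \<otimes> x \<oplus> c = \<zero>}"
  have "finite ?S \<and> card ?S \<le> 2"
  proof (cases "?S = {}")
    case True
    thus ?thesis by (metis card.empty finite.emptyI zero_le)
  next
    case False
    then obtain r where r: "r \<in> carrier R" "r \<otimes> r \<oplus> b \<otimes> r \<oplus> c = \<zero>" by blast
    have "?S \<subseteq> {r, \<ominus> b \<ominus> r}"
    proof
      fix x assume "x \<in> ?S"
      hence x: "x \<in> carrier R" "x \<otimes> x \<oplus> b \<otimes> x \<oplus> c = \<zero>" by auto
      have "(x \<ominus> r) \<otimes> (x \<oplus> r \<oplus> b) = (x \<otimes> x \<oplus> b \<otimes> x \<oplus> c) \<ominus> (r \<otimes> r \<oplus> b \<otimes> r \<oplus> c)"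
        using x(1) r(1) b c by algebra
      also have "\<dots> = \<zero>" unfolding x(2) r(2) by algebra
      finally have "x \<ominus> r = \<zero> \<or> x \<oplus> r \<oplus> b = \<zero>" using x(1) r(1) b by (simp add: integral_iff)
      moreover have "x = (x \<ominus> r) \<oplus> r" "x = (x \<oplus> r \<oplus> b) \<oplus> (\<ominus> b \<ominus> r)" using x(1) r(1) b by algebra+
      ultimately show "x \<in> {r, \<ominus> b \<ominus> r}" using r(1) b by auto
    qed
    moreover have "card {r, \<ominus> b \<ominus> r} \<le> 2" by (simp add: card_insert_if)
    ultimately show ?thesis using card_mono[of "{r, \<ominus> b \<ominus> r}" ?S] finite_subset[of ?S "{r, \<ominus> b \<ominus> r}"]
      by (metis (no_types, lifting) finite.emptyI finite.insertI le_trans)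
  qed
  thus "finite ?S" "card ?S \<le> 2" by auto
qed

text \<open>Three single values and three quadratics exclude at most 3 + 2 + 2 + 2 = 9
  elements.\<close>

lemma generic_element:
  assumes fin: "finite (carrier R)" and big: "card (carrier R) > 9"
  shows "\<exists>x\<in>carrier R. x \<noteq> \<zero> \<and> x \<oplus> \<one> \<noteq> \<zero> \<and> x \<ominus> \<one> \<noteq> \<zero> \<and> x \<otimes> x \<oplus> \<one> \<noteq> \<zero> \<and>
    x \<otimes> x \<ominus> x \<ominus> \<one> \<noteq> \<zero> \<and> x \<otimes> x \<oplus> x \<ominus> \<one> \<noteq> \<zero>"
proof -
  let ?Q = "\<lambda>b c. {x \<in> carrier R. x \<otimes> x \<oplus> b \<otimes> x \<oplus> c = \<zero>}"
  let ?B = "{\<zero>, \<ominus> \<one>, \<one>} \<union> (?Q \<zero> \<one> \<union> (?Q (\<ominus> \<one>) (\<ominus> \<one>) \<union> ?Q \<one> (\<ominus> \<one>)))"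
  have "card {\<zero>, \<ominus> \<one>, \<one>} \<le> 3" by (simp add: card_insert_if)
  moreover have "card ?B \<le> card {\<zero>, \<ominus> \<one>, \<one>} + (card (?Q \<zero> \<one>) + (card (?Q (\<ominus> \<one>) (\<ominus> \<one>)) + card (?Q \<one> (\<ominus> \<one>))))"
    by (intro order_trans[OF card_Un_le] add_mono order_refl)
  ultimately have "card ?B \<le> 9"
    using card_quadratic_roots(2)[of \<zero> \<one>] card_quadratic_roots(2)[of "\<ominus> \<one>" "\<ominus> \<one>"] card_quadratic_roots(2)[of \<one> "\<ominus> \<one>"]
    by simp
  moreover have "finite ?B" using card_quadratic_roots(1) by simp
  ultimately have "\<not> carrier R \<subseteq> ?B" using big card_mono[of ?B "carrier R"] by linarith
  then obtain x where x: "x \<in> carrier R" "x \<notin> ?B" by blast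
  have e: "\<zero> \<otimes> x = \<zero>" "x \<oplus> \<one> = x \<ominus> (\<ominus> \<one>)" "x \<otimes> x \<ominus> x \<ominus> \<one> = x \<otimes> x \<oplus> \<ominus> \<one> \<otimes> x \<oplus> \<ominus> \<one>"
    "x \<otimes> x \<oplus> x \<ominus> \<one> = x \<otimes> x \<oplus> \<one> \<otimes> x \<oplus> \<ominus> \<one>" "x \<otimes> x \<oplus> \<one> = x \<otimes> x \<oplus> \<zero> \<otimes> x \<oplus> \<one>" using x(1) by algebra+
  have 1: "x \<ominus> \<one> \<noteq> \<zero>" and "x \<ominus> (\<ominus> \<one>) \<noteq> \<zero>" using x by (auto simp: r_right_minus_eq)
  hence 2: "x \<oplus> \<one> \<noteq> \<zero>" unfolding e(2) by blast
  have 3: "x \<otimes> x \<ominus> x \<ominus> \<one> \<noteq> \<zero>" unfolding e(3) using x by blast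
  have 4: "x \<otimes> x \<oplus> x \<ominus> \<one> \<noteq> \<zero>" unfolding e(4) using x by blast
  have 5: "x \<otimes> x \<oplus> \<one> \<noteq> \<zero>" unfolding e(5) using x by blast
  have 6: "x \<noteq> \<zero>" using x by blast
  show ?thesis by (intro bexI[of _ x] conjI) (fact x(1) 1 2 3 4 5 6)+
qed

text \<open>With q elements in the field and p k = 1 modulo q - 1 by Bezout, a^k is a p-th root of a
  nonzero a.\<close>

lemma exists_pth_root:
  assumes fin: "finite (carrier R)" and p: "coprime p (card (carrier R) - 1)" "p > 0" and a: "a \<in> carrier R"
  shows "\<exists>b\<in>carrier R. b [^] p = a"
proof (cases "a = \<zero>")
  case True
  have "\<zero> [^] p = \<zero>" using p(2) by (cases p) auto
  thus ?thesis using True by blast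
next
  case False
  let ?q = "card (carrier R) - 1"
  have am: "a \<in> carrier (Multiplicative_Group.mult_of R)" using a False by simp
  have "Coset.order (Multiplicative_Group.mult_of R) = ?q" by (simp add: Coset.order_def card_Diff_subset fin)
  hence aq: "a [^] ?q = \<one>" using group.pow_order_eq_1[OF field_mult_group am] by (simp add: Multiplicative_Group.nat_pow_mult_of)
  obtain k j where kj: "p * k = ?q * j + 1" using bezout_nat[of p ?q] p by auto
  have "(a [^] k) [^] p = a [^] (?q * j + 1)" using a by (simp add: nat_pow_pow mult.commute[of k] kj)
  also have "\<dots> = (a [^] ?q) [^] j \<otimes> a" using a by (simp add: nat_pow_pow)
  also have "\<dots> = a" unfolding aq using a by simp
  finally show ?thesis using a by blast
qed

text \<open>The order q is odd, since (-1)^(q-1) = 1 would otherwise make 2 = 0. So q exceeds 9 or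
  equals 7; in the latter case x = 2 works, the six expressions being 2, 3, 1, 5, 1 and 5.\<close>

lemma residue_generic_element:
  assumes fin: "finite (carrier R)" and odd: "odd (ring_char R)"
    and card: "card (carrier R) \<notin> {3, 5, 9}" and p: "Factorial_Ring.prime p" "add_pow R p \<one> = \<zero>"
  shows "odd p" "p dvd card (carrier R)"
   "\<exists>x\<in>carrier R. x \<noteq> \<zero> \<and> x \<oplus> \<one> \<noteq> \<zero> \<and> x \<ominus> \<one> \<noteq> \<zero> \<and> x \<otimes> x \<oplus> \<one> \<noteq> \<zero> \<and>
    x \<otimes> x \<ominus> x \<ominus> \<one> \<noteq> \<zero> \<and> x \<otimes> x \<oplus> x \<ominus> \<one> \<noteq> \<zero>"
proof -
  let ?q = "card (carrier R)"
  have dvd: "ring_char R dvd k \<longleftrightarrow> add_pow R k \<one> = \<zero>" for k :: nat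
    unfolding ring_char_def using add.pow_eq_id[of \<one> k] by (simp add: add_pow_def)
  have "ring_char R \<noteq> 1" using dvd[of 1] by auto
  hence char: "ring_char R = p" using dvd[of p] p by (metis prime_nat_iff)
  show "odd p" using odd char by simp
  have q: "Coset.order (add_monoid R) = ?q" by (simp add: Coset.order_def)
  have "add_pow R ?q \<one> = \<zero>" using add.pow_order_eq_1[of \<one>] unfolding q by (simp add: add_pow_def)
  thus pq: "p dvd ?q" using dvd char by blast
  have oq: "odd ?q"
  proof
    assume ev: "even ?q"
    have "?q > 0" using fin card_gt_0_iff by blast
    hence "odd (?q - 1)" using ev by simp
    then obtain k where k: "?q - 1 = 2 * k + 1" by (elim oddE)
    have m: "\<ominus> \<one> \<in> carrier (Multiplicative_Group.mult_of R)" by simp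
    have "Coset.order (Multiplicative_Group.mult_of R) = 2 * k + 1"
      unfolding k[symmetric] by (simp add: Coset.order_def card_Diff_subset fin)
    hence "(\<ominus> \<one>) [^] (2 * k + 1) = \<one>"
      using group.pow_order_eq_1[OF field_mult_group m] by (simp only: Multiplicative_Group.nat_pow_mult_of Multiplicative_Group.one_mult_of)
    moreover have "(\<ominus> \<one>) [^] (2 * k + 1) = ((\<ominus> \<one>) [^] (2::nat)) [^] k \<otimes> (\<ominus> \<one>)"
      by (simp add: nat_pow_pow)
    moreover have "(\<ominus> \<one>) [^] (2::nat) = \<one>" by (simp add: numeral_2_eq_2 l_minus r_minus)
    ultimately have "\<ominus> \<one> = \<one>" by simp
    hence "\<one> \<oplus> \<one> = \<zero>" by (metis one_closed r_neg)
    hence "add_pow R (2::nat) \<one> = \<zero>" by (simp add: numeral_2_eq_2)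
    hence "p dvd 2" using dvd char by blast
    hence "p = 2" using dvd_imp_le[of p 2] prime_ge_2_nat[OF p(1)] by simp
    thus False using \<open>odd p\<close> by simp
  qed
  show "\<exists>x\<in>carrier R. x \<noteq> \<zero> \<and> x \<oplus> \<one> \<noteq> \<zero> \<and> x \<ominus> \<one> \<noteq> \<zero> \<and> x \<otimes> x \<oplus> \<one> \<noteq> \<zero> \<and>
    x \<otimes> x \<ominus> x \<ominus> \<one> \<noteq> \<zero> \<and> x \<otimes> x \<oplus> x \<ominus> \<one> \<noteq> \<zero>"
  proof (cases "?q > 9")
    case True
    thus ?thesis using generic_element fin by blast
  next
    case False
    have "?q \<noteq> 1" using pq p(1) by (metis not_prime_unit)
    moreover have "?q \<noteq> 3" "?q \<noteq> 5" "?q \<noteq> 9" using card by auto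
    ultimately have q7: "?q = 7" using False oq by presburger
    have "p = 7"
    proof -
      have "Factorial_Ring.prime (7::nat)" by simp
      thus ?thesis using pq p(1) unfolding q7 by (intro primes_dvd_imp_eq)
    qed
    hence nz: "add_pow R k \<one> \<noteq> \<zero>" if "\<not> 7 dvd k" for k :: nat using dvd char that by simp
    let ?x = "\<one> \<oplus> \<one>"
    have n: "add_pow R (2::nat) \<one> = ?x" "add_pow R (3::nat) \<one> = ?x \<oplus> \<one>"
      "add_pow R (5::nat) \<one> = \<one> \<oplus> \<one> \<oplus> \<one> \<oplus> \<one> \<oplus> \<one>" by (simp_all add: numeral_eq_Suc)
    have 1: "?x \<noteq> \<zero>" "?x \<oplus> \<one> \<noteq> \<zero>" "\<one> \<oplus> \<one> \<oplus> \<one> \<oplus> \<one> \<oplus> \<one> \<noteq> \<zero>"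
      using nz[of 2] nz[of 3] nz[of 5] unfolding n by auto
    have m: "a \<oplus> b \<ominus> b = a" if "a \<in> carrier R" "b \<in> carrier R" for a b using that by algebra
    have xx: "?x \<otimes> ?x = \<one> \<oplus> \<one> \<oplus> \<one> \<oplus> \<one>" by (simp add: l_distr r_distr a_assoc)
    have 5: "?x \<otimes> ?x \<oplus> \<one> = \<one> \<oplus> \<one> \<oplus> \<one> \<oplus> \<one> \<oplus> \<one>" unfolding xx ..
    have "?x \<otimes> ?x \<oplus> ?x \<ominus> \<one> = (\<one> \<oplus> \<one> \<oplus> \<one> \<oplus> \<one> \<oplus> \<one>) \<oplus> \<one> \<ominus> \<one>" unfolding xx by (simp add: a_assoc)
    hence 7: "?x \<otimes> ?x \<oplus> ?x \<ominus> \<one> = \<one> \<oplus> \<one> \<oplus> \<one> \<oplus> \<one> \<oplus> \<one>" by (simp only: m add.m_closed one_closed)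
    have 6: "?x \<ominus> \<one> = \<one>" by (rule m) simp_all
    have "?x \<otimes> ?x = ?x \<oplus> ?x" unfolding xx by (simp add: a_assoc)
    hence "?x \<otimes> ?x \<ominus> ?x = ?x" using m[of ?x ?x] by simp
    hence 8: "?x \<otimes> ?x \<ominus> ?x \<ominus> \<one> = \<one>" using 6 by simp
    have "?x \<in> carrier R" by simp
    thus ?thesis using 1 one_not_zero by (intro bexI[of _ ?x] conjI) (simp_all only: 5 6 7 8 not_False_eq_True)
  qed
qed

end

text \<open>The product (1 + x)(1 - x) = 1 - x^2 is a unit by induction, because x^2 has about half
  the nilpotency exponent; a factor of a unit is a unit.\<close>

lemma (in cring) unit_add_nilpotent:
  assumes "x \<in> carrier R" "x [^] (n::nat) = \<zero>"
  shows "\<one> \<oplus> x \<in> Units R"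
  using assms
proof (induction n arbitrary: x rule: less_induct)
  case (less n)
  show ?case
  proof (cases "n \<le> 1")
    case True
    hence "x = \<zero>"
    proof (cases "n = 0")
      case True
      hence "\<one> = \<zero>" using less.prems by simp
      thus ?thesis using less.prems(1) one_zeroD by blast
    next
      case False
      hence "n = 1" using True by simp
      thus ?thesis using less.prems by simp
    qed
    thus ?thesis by simp
  next
    case False
    define k where "k = (n + 1) div 2"
    have k: "k < n" "2 * k \<ge> n" using False by (auto simp: k_def)
    have c: "x \<otimes> x \<in> carrier R" using less.prems by simp
    have "x [^] (2 * k) = x [^] n \<otimes> x [^] (2 * k - n)" using less.prems(1) k by (simp add: nat_pow_mult)
    hence "(x \<otimes> x) [^] k = \<zero>" using less.prems by (simp add: nat_pow_distrib nat_pow_mult mult_2)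
    moreover have "(\<ominus> y) [^] k = \<zero>" if "y \<in> carrier R" "y [^] k = \<zero>" for y
    proof -
      have "(\<ominus> y) [^] k = (\<ominus> \<one>) [^] k \<otimes> y [^] k"
        using that(1) by (subst nat_pow_distrib[symmetric]) (simp_all add: l_minus)
      thus ?thesis using that by simp
    qed
    ultimately have "(\<ominus> (x \<otimes> x)) [^] k = \<zero>" using c by blast
    hence "\<one> \<oplus> \<ominus> (x \<otimes> x) \<in> Units R" using less.IH[OF k(1)] c by simp
    moreover have "\<one> \<oplus> \<ominus> (x \<otimes> x) = (\<one> \<oplus> x) \<otimes> (\<one> \<ominus> x)" using less.prems(1) by algebra
    ultimately show ?thesis using less.prems(1) by (metis Units_assoc a_closed minus_closed one_closed prod_unit_l prod_unit_r unit_factor)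
  qed
qed

section \<open>Galois and quasi-Galois rings as chain rings\<close>

text \<open>What the two kinds of rings have in common, in a form invariant under isomorphism. The
  finite set B of representatives modulo t expresses finiteness of the residue ring.\<close>

definition finite_chain_ring :: "('a, 'r) ring_scheme \<Rightarrow> nat \<Rightarrow> bool" where
  "finite_chain_ring A p \<longleftrightarrow> Factorial_Ring.prime p \<and> (\<exists>t\<in>carrier A. (\<exists>n::nat. t [^]\<^bsub>A\<^esub> n = \<zero>\<^bsub>A\<^esub>) \<and>
     (\<forall>a\<in>carrier A. a \<in> Units A \<or> (\<exists>b\<in>carrier A. a = t \<otimes>\<^bsub>A\<^esub> b)) \<and>
     (add_pow A p \<one>\<^bsub>A\<^esub> = \<zero>\<^bsub>A\<^esub> \<or> add_pow A p \<one>\<^bsub>A\<^esub> = t) \<and>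
     (\<exists>B. finite B \<and> B \<subseteq> carrier A \<and> (\<forall>a\<in>carrier A. \<exists>b\<in>B. \<exists>c\<in>carrier A. a = b \<oplus>\<^bsub>A\<^esub> t \<otimes>\<^bsub>A\<^esub> c)))"

lemma (in domain) nat_pow_eq_zero: "x \<in> carrier R \<Longrightarrow> x [^] (n::nat) = \<zero> \<Longrightarrow> x = \<zero>"
  by (induction n) (auto simp: integral_iff)

text \<open>The nilpotent t dies in the field A/M and elements outside t A are units, so M = t A.
  All parameters are lifted from the finite field A/M: r from a generic element, g from a generator
  of its units, and p-th powers from its perfectness.\<close>

lemma finite_chain_ring_good_param:
  fixes A :: "('a, 'r) ring_scheme" (structure)
  assumes A: "cring A" and M: "maximalideal M A" and ch: "finite_chain_ring A p"
    and odd: "odd (ring_char (A Quot M))" and card: "card (carrier (A Quot M)) \<notin> {3, 5, 9}"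
  shows "\<exists>n t g r. good_param A p n t g r"
proof -
  interpret cring A by fact
  interpret M: maximalideal M A by fact
  let ?K = "A Quot M"
  interpret K: field ?K by (rule M.quotient_is_field[OF A])
  obtain t n B where t: "t \<in> carrier A" "t [^] (n::nat) = \<zero>"
    and loc: "\<And>a. a \<in> carrier A \<Longrightarrow> a \<in> Units A \<or> (\<exists>b\<in>carrier A. a = t \<otimes> b)"
    and char: "add_pow A p \<one> = \<zero> \<or> add_pow A p \<one> = t"
    and B: "finite B" "B \<subseteq> carrier A" "\<And>a. a \<in> carrier A \<Longrightarrow> \<exists>b\<in>B. \<exists>c\<in>carrier A. a = b \<oplus> t \<otimes> c"
    and p: "Factorial_Ring.prime p"
    using ch unfolding finite_chain_ring_def by blast
  define \<phi> where "\<phi> a = M +> a" for a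
  have hom: "\<phi> \<in> ring_hom A ?K" unfolding \<phi>_def by (rule M.rcos_ring_hom)
  interpret \<phi>: ring_hom_cring A ?K \<phi>
    by (intro ring_hom_cring.intro ring_hom_cring_axioms.intro A K.is_cring hom)
  have zero: "\<phi> a = \<zero>\<^bsub>?K\<^esub> \<longleftrightarrow> a \<in> M" if "a \<in> carrier A" for a
  proof -
    have "\<zero>\<^bsub>?K\<^esub> = M" by (simp add: FactRing_def)
    thus ?thesis using M.a_rcos_const[of a] M.rcos_const_imp_mem[OF that] unfolding \<phi>_def by metis
  qed
  have unit: "a \<in> Units A" if a: "a \<in> carrier A" and na: "a \<notin> M" for a
  proof (rule ccontr)
    assume "a \<notin> Units A"
    then obtain b where b: "b \<in> carrier A" "a = t \<otimes> b" using loc a by blast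
    have "\<phi> t [^]\<^bsub>?K\<^esub> n = \<zero>\<^bsub>?K\<^esub>" using \<phi>.hom_pow[OF t(1), of n] t(2) by simp
    hence "\<phi> t = \<zero>\<^bsub>?K\<^esub>" using t(1) K.nat_pow_eq_zero by blast
    hence "t \<in> M" using zero t by blast
    hence "a \<in> M" using b M.I_r_closed by simp
    thus False using na by simp
  qed
  have tM: "t \<in> M"
  proof (rule ccontr)
    assume "t \<notin> M"
    hence "\<phi> t \<noteq> \<zero>\<^bsub>?K\<^esub>" using zero t by simp
    moreover have "\<phi> t [^]\<^bsub>?K\<^esub> n = \<zero>\<^bsub>?K\<^esub>" using \<phi>.hom_pow[OF t(1), of n] t(2) by simp
    ultimately show False using t(1) K.nat_pow_eq_zero by blast
  qed
  have nonunit: "a \<notin> Units A" if "a \<in> M" for a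
  proof
    assume "a \<in> Units A"
    hence "\<one> \<in> M" using M.I_r_closed[OF that, of "inv a"] by simp
    thus False using M.one_imp_carrier M.I_notcarr by simp
  qed
  have memM: "a \<in> M \<longleftrightarrow> (\<exists>b\<in>carrier A. a = t \<otimes> b)" for a
  proof
    assume "a \<in> M"
    thus "\<exists>b\<in>carrier A. a = t \<otimes> b" using nonunit loc M.Icarr by blast
  next
    assume "\<exists>b\<in>carrier A. a = t \<otimes> b"
    thus "a \<in> M" using tM M.I_r_closed by blast
  qed
  have units: "a \<in> Units A \<longleftrightarrow> \<phi> a \<noteq> \<zero>\<^bsub>?K\<^esub>" if "a \<in> carrier A" for a
    using that unit nonunit zero by blast
  have surj: "\<exists>a\<in>carrier A. k = \<phi> a" if "k \<in> carrier ?K" for k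
    using that unfolding FactRing_def A_RCOSETS_def' \<phi>_def by auto
  have eqM: "\<exists>c\<in>carrier A. a = b \<oplus> t \<otimes> c" if ab: "a \<in> carrier A" "b \<in> carrier A" "\<phi> a = \<phi> b" for a b
  proof -
    have "\<phi> (a \<ominus> b) = \<zero>\<^bsub>?K\<^esub>" using ab by (simp add: a_minus_def K.r_neg)
    then obtain c where c: "c \<in> carrier A" "a \<ominus> b = t \<otimes> c" using zero memM ab by blast
    have "a = b \<oplus> (a \<ominus> b)" using ab by algebra
    thus ?thesis using c by auto
  qed
  have "carrier ?K \<subseteq> \<phi> ` B"
  proof
    fix k assume "k \<in> carrier ?K"
    then obtain a where a: "a \<in> carrier A" "k = \<phi> a" using surj by blast
    then obtain b c where bc: "b \<in> B" "c \<in> carrier A" "a = b \<oplus> t \<otimes> c" using B by blast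
    have "t \<otimes> c \<in> M" using tM bc M.I_r_closed by blast
    hence tc: "\<phi> (t \<otimes> c) = \<zero>\<^bsub>?K\<^esub>" using zero[of "t \<otimes> c"] t bc by blast
    have "b \<in> carrier A" "t \<otimes> c \<in> carrier A" using bc B(2) t by auto
    hence "\<phi> a = \<phi> b" unfolding bc(3) \<phi>.hom_add[OF \<open>b \<in> carrier A\<close> \<open>t \<otimes> c \<in> carrier A\<close>] tc by simp
    thus "k \<in> \<phi> ` B" using a bc by blast
  qed
  hence fin: "finite (carrier ?K)" using B(1) finite_surj by blast
  have nat: "\<phi> (add_pow A (k::nat) \<one>) = add_pow ?K k \<one>\<^bsub>?K\<^esub>" for k
    by (induction k) simp_all
  have "\<phi> (add_pow A p \<one>) = \<zero>\<^bsub>?K\<^esub>" using char tM zero t by auto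
  hence pK: "add_pow ?K p \<one>\<^bsub>?K\<^esub> = \<zero>\<^bsub>?K\<^esub>" using nat by simp
  note gen = K.residue_generic_element[OF fin odd card p pK]
  obtain x where x: "x \<in> carrier ?K" "x \<noteq> \<zero>\<^bsub>?K\<^esub>" "x \<oplus>\<^bsub>?K\<^esub> \<one>\<^bsub>?K\<^esub> \<noteq> \<zero>\<^bsub>?K\<^esub>" "x \<ominus>\<^bsub>?K\<^esub> \<one>\<^bsub>?K\<^esub> \<noteq> \<zero>\<^bsub>?K\<^esub>"
    "x \<otimes>\<^bsub>?K\<^esub> x \<oplus>\<^bsub>?K\<^esub> \<one>\<^bsub>?K\<^esub> \<noteq> \<zero>\<^bsub>?K\<^esub>" "x \<otimes>\<^bsub>?K\<^esub> x \<ominus>\<^bsub>?K\<^esub> x \<ominus>\<^bsub>?K\<^esub> \<one>\<^bsub>?K\<^esub> \<noteq> \<zero>\<^bsub>?K\<^esub>"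
    "x \<otimes>\<^bsub>?K\<^esub> x \<oplus>\<^bsub>?K\<^esub> x \<ominus>\<^bsub>?K\<^esub> \<one>\<^bsub>?K\<^esub> \<noteq> \<zero>\<^bsub>?K\<^esub>" using gen(3) by blast
  obtain r where r: "r \<in> carrier A" "x = \<phi> r" using surj x(1) by blast
  have minus: "\<phi> (a \<ominus> b) = \<phi> a \<ominus>\<^bsub>?K\<^esub> \<phi> b" if "a \<in> carrier A" "b \<in> carrier A" for a b
    using that by (simp add: a_minus_def)
  have runits: "r \<in> Units A" "r \<oplus> \<one> \<in> Units A" "r \<ominus> \<one> \<in> Units A" "r \<otimes> r \<oplus> \<one> \<in> Units A"
    "r \<otimes> r \<ominus> r \<ominus> \<one> \<in> Units A" "r \<otimes> r \<oplus> r \<ominus> \<one> \<in> Units A"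
    using r(1) x(2-) unfolding r(2) by (simp_all add: units minus)
  obtain \<gamma> where \<gamma>: "\<gamma> \<in> carrier ?K - {\<zero>\<^bsub>?K\<^esub>}" "carrier ?K - {\<zero>\<^bsub>?K\<^esub>} = {\<gamma> [^]\<^bsub>?K\<^esub> i |i::nat. i \<in> UNIV}"
    using K.finite_field_mult_group_has_gen[OF fin] by auto
  obtain g where g: "g \<in> carrier A" "\<gamma> = \<phi> g" using surj \<gamma>(1) by blast
  have gU: "g \<in> Units A" using units g \<gamma>(1) by blast
  have ggen: "\<exists>i::nat. \<exists>c\<in>carrier A. u = g [^] i \<oplus> t \<otimes> c" if u: "u \<in> Units A" for u
  proof -
    have "u \<in> carrier A" using u by (rule Units_closed)
    hence "\<phi> u \<in> carrier ?K - {\<zero>\<^bsub>?K\<^esub>}" using units u by simp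
    then obtain i :: nat where "\<phi> u = \<gamma> [^]\<^bsub>?K\<^esub> i" using \<gamma>(2) by auto
    hence "\<phi> u = \<phi> (g [^] i)" using g by simp
    thus ?thesis using eqM[of u "g [^] i"] g(1) \<open>u \<in> carrier A\<close> by blast
  qed
  have p0: "p > 0" using p prime_gt_0_nat by blast
  \<comment> \<open>p divides the order of the residue field, hence not that order minus 1.\<close>
  have "coprime p (card (carrier ?K) - 1)"
  proof -
    have "card (carrier ?K) > 0" using fin card_gt_0_iff by blast
    hence 1: "card (carrier ?K) - (card (carrier ?K) - 1) = 1" by simp
    have "\<not> p dvd card (carrier ?K) - 1"
    proof
      assume "p dvd card (carrier ?K) - 1"
      hence "p dvd 1" using dvd_diff_nat[OF gen(2), of "card (carrier ?K) - 1"] unfolding 1 by simp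
      thus False using prime_ge_2_nat[OF p] by simp
    qed
    thus ?thesis using p prime_imp_coprime by blast
  qed
  note root = K.exists_pth_root[OF fin this p0]
  have perf: "\<exists>b\<in>carrier A. \<exists>c\<in>carrier A. a = b [^] p \<oplus> t \<otimes> c" if a: "a \<in> carrier A" for a
  proof -
    obtain k where k: "k \<in> carrier ?K" "k [^]\<^bsub>?K\<^esub> p = \<phi> a" using root[of "\<phi> a"] a by auto
    obtain b where b: "b \<in> carrier A" "k = \<phi> b" using surj k by blast
    have "\<phi> a = \<phi> (b [^] p)" using k b by simp
    thus ?thesis using eqM[of a "b [^] p"] a b by blast
  qed
  have "good_param A p n t g r" unfolding good_param_def
  proof (intro conjI ballI)
    show "a \<in> Units A \<longleftrightarrow> \<not> (\<exists>b\<in>carrier A. a = t \<otimes> b)" if "a \<in> carrier A" for a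
      using memM unit nonunit that by blast
    show "add_pow A p \<one> = \<zero> \<or> (\<exists>w\<in>Units A. add_pow A p \<one> = t \<otimes> w)"
      using char t by (auto intro: bexI[of _ \<one>])
  qed (use p gen(1) t gU ggen perf runits in auto)
  thus ?thesis by blast
qed

lemma finite_chain_ring_iso:
  assumes A: "cring A" and Q: "cring Q" and iso: "A \<simeq> Q" and ch: "finite_chain_ring Q p"
  shows "finite_chain_ring A p"
proof -
  interpret A: cring A by fact
  interpret Q: cring Q by fact
  have "Q \<simeq> A" using ring_iso_sym[OF A.ring_axioms iso] .
  then obtain h where h: "h \<in> ring_iso Q A" unfolding is_ring_iso_def by blast
  have hom: "h \<in> ring_hom Q A" and bij: "bij_betw h (carrier Q) (carrier A)" using h by (auto simp: ring_iso_def)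
  interpret h: ring_hom_cring Q A h by (intro ring_hom_cring.intro ring_hom_cring_axioms.intro A Q hom)
  have surj: "\<exists>b\<in>carrier Q. a = h b" if "a \<in> carrier A" for a using bij that by (auto simp: bij_betw_def)
  have nat: "h (add_pow Q (k::nat) \<one>\<^bsub>Q\<^esub>) = add_pow A k \<one>\<^bsub>A\<^esub>" for k by (induction k) simp_all
  have unit: "h u \<in> Units A" if "u \<in> Units Q" for u
  proof -
    have "h u \<otimes>\<^bsub>A\<^esub> h (inv\<^bsub>Q\<^esub> u) = \<one>\<^bsub>A\<^esub>" "h (inv\<^bsub>Q\<^esub> u) \<otimes>\<^bsub>A\<^esub> h u = \<one>\<^bsub>A\<^esub>"
      using h.hom_mult[OF Q.Units_closed[OF that] Q.Units_inv_closed[OF that]]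
        h.hom_mult[OF Q.Units_inv_closed[OF that] Q.Units_closed[OF that]] that by simp_all
    thus ?thesis using Q.Units_closed[OF that] that unfolding Units_def[of A] by (auto intro!: bexI[of _ "h (inv\<^bsub>Q\<^esub> u)"])
  qed
  obtain t n B where t: "t \<in> carrier Q" "t [^]\<^bsub>Q\<^esub> (n::nat) = \<zero>\<^bsub>Q\<^esub>"
    and loc: "\<And>a. a \<in> carrier Q \<Longrightarrow> a \<in> Units Q \<or> (\<exists>b\<in>carrier Q. a = t \<otimes>\<^bsub>Q\<^esub> b)"
    and char: "add_pow Q p \<one>\<^bsub>Q\<^esub> = \<zero>\<^bsub>Q\<^esub> \<or> add_pow Q p \<one>\<^bsub>Q\<^esub> = t"
    and B: "finite B" "B \<subseteq> carrier Q" "\<And>a. a \<in> carrier Q \<Longrightarrow> \<exists>b\<in>B. \<exists>c\<in>carrier Q. a = b \<oplus>\<^bsub>Q\<^esub> t \<otimes>\<^bsub>Q\<^esub> c"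
    and p: "Factorial_Ring.prime p"
    using ch unfolding finite_chain_ring_def by blast
  have 1: "h t [^]\<^bsub>A\<^esub> n = \<zero>\<^bsub>A\<^esub>" using h.hom_pow[OF t(1), of n] t(2) by simp
  have 2: "a \<in> Units A \<or> (\<exists>b\<in>carrier A. a = h t \<otimes>\<^bsub>A\<^esub> b)" if a: "a \<in> carrier A" for a
    proof -
      obtain b where b: "b \<in> carrier Q" "a = h b" using surj a by blast
      show ?thesis using loc[OF b(1)]
      proof
        assume "b \<in> Units Q" thus ?thesis using unit b by blast
      next
        assume "\<exists>c\<in>carrier Q. b = t \<otimes>\<^bsub>Q\<^esub> c"
        then obtain c where "c \<in> carrier Q" "b = t \<otimes>\<^bsub>Q\<^esub> c" by blast
        hence "a = h t \<otimes>\<^bsub>A\<^esub> h c" "h c \<in> carrier A" using b t by auto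
        thus ?thesis by blast
      qed
    qed
  have 3: "add_pow A p \<one>\<^bsub>A\<^esub> = \<zero>\<^bsub>A\<^esub> \<or> add_pow A p \<one>\<^bsub>A\<^esub> = h t" using char nat[of p] by auto
  have 4: "\<exists>b\<in>h ` B. \<exists>c\<in>carrier A. a = b \<oplus>\<^bsub>A\<^esub> h t \<otimes>\<^bsub>A\<^esub> c" if a: "a \<in> carrier A" for a
    proof -
      obtain d where d: "d \<in> carrier Q" "a = h d" using surj a by blast
      obtain b c where bc: "b \<in> B" "c \<in> carrier Q" "d = b \<oplus>\<^bsub>Q\<^esub> t \<otimes>\<^bsub>Q\<^esub> c" using B(3)[OF d(1)] by blast
      have "a = h b \<oplus>\<^bsub>A\<^esub> h t \<otimes>\<^bsub>A\<^esub> h c" using d bc t B(2) by auto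
      thus ?thesis using bc by blast
    qed
  have "finite (h ` B)" "h ` B \<subseteq> carrier A" "h t \<in> carrier A" using B t by auto
  with 1 2 3 4 p show ?thesis unfolding finite_chain_ring_def by blast
qed

text \<open>The library knows \<open>univ_poly R (carrier R)\<close> to be a ring only over a domain \<open>R\<close>. Over
  \<open>\<int>/m\<close> this and the arithmetic of the quotients are pulled back to \<open>int poly\<close>.\<close>

definition theta :: "int \<Rightarrow> int poly \<Rightarrow> int list" where
  "theta m P = ring.normalize (residue_ring m) (map (\<lambda>i. Polynomial.coeff P i mod m) (rev [0..<Suc (Polynomial.degree P)]))"

context residues
begin

abbreviation "RX \<equiv> univ_poly R (carrier R)"

lemma coeff_map_rev: "coeff (map c (rev [0..<n])) i = (if i < n then c i else \<zero>)"
  by (induction n) auto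

lemma theta_coeff: "coeff (theta m P) i = Polynomial.coeff P i mod m"
proof -
  have "coeff (theta m P) i = coeff (map (\<lambda>i. Polynomial.coeff P i mod m) (rev [0..<Suc (Polynomial.degree P)])) i"
    unfolding theta_def R_m_def[symmetric] by (metis normalize_coeff)
  also have "\<dots> = Polynomial.coeff P i mod m"
    unfolding coeff_map_rev by (auto simp: res_zero_eq coeff_eq_0)
  finally show ?thesis .
qed

lemma theta_closed: "theta m P \<in> carrier RX"
  unfolding univ_poly_carrier[symmetric] theta_def R_m_def[symmetric]
  by (intro normalize_gives_polynomial) (use m_gt_one in \<open>auto simp: res_carrier_eq\<close>)

lemma RX_eqI: "p \<in> carrier RX \<Longrightarrow> q \<in> carrier RX \<Longrightarrow> (\<And>i. coeff p i = coeff q i) \<Longrightarrow> p = q"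
  unfolding univ_poly_carrier[symmetric] using coeff_iff_polynomial_cond by blast

lemma RX_set: "p \<in> carrier RX \<Longrightarrow> set p \<subseteq> carrier R"
  unfolding univ_poly_carrier[symmetric] using polynomial_in_carrier[OF carrier_is_subring] by blast

lemma theta_add: "theta m (P + Q) = theta m P \<oplus>\<^bsub>RX\<^esub> theta m Q"
proof (rule RX_eqI[OF theta_closed])
  show "theta m P \<oplus>\<^bsub>RX\<^esub> theta m Q \<in> carrier RX"
    using poly_add_is_polynomial[OF carrier_is_subring RX_set[OF theta_closed] RX_set[OF theta_closed]]
    unfolding univ_poly_carrier[symmetric] univ_poly_add .
  show "coeff (theta m (P + Q)) i = coeff (theta m P \<oplus>\<^bsub>RX\<^esub> theta m Q) i" for i
    unfolding univ_poly_add poly_add_coeff[OF RX_set[OF theta_closed] RX_set[OF theta_closed]] theta_coeff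
    by (simp add: add_cong)
qed

lemma theta_mult: "theta m (P * Q) = theta m P \<otimes>\<^bsub>RX\<^esub> theta m Q"
proof (rule RX_eqI[OF theta_closed])
  show "theta m P \<otimes>\<^bsub>RX\<^esub> theta m Q \<in> carrier RX"
    using poly_mult_is_polynomial[OF carrier_is_subring RX_set[OF theta_closed] RX_set[OF theta_closed]]
    unfolding univ_poly_carrier[symmetric] univ_poly_mult .
  show "coeff (theta m (P * Q)) i = coeff (theta m P \<otimes>\<^bsub>RX\<^esub> theta m Q) i" for i
    unfolding univ_poly_mult poly_mult_coeff[OF RX_set[OF theta_closed] RX_set[OF theta_closed]] theta_coeff
    by (simp only: coeff_mult mult_cong sum_cong[OF finite_atMost])
qed

lemma theta_one: "theta m 1 = \<one>\<^bsub>RX\<^esub>"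
proof (rule RX_eqI[OF theta_closed])
  show "\<one>\<^bsub>RX\<^esub> \<in> carrier RX" proof -
    have "\<one> \<noteq> \<zero>" by (simp add: res_one_eq res_zero_eq)
    thus ?thesis unfolding univ_poly_carrier[symmetric] univ_poly_one polynomial_def by simp
  qed
  show "coeff (theta m 1) i = coeff \<one>\<^bsub>RX\<^esub> i" for i
    unfolding theta_coeff univ_poly_one using m_gt_one by (simp add: res_zero_eq res_one_eq)
qed

lemma theta_Poly: assumes g: "g \<in> carrier RX" shows "theta m (Poly (rev g)) = g"
proof (rule RX_eqI[OF theta_closed g])
  fix i
  show "coeff (theta m (Poly (rev g))) i = coeff g i"
  proof (cases "i < length g")
    case True
    have "g ! (length g - 1 - i) \<in> carrier R" using RX_set[OF g] True by (auto intro!: subsetD[OF RX_set[OF g]] nth_mem)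
    thus ?thesis using True unfolding theta_coeff coeff_nth[OF True]
      by (simp add: nth_default_def rev_nth res_carrier_eq)
  next
    case False
    thus ?thesis unfolding theta_coeff by (simp add: nth_default_def coeff_length res_zero_eq)
  qed
qed

lemma theta_surj: "g \<in> carrier RX \<Longrightarrow> \<exists>P. g = theta m P"
  using theta_Poly by metis

lemma theta_0: "theta m 0 = \<zero>\<^bsub>RX\<^esub>"
proof (rule RX_eqI[OF theta_closed])
  show "\<zero>\<^bsub>RX\<^esub> \<in> carrier RX" unfolding univ_poly_carrier[symmetric] univ_poly_zero by (simp add: polynomial_def)
qed (simp add: theta_coeff univ_poly_zero res_zero_eq)

lemma theta_eq_iff: assumes "theta m P = theta m Q" shows "\<exists>H. P = Q + [:m:] * H"
proof -
  have "Polynomial.coeff (P - Q) i mod m = 0" for i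
    using theta_coeff[of P i] theta_coeff[of Q i] assms by (simp add: mod_eq_dvd_iff[symmetric] dvd_eq_mod_eq_0[symmetric])
  hence "[:m:] dvd P - Q" by (simp add: const_poly_dvd_iff dvd_eq_mod_eq_0)
  then obtain H where "P - Q = [:m:] * H" by (auto simp: dvd_def)
  hence "P = Q + [:m:] * H" by (simp add: algebra_simps)
  thus ?thesis by blast
qed

lemma cring_RX: "cring RX"
proof -
  have neg: "theta m (- P) \<oplus>\<^bsub>RX\<^esub> theta m P = \<zero>\<^bsub>RX\<^esub>" for P
    unfolding theta_add[symmetric] by (simp add: theta_0)
  show ?thesis
  proof (intro cringI abelian_groupI comm_monoidI)
    fix x assume "x \<in> carrier RX"
    then obtain P where "x = theta m P" using theta_surj by blast
    thus "\<exists>y\<in>carrier RX. y \<oplus>\<^bsub>RX\<^esub> x = \<zero>\<^bsub>RX\<^esub>" using neg theta_closed by blast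
  qed (auto dest!: theta_surj simp: theta_0[symmetric] theta_one[symmetric] theta_add[symmetric]
      theta_mult[symmetric] theta_closed algebra_simps)
qed

end

lemma (in cring) rupture_cring:
  assumes "cring (univ_poly R (carrier R))" "f \<in> carrier (univ_poly R (carrier R))"
  shows "ideal (PIdl\<^bsub>univ_poly R (carrier R)\<^esub> f) (univ_poly R (carrier R))" "cring (rupture R (carrier R) f)"
    "f \<in> PIdl\<^bsub>univ_poly R (carrier R)\<^esub> f"
proof -
  interpret U: cring "univ_poly R (carrier R)" by fact
  show i: "ideal (PIdl\<^bsub>univ_poly R (carrier R)\<^esub> f) (univ_poly R (carrier R))" using U.cgenideal_ideal assms by blast
  show "cring (rupture R (carrier R) f)" unfolding rupture_def by (rule ideal.quotient_is_cring[OF i U.is_cring])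
  show "f \<in> PIdl\<^bsub>univ_poly R (carrier R)\<^esub> f" using U.cgenideal_self assms by blast
qed

text \<open>Here t is the class of p. Modulo p the quotient by f is a field: a polynomial P either
  vanishes there and is G k + p H, whose class is a multiple of t, or has an inverse S with S P = G
  k + 1 + p H, whose class is 1 plus a nilpotent. Remainders modulo f with coefficients in the prime
  field represent the residue classes.\<close>

lemma galois_finite_chain_ring:
  assumes p: "Factorial_Ring.prime p" and l: "l \<ge> 1" and f: "galois_polynomial p l d f"
  defines "Q \<equiv> rupture (residue_ring (int p ^ l)) (carrier (residue_ring (int p ^ l))) f"
  shows "cring Q" "finite_chain_ring Q p"
proof -
  let ?R = "residue_ring (int p ^ l)" and ?F = "residue_ring (int p)"
  have p2: "p \<ge> 2" using p by (rule prime_ge_2_nat)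
  have "int p ^ l > 1" using p2 l by (simp add: one_less_power)
  then interpret R: residues "int p ^ l" ?R by unfold_locales auto
  interpret F: residues_prime p ?F using p by unfold_locales auto
  let ?U = "univ_poly ?R (carrier ?R)" and ?V = "univ_poly ?F (carrier ?F)"
  have f': "f \<in> carrier ?U" "pirreducible\<^bsub>?F\<^esub> (carrier ?F) (map (\<lambda>a. a mod int p) f)" "f \<noteq> []" "hd f = 1"
    using f unfolding galois_polynomial_def by auto
  let ?J = "PIdl\<^bsub>?U\<^esub> f"
  interpret U: cring ?U by (rule R.cring_RX)
  interpret J: ideal ?J ?U by (rule R.rupture_cring[OF R.cring_RX f'(1)])
  show Qc: "cring Q" unfolding Q_def by (rule R.rupture_cring[OF R.cring_RX f'(1)])
  interpret Q: cring Q by fact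
  have Qdef: "Q = ?U Quot ?J" by (simp add: Q_def rupture_def)
  define c where "c P = ?J +>\<^bsub>?U\<^esub> theta (int p ^ l) P" for P
  have hom: "(+>\<^bsub>?U\<^esub>) ?J \<in> ring_hom ?U Q" unfolding Qdef by (rule J.rcos_ring_hom)
  note hm = ring_hom_memE[OF hom]
  have c_closed: "c P \<in> carrier Q" for P unfolding c_def using hm(1)[OF R.theta_closed] .
  have c_add: "c (P + P') = c P \<oplus>\<^bsub>Q\<^esub> c P'" for P P'
    unfolding c_def R.theta_add by (rule hm(3)[OF R.theta_closed R.theta_closed])
  have c_mult: "c (P * P') = c P \<otimes>\<^bsub>Q\<^esub> c P'" for P P'
    unfolding c_def R.theta_mult by (rule hm(2)[OF R.theta_closed R.theta_closed])
  have c_one: "c 1 = \<one>\<^bsub>Q\<^esub>" unfolding c_def R.theta_one by (rule hm(4))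
  have c_surj: "\<exists>P. a = c P" if "a \<in> carrier Q" for a
    using that R.theta_surj unfolding Qdef FactRing_def A_RCOSETS_def' c_def by auto
  have c_zero: "c 0 = \<zero>\<^bsub>Q\<^esub>"
    using c_add[of 0 0] Q.add.r_cancel_one'[OF c_closed[of 0] c_closed[of 0]] by simp
  have c_nat: "c (of_nat k) = add_pow Q k \<one>\<^bsub>Q\<^esub>" for k
    by (induction k) (simp_all add: c_zero c_add c_one Q.a_comm c_closed)
  have c_power: "c (P ^ k) = c P [^]\<^bsub>Q\<^esub> k" for P k
    by (induction k) (simp_all add: c_one c_mult Q.m_comm c_closed)
  have pp: "[:int p:] = of_nat p" by (simp add: of_nat_poly)
  define t where "t = c [:int p:]"
  have t: "t = add_pow Q p \<one>\<^bsub>Q\<^esub>" unfolding t_def pp by (rule c_nat)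
  have "theta (int p ^ l) ([:int p:] ^ l) = \<zero>\<^bsub>?U\<^esub>"
  proof (rule R.RX_eqI[OF R.theta_closed])
    show "R.coeff (theta (int p ^ l) ([:int p:] ^ l)) i = R.coeff \<zero>\<^bsub>?U\<^esub> i" for i
      unfolding R.theta_coeff by (simp add: univ_poly_zero R.res_zero_eq poly_const_pow coeff_pCons split: nat.split)
  qed (rule U.zero_closed)
  hence "c ([:int p:] ^ l) = \<zero>\<^bsub>Q\<^esub>" using c_zero unfolding c_def R.theta_0 by simp
  hence tl: "t [^]\<^bsub>Q\<^esub> l = \<zero>\<^bsub>Q\<^esub>" unfolding t_def c_power .
  define G where "G = Poly (rev f)"
  have G: "theta (int p ^ l) G = f" unfolding G_def by (rule R.theta_Poly[OF f'(1)])
  have cG: "c G = \<zero>\<^bsub>Q\<^esub>"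
  proof -
    have "f \<in> ?J" by (rule R.rupture_cring[OF R.cring_RX f'(1)])
    thus ?thesis unfolding c_def G Qdef using J.a_rcos_const by (simp add: FactRing_def)
  qed
  let ?f = "map (\<lambda>a. a mod int p) f"
  have fV: "?f \<in> carrier ?V"
  proof -
    have "hd ?f = 1" using f'(3,4) p2 by (cases f) auto
    thus ?thesis using p2 f'(3) unfolding univ_poly_carrier[symmetric] polynomial_def
      by (auto simp: F.res_carrier_eq F.res_zero_eq)
  qed
  have Gp: "theta (int p) G = ?f"
  proof (rule F.RX_eqI[OF F.theta_closed fV])
    fix i
    have "F.coeff (theta (int p) G) i = Polynomial.coeff G i mod int p" by (rule F.theta_coeff)
    also have "\<dots> = F.coeff ?f i"
    proof (cases "i < length f")
      case True
      hence "F.coeff ?f i = f ! (length f - 1 - i) mod int p" by (subst F.coeff_nth) auto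
      thus ?thesis using True by (simp add: G_def nth_default_def rev_nth)
    next
      case False
      hence "F.coeff ?f i = 0" using F.coeff_length[of ?f i] by (simp add: F.res_zero_eq)
      thus ?thesis using False by (simp add: G_def nth_default_def)
    qed
    finally show "F.coeff (theta (int p) G) i = F.coeff ?f i" .
  qed
  have sub: "subfield (carrier ?F) ?F" by (rule F.carrier_is_subfield)
  interpret V: cring ?V by (rule F.cring_RX)
  interpret I: ideal "PIdl\<^bsub>?V\<^esub> ?f" ?V by (rule F.rupture_cring[OF F.cring_RX fV])
  have Kf: "field (rupture ?F (carrier ?F) ?f)" using F.rupture_is_field_iff_pirreducible[OF sub fV] f'(2) by blast
  then interpret K: field "?V Quot (PIdl\<^bsub>?V\<^esub> ?f)" by (simp add: rupture_def)
  have homI: "(+>\<^bsub>?V\<^esub>) (PIdl\<^bsub>?V\<^esub> ?f) \<in> ring_hom ?V (?V Quot (PIdl\<^bsub>?V\<^esub> ?f))" by (rule I.rcos_ring_hom)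
  note hI = ring_hom_memE[OF homI]
  have memI: "\<exists>k. x = theta (int p) (G * k)" if x: "x \<in> PIdl\<^bsub>?V\<^esub> ?f" for x
  proof -
    obtain y where y: "y \<in> carrier ?V" "x = y \<otimes>\<^bsub>?V\<^esub> ?f" using x unfolding cgenideal_def by blast
    obtain k where "y = theta (int p) k" using F.theta_surj[OF y(1)] by blast
    hence "x = theta (int p) (G * k)" using y(2) V.m_comm[OF fV y(1)] unfolding F.theta_mult Gp by simp
    thus ?thesis by blast
  qed
  have loc: "a \<in> Units Q \<or> (\<exists>b\<in>carrier Q. a = t \<otimes>\<^bsub>Q\<^esub> b)" if a: "a \<in> carrier Q" for a
  proof -
    obtain P where P: "a = c P" using c_surj[OF a] by blast
    let ?\<pi> = "\<lambda>P. PIdl\<^bsub>?V\<^esub> ?f +>\<^bsub>?V\<^esub> theta (int p) P"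
    show ?thesis
    proof (cases "?\<pi> P = \<zero>\<^bsub>?V Quot (PIdl\<^bsub>?V\<^esub> ?f)\<^esub>")
      case True
      hence "theta (int p) P \<in> PIdl\<^bsub>?V\<^esub> ?f"
        using I.rcos_const_imp_mem[OF F.theta_closed] by (simp add: FactRing_def)
      then obtain k where "theta (int p) P = theta (int p) (G * k)" using memI by blast
      then obtain H where "P = G * k + [:int p:] * H" using F.theta_eq_iff by blast
      hence "a = t \<otimes>\<^bsub>Q\<^esub> c H" unfolding P t_def using c_closed by (simp add: c_add c_mult cG del: mult_pCons_left)
      thus ?thesis using c_closed by blast
    next
      case False
      have "?\<pi> P \<in> carrier (?V Quot (PIdl\<^bsub>?V\<^esub> ?f))" by (rule hI(1)[OF F.theta_closed])
      hence "?\<pi> P \<in> Units (?V Quot (PIdl\<^bsub>?V\<^esub> ?f))" using False K.field_Units by blast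
      then obtain y where y: "y \<in> carrier (?V Quot (PIdl\<^bsub>?V\<^esub> ?f))"
          "y \<otimes>\<^bsub>?V Quot (PIdl\<^bsub>?V\<^esub> ?f)\<^esub> ?\<pi> P = \<one>\<^bsub>?V Quot (PIdl\<^bsub>?V\<^esub> ?f)\<^esub>"
        unfolding Units_def by blast
      obtain S where S: "y = ?\<pi> S" using y(1) F.theta_surj unfolding FactRing_def A_RCOSETS_def' by auto
      have "?\<pi> (S * P) = ?\<pi> 1" using y(2) unfolding S F.theta_mult F.theta_one hI(4)
        using hI(2)[OF F.theta_closed F.theta_closed, of S P] by simp
      hence "theta (int p) (S * P) \<in> PIdl\<^bsub>?V\<^esub> ?f +>\<^bsub>?V\<^esub> theta (int p) 1"
        using I.a_rcos_self[OF F.theta_closed] by metis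
      then obtain x where x: "x \<in> PIdl\<^bsub>?V\<^esub> ?f" "theta (int p) (S * P) = x \<oplus>\<^bsub>?V\<^esub> theta (int p) 1"
        unfolding a_r_coset_def' by blast
      obtain k where "x = theta (int p) (G * k)" using memI[OF x(1)] by blast
      hence "theta (int p) (S * P) = theta (int p) (G * k + 1)" using x by (simp add: F.theta_add)
      then obtain H where "S * P = G * k + 1 + [:int p:] * H" using F.theta_eq_iff by blast
      hence "c S \<otimes>\<^bsub>Q\<^esub> a = \<one>\<^bsub>Q\<^esub> \<oplus>\<^bsub>Q\<^esub> t \<otimes>\<^bsub>Q\<^esub> c H" unfolding P t_def c_mult[symmetric] using c_closed
        by (simp add: c_add c_mult cG c_one del: mult_pCons_left)
      moreover have "(t \<otimes>\<^bsub>Q\<^esub> c H) [^]\<^bsub>Q\<^esub> l = \<zero>\<^bsub>Q\<^esub>" using tl c_closed by (simp add: Q.nat_pow_distrib t_def)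
      hence "\<one>\<^bsub>Q\<^esub> \<oplus>\<^bsub>Q\<^esub> t \<otimes>\<^bsub>Q\<^esub> c H \<in> Units Q" using c_closed by (intro Q.unit_add_nilpotent) (auto simp: t_def)
      ultimately have "a \<in> Units Q" using Q.unit_factor[of a "c S"] Q.m_comm[OF c_closed[of S] a] a c_closed by simp
      thus ?thesis by blast
    qed
  qed
  define B where "B = (\<lambda>r. c (Poly (rev r))) ` {r. set r \<subseteq> carrier ?F \<and> length r \<le> length f}"
  have "finite B" unfolding B_def using finite_lists_length_le[OF F.finite] by blast
  moreover have "B \<subseteq> carrier Q" unfolding B_def using c_closed by blast
  moreover have "\<exists>b\<in>B. \<exists>d\<in>carrier Q. a = b \<oplus>\<^bsub>Q\<^esub> t \<otimes>\<^bsub>Q\<^esub> d" if a: "a \<in> carrier Q" for a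
  proof -
    obtain P where P: "a = c P" using c_surj[OF a] by blast
    have f0: "?f \<noteq> \<zero>\<^bsub>?V\<^esub>" using f'(3) by (simp add: univ_poly_zero)
    obtain q r where qr: "q \<in> carrier ?V" "r \<in> carrier ?V" "theta (int p) P = ?f \<otimes>\<^bsub>?V\<^esub> q \<oplus>\<^bsub>?V\<^esub> r"
      "r = \<zero>\<^bsub>?V\<^esub> \<or> length r - 1 < length ?f - 1"
      using F.field_long_division_theorem_shell[OF sub F.theta_closed fV f0] by blast
    obtain k where k: "q = theta (int p) k" using F.theta_surj[OF qr(1)] by blast
    have "theta (int p) P = theta (int p) (G * k + Poly (rev r))"
      using qr(3) unfolding F.theta_add F.theta_mult Gp k F.theta_Poly[OF qr(2)] .
    then obtain H where "P = G * k + Poly (rev r) + [:int p:] * H" using F.theta_eq_iff by blast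
    hence "a = c (Poly (rev r)) \<oplus>\<^bsub>Q\<^esub> t \<otimes>\<^bsub>Q\<^esub> c H" unfolding P t_def using c_closed by (simp add: c_add c_mult cG del: mult_pCons_left)
    moreover have "length r \<le> length f" using qr(4) by (auto simp: univ_poly_zero)
    hence "c (Poly (rev r)) \<in> B" unfolding B_def using F.RX_set[OF qr(2)] by blast
    ultimately show ?thesis using c_closed by blast
  qed
  ultimately have "\<exists>B. finite B \<and> B \<subseteq> carrier Q \<and> (\<forall>a\<in>carrier Q. \<exists>b\<in>B. \<exists>c\<in>carrier Q. a = b \<oplus>\<^bsub>Q\<^esub> t \<otimes>\<^bsub>Q\<^esub> c)" by blast
  moreover have "t \<in> carrier Q" unfolding t_def by (rule c_closed)
  ultimately show "finite_chain_ring Q p" unfolding finite_chain_ring_def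
    using p tl loc t by (intro conjI bexI[of _ t]) blast+
qed

text \<open>Here t is the class of X, and division by X leaves a constant, which is 0 or a
  unit.\<close>

lemma quasi_galois_finite_chain_ring:
  fixes n :: nat
  assumes p: "Factorial_Ring.prime p" and F: "field F" and card: "card (carrier F) = p ^ m"
  defines "Q \<equiv> rupture F (carrier F) (X\<^bsub>F\<^esub> [^]\<^bsub>univ_poly F (carrier F)\<^esub> n)"
  shows "cring Q" "finite_chain_ring Q p"
proof -
  interpret F: field F by fact
  have sub: "subfield (carrier F) F" by (rule F.carrier_is_subfield)
  let ?U = "univ_poly F (carrier F)"
  interpret U: cring ?U by (rule F.univ_poly_is_cring[OF F.carrier_is_subring])
  have x: "X\<^bsub>F\<^esub> \<in> carrier ?U" by (rule F.var_closed(1)[OF F.carrier_is_subring])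
  let ?f = "X\<^bsub>F\<^esub> [^]\<^bsub>?U\<^esub> n"
  have f: "?f \<in> carrier ?U" using x by simp
  let ?J = "PIdl\<^bsub>?U\<^esub> ?f"
  interpret J: ideal ?J ?U by (rule F.rupture_cring[OF U.is_cring f])
  show Qc: "cring Q" unfolding Q_def by (rule F.rupture_cring[OF U.is_cring f])
  interpret Q: cring Q by fact
  have Qdef: "Q = ?U Quot ?J" by (simp add: Q_def rupture_def)
  define c where "c P = ?J +>\<^bsub>?U\<^esub> P" for P
  have hom: "c \<in> ring_hom ?U Q" unfolding Qdef c_def by (rule J.rcos_ring_hom)
  interpret c: ring_hom_cring ?U Q c
    by (intro ring_hom_cring.intro ring_hom_cring_axioms.intro U.is_cring Qc hom)
  have c_surj: "\<exists>P\<in>carrier ?U. a = c P" if "a \<in> carrier Q" for a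
    using that unfolding Qdef FactRing_def A_RCOSETS_def' c_def by auto
  define t where "t = c (X\<^bsub>F\<^esub>)"
  have t: "t \<in> carrier Q" unfolding t_def using x by simp
  have "c ?f = \<zero>\<^bsub>Q\<^esub>"
  proof -
    have "?f \<in> ?J" by (rule F.rupture_cring[OF U.is_cring f])
    thus ?thesis unfolding c_def Qdef using J.a_rcos_const by (simp add: FactRing_def)
  qed
  hence tn: "t [^]\<^bsub>Q\<^esub> n = \<zero>\<^bsub>Q\<^esub>" unfolding t_def using c.hom_pow[OF x, of n] by simp
  have div: "\<exists>q r. q \<in> carrier ?U \<and> r \<in> carrier ?U \<and> P = X\<^bsub>F\<^esub> \<otimes>\<^bsub>?U\<^esub> q \<oplus>\<^bsub>?U\<^esub> r \<and> (r = [] \<or> (\<exists>a\<in>carrier F - {\<zero>\<^bsub>F\<^esub>}. r = [a]))"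
    if P: "P \<in> carrier ?U" for P
  proof -
    have x0: "X\<^bsub>F\<^esub> \<noteq> \<zero>\<^bsub>?U\<^esub>" by (simp add: var_def univ_poly_zero)
    obtain q r where qr: "q \<in> carrier ?U" "r \<in> carrier ?U" "P = X\<^bsub>F\<^esub> \<otimes>\<^bsub>?U\<^esub> q \<oplus>\<^bsub>?U\<^esub> r"
      "r = \<zero>\<^bsub>?U\<^esub> \<or> length r - 1 < length X\<^bsub>F\<^esub> - 1"
      using F.field_long_division_theorem_shell[OF sub P x x0] by blast
    have "r = [] \<or> (\<exists>a\<in>carrier F - {\<zero>\<^bsub>F\<^esub>}. r = [a])"
    proof (cases r)
      case (Cons a as)
      hence "as = []" using qr(4) by (auto simp: univ_poly_zero var_def)
      moreover have "a \<in> carrier F - {\<zero>\<^bsub>F\<^esub>}" using qr(2) Cons unfolding univ_poly_carrier[symmetric] polynomial_def by auto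
      ultimately show ?thesis using Cons by blast
    qed simp
    thus ?thesis using qr by blast
  qed
  have const: "[a] \<in> carrier ?U" if "a \<in> carrier F - {\<zero>\<^bsub>F\<^esub>}" for a
    using that unfolding univ_poly_carrier[symmetric] polynomial_def by auto
  have const_unit: "c [a] \<in> Units Q" if a: "a \<in> carrier F - {\<zero>\<^bsub>F\<^esub>}" for a
  proof -
    have u: "a \<in> Units F" using a F.field_Units by blast
    have i: "inv\<^bsub>F\<^esub> a \<in> carrier F - {\<zero>\<^bsub>F\<^esub>}" using F.Units_inv_Units[OF u] F.field_Units by blast
    have m: "[a] \<otimes>\<^bsub>?U\<^esub> [inv\<^bsub>F\<^esub> a] = \<one>\<^bsub>?U\<^esub>"
      using a i F.Units_r_inv[OF u] by (simp add: univ_poly_mult univ_poly_one)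
    have "c [a] \<otimes>\<^bsub>Q\<^esub> c [inv\<^bsub>F\<^esub> a] = \<one>\<^bsub>Q\<^esub>" using c.hom_mult[OF const[OF a] const[OF i]] unfolding m by simp
    thus ?thesis using Q.unit_factor[of "c [a]" "c [inv\<^bsub>F\<^esub> a]"] const[OF a] const[OF i] by simp
  qed
  have rep: "\<exists>r d. d \<in> carrier Q \<and> a = c r \<oplus>\<^bsub>Q\<^esub> t \<otimes>\<^bsub>Q\<^esub> d \<and> r \<in> carrier ?U \<and> (r = [] \<or> (\<exists>a\<in>carrier F - {\<zero>\<^bsub>F\<^esub>}. r = [a]))"
    if a: "a \<in> carrier Q" for a
  proof -
    obtain P where P: "P \<in> carrier ?U" "a = c P" using c_surj[OF a] by blast
    obtain q r where qr: "q \<in> carrier ?U" "r \<in> carrier ?U" "P = X\<^bsub>F\<^esub> \<otimes>\<^bsub>?U\<^esub> q \<oplus>\<^bsub>?U\<^esub> r"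
       "r = [] \<or> (\<exists>a\<in>carrier F - {\<zero>\<^bsub>F\<^esub>}. r = [a])" using div[OF P(1)] by blast
    have "a = c r \<oplus>\<^bsub>Q\<^esub> t \<otimes>\<^bsub>Q\<^esub> c q" unfolding P(2) qr(3) t_def using qr x by (simp add: Q.a_comm)
    thus ?thesis using qr by blast
  qed
  have c0: "c [] = \<zero>\<^bsub>Q\<^esub>" using c.hom_zero by (simp add: univ_poly_zero)
  have loc: "a \<in> Units Q \<or> (\<exists>b\<in>carrier Q. a = t \<otimes>\<^bsub>Q\<^esub> b)" if a: "a \<in> carrier Q" for a
  proof -
    obtain r d where rd: "d \<in> carrier Q" "a = c r \<oplus>\<^bsub>Q\<^esub> t \<otimes>\<^bsub>Q\<^esub> d" "r \<in> carrier ?U" "r = [] \<or> (\<exists>a\<in>carrier F - {\<zero>\<^bsub>F\<^esub>}. r = [a])"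
      using rep[OF a] by blast
    show ?thesis using rd(4)
    proof
      assume "r = []"
      thus ?thesis using rd t c0 by auto
    next
      assume "\<exists>a\<in>carrier F - {\<zero>\<^bsub>F\<^esub>}. r = [a]"
      hence u: "c r \<in> Units Q" using const_unit by blast
      define v where "v = inv\<^bsub>Q\<^esub> (c r)"
      have v: "v \<in> carrier Q" "v \<otimes>\<^bsub>Q\<^esub> c r = \<one>\<^bsub>Q\<^esub>" using u by (auto simp: v_def)
      have "v \<otimes>\<^bsub>Q\<^esub> a = \<one>\<^bsub>Q\<^esub> \<oplus>\<^bsub>Q\<^esub> t \<otimes>\<^bsub>Q\<^esub> (v \<otimes>\<^bsub>Q\<^esub> d)" unfolding rd(2) using v rd t
        by (simp add: Q.r_distr Q.m_lcomm)
      moreover have "(t \<otimes>\<^bsub>Q\<^esub> (v \<otimes>\<^bsub>Q\<^esub> d)) [^]\<^bsub>Q\<^esub> n = \<zero>\<^bsub>Q\<^esub>" using tn v rd t by (simp add: Q.nat_pow_distrib)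
      hence "\<one>\<^bsub>Q\<^esub> \<oplus>\<^bsub>Q\<^esub> t \<otimes>\<^bsub>Q\<^esub> (v \<otimes>\<^bsub>Q\<^esub> d) \<in> Units Q" using v rd t by (intro Q.unit_add_nilpotent) auto
      ultimately have "a \<in> Units Q" using Q.unit_factor[of a v] Q.m_comm[OF v(1) a] a v by simp
      thus ?thesis by blast
    qed
  qed
  have finF: "finite (carrier F)" using card p by (metis card.infinite not_prime_0 power_eq_0_iff)
  have pm: "add_pow F (p ^ m) \<one>\<^bsub>F\<^esub> = \<zero>\<^bsub>F\<^esub>"
    using F.add.pow_order_eq_1[of "\<one>\<^bsub>F\<^esub>"] card by (simp add: Coset.order_def add_pow_def)
  \<comment> \<open>p^k 1 is the k-th power of p 1. As p^m is the order of F, p 1 is nilpotent,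
    hence 0 in a field.\<close>
  have "add_pow F (p ^ k) \<one>\<^bsub>F\<^esub> = (add_pow F p \<one>\<^bsub>F\<^esub>) [^]\<^bsub>F\<^esub> k" for k
  proof (induction k)
    case (Suc k)
    have "add_pow F (p ^ Suc k) \<one>\<^bsub>F\<^esub> = add_pow F (p ^ k) (add_pow F p \<one>\<^bsub>F\<^esub>)"
      using F.add.nat_pow_pow[of "\<one>\<^bsub>F\<^esub>" "p ^ k" p] by (simp add: add_pow_def)
    also have "\<dots> = add_pow F (p ^ k) \<one>\<^bsub>F\<^esub> \<otimes>\<^bsub>F\<^esub> add_pow F p \<one>\<^bsub>F\<^esub>" by (simp add: F.add_pow_ldistr)
    finally show ?case using Suc by simp
  qed simp
  hence charF: "add_pow F p \<one>\<^bsub>F\<^esub> = \<zero>\<^bsub>F\<^esub>" using pm F.nat_pow_eq_zero[of "add_pow F p \<one>\<^bsub>F\<^esub>" m] by simp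
  have cpow: "c (add_pow ?U k \<one>\<^bsub>?U\<^esub>) = add_pow Q k \<one>\<^bsub>Q\<^esub>" for k :: nat
    by (induction k) (simp_all add: const Q.a_comm)
  have Upow: "add_pow ?U k \<one>\<^bsub>?U\<^esub> = F.poly_of_const (add_pow F k \<one>\<^bsub>F\<^esub>)" for k :: nat
  proof (induction k)
    case 0
    show ?case by (simp add: F.poly_of_const_def univ_poly_zero)
  next
    case (Suc k)
    have "F.poly_of_const \<in> ring_hom (F \<lparr> carrier := carrier F \<rparr>) ?U" by (rule F.canonical_embedding_is_hom[OF F.carrier_is_subring])
    note h = ring_hom_memE[OF this]
    show ?case using h(3)[of "add_pow F k \<one>\<^bsub>F\<^esub>" "\<one>\<^bsub>F\<^esub>"] h(4) Suc by simp
  qed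
  have char: "add_pow Q p \<one>\<^bsub>Q\<^esub> = \<zero>\<^bsub>Q\<^esub>"
    unfolding cpow[symmetric] Upow charF by (simp add: F.poly_of_const_def c0)
  define B where "B = c ` (insert [] ((\<lambda>a. [a]) ` (carrier F - {\<zero>\<^bsub>F\<^esub>})))"
  have "finite B" unfolding B_def using finF by blast
  moreover have "B \<subseteq> carrier Q" unfolding B_def using const c0 by auto
  moreover have "\<exists>b\<in>B. \<exists>d\<in>carrier Q. a = b \<oplus>\<^bsub>Q\<^esub> t \<otimes>\<^bsub>Q\<^esub> d" if "a \<in> carrier Q" for a
    using rep[OF that] unfolding B_def by blast
  ultimately have "\<exists>B. finite B \<and> B \<subseteq> carrier Q \<and> (\<forall>a\<in>carrier Q. \<exists>b\<in>B. \<exists>c\<in>carrier Q. a = b \<oplus>\<^bsub>Q\<^esub> t \<otimes>\<^bsub>Q\<^esub> c)" by blast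
  thus "finite_chain_ring Q p" unfolding finite_chain_ring_def
    using p tn loc t char by (intro conjI bexI[of _ t]) blast+
qed

theorem theoremD:
  fixes A :: "('a, 'r) ring_scheme" and M :: "'a set"
  assumes "galois_ring A \<or> quasi_galois_ring A"
    and "maximalideal M A"
    and "odd (ring_char (A Quot M))"
    and "card (carrier (A Quot M)) \<notin> {3, 5, 9}"
  shows "trivial_group (group_homology 2 (SL2 A))"
proof -
  have "cring A \<and> (\<exists>p. finite_chain_ring A p)"
    using assms(1)
  proof
    assume "galois_ring A"
    then obtain p l m f where A: "cring A" and p: "Factorial_Ring.prime p" "l \<ge> 1" "galois_polynomial p l m f"
      and iso: "A \<simeq> rupture (residue_ring (int p ^ l)) (carrier (residue_ring (int p ^ l))) f"
      unfolding galois_ring_def by blast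
    show ?thesis using A finite_chain_ring_iso[OF A galois_finite_chain_ring(1)[OF p] iso galois_finite_chain_ring(2)[OF p]] by blast
  next
    assume "quasi_galois_ring A"
    then obtain p m n and F :: "nat ring" where A: "cring A" and p: "Factorial_Ring.prime p" "field F" "card (carrier F) = p ^ m"
      and iso: "A \<simeq> rupture F (carrier F) (X\<^bsub>F\<^esub> [^]\<^bsub>univ_poly F (carrier F)\<^esub> (n::nat))"
      unfolding quasi_galois_ring_def by blast
    show ?thesis
      using A finite_chain_ring_iso[OF A quasi_galois_finite_chain_ring(1)[OF p] iso quasi_galois_finite_chain_ring(2)[OF p]]
      by blast
  qed
  then obtain p where A: "cring A" and ch: "finite_chain_ring A p" by blast
  interpret cring A by fact
  interpret M: maximalideal M A by fact
  obtain n t g r where gp: "good_param A p n t g r"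
    using finite_chain_ring_good_param[OF A assms(2) ch assms(3,4)] by blast
  have "\<one>\<^bsub>A\<^esub> \<noteq> \<zero>\<^bsub>A\<^esub>"
    using M.one_imp_carrier M.I_notcarr additive_subgroup.zero_closed[OF M.is_additive_subgroup] by metis
  thus ?thesis by (rule good_param_trivial_homology[OF A _ gp])
qed

end
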